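(* Let $\mathcal G$ be a finite directed graph (loops and multiple arcs allowed) and let $(X,\nu)$ be a probability space. Suppose that to each arc $e$ of $\mathcal G$ a measure-preserving transformation $T_e$ of $(X,\nu)$ is assigned. For a finite path $l=e_1\dots e_k$ in $\mathcal G$ put $T_l=T_{e_1}\cdots T_{e_k}$ (the identity for the empty path), acting on functions by $T_l\varphi=\varphi\circ T_l$. For a finite set $L$ of paths put $s(L)=\frac{1}{\#L}\sum_{l\in L}T_l$ if $L\neq\varnothing$ and $s(\varnothing)=0$. For vertices $u,v$ and $n\ge 0$ let $L_{u,v,n}$ be the set of paths of length $n$ from $u$ to $v$ (where $L_{u,u,0}$ consists of the empty path at $u$ and $L_{u,v,0}=\varnothing$ for $u\ne v$), and $L_{u,*,n}=\bigcup_{v}L_{u,v,n}$. Define $$c_{u,v,N}=\frac1N\sum_{n=0}^{N-1}s(L_{u,v,n}),\qquad c_{u,*,N}=\frac1N\sum_{n=0}^{N-1}s(L_{u,*,n}).$$ Then for all vertices $u,v,v_0$ of $\mathcal G$: (1a) for every $p\in[1,\infty)$ and $\varphi\in L^p(X,\nu)$ the sequence $c_{u,v,N}(\varphi)$ converges in $L^p(X,\nu)$; (1b) for every $\varphi\in L^\infty(X,\nu)$ the sequence $c_{u,v,N}(\varphi)$ converges $\nu$-almost everywhere; (2a) for every $p\in[1,\infty)$ and $\varphi\in L^p(X,\nu)$ the sequence $c_{v_0,*,N}(\varphi)$ converges in $L^p(X,\nu)$; (2b) for every $\varphi\in L^\infty(X,\nu)$ the sequence $c_{v_0,*,N}(\varphi)$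 converges $\nu$-almost everywhere.
   Context: A path $e_1\dots e_k$ is a sequence of arcs with the head of $e_{j-1}$ equal to the tail of $e_j$; its length is $k$; it goes from the tail of $e_1$ to the head of $e_k$. *)

theory Defs
  imports "HOL-Probability.Probability" "Graph_Theory.Digraph" "Graph_Theory.Arc_Walk"
begin

definition mpt :: "'x measure \<Rightarrow> ('x \<Rightarrow> 'x) \<Rightarrow> bool" where
  "mpt M T \<longleftrightarrow> T \<in> M \<rightarrow>\<^sub>M M \<and> distr M M T = M"

definition path_map :: "('b \<Rightarrow> 'x \<Rightarrow> 'x) \<Rightarrow> 'b list \<Rightarrow> 'x \<Rightarrow> 'x" where
  "path_map T l = foldr (\<lambda>e f. T e \<circ> f) l id"

definition avg_op :: "('b \<Rightarrow> 'x \<Rightarrow> 'x) \<Rightarrow> 'b list set \<Rightarrow> ('x \<Rightarrow> real) \<Rightarrow> 'x \<Rightarrow> real" where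
  "avg_op T L \<phi> x = (if L = {} then 0
      else (1 / real (card L)) * (\<Sum>l\<in>L. \<phi> (path_map T l x)))"

definition paths_uv :: "('a,'b) pre_digraph \<Rightarrow> 'a \<Rightarrow> 'a \<Rightarrow> nat \<Rightarrow> 'b list set" where
  "paths_uv G u v n = {l. pre_digraph.awalk G u l v \<and> length l = n}"

definition paths_u :: "('a,'b) pre_digraph \<Rightarrow> 'a \<Rightarrow> nat \<Rightarrow> 'b list set" where
  "paths_u G u n = (\<Union>v\<in>verts G. paths_uv G u v n)"

definition c_uv :: "('a,'b) pre_digraph \<Rightarrow> ('b \<Rightarrow> 'x \<Rightarrow> 'x) \<Rightarrow> 'a \<Rightarrow> 'a \<Rightarrow> nat
    \<Rightarrow> ('x \<Rightarrow> real) \<Rightarrow> 'x \<Rightarrow> real" where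
  "c_uv G T u v N \<phi> x = (1 / real N) * (\<Sum>n<N. avg_op T (paths_uv G u v n) \<phi> x)"

definition c_u :: "('a,'b) pre_digraph \<Rightarrow> ('b \<Rightarrow> 'x \<Rightarrow> 'x) \<Rightarrow> 'a \<Rightarrow> nat
    \<Rightarrow> ('x \<Rightarrow> real) \<Rightarrow> 'x \<Rightarrow> real" where
  "c_u G T u N \<phi> x = (1 / real N) * (\<Sum>n<N. avg_op T (paths_u G u n) \<phi> x)"

definition in_Lp :: "'x measure \<Rightarrow> real \<Rightarrow> ('x \<Rightarrow> real) \<Rightarrow> bool" where
  "in_Lp M p f \<longleftrightarrow> f \<in> borel_measurable M \<and> integrable M (\<lambda>x. \<bar>f x\<bar> powr p)"

definition in_Linf :: "'x measure \<Rightarrow> ('x \<Rightarrow> real) \<Rightarrow> bool" where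
  "in_Linf M f \<longleftrightarrow> f \<in> borel_measurable M \<and> (\<exists>C. AE x in M. \<bar>f x\<bar> \<le> C)"

definition Lp_convergent :: "'x measure \<Rightarrow> real \<Rightarrow> (nat \<Rightarrow> 'x \<Rightarrow> real) \<Rightarrow> bool" where
  "Lp_convergent M p F \<longleftrightarrow> (\<exists>g. in_Lp M p g \<and>
      (\<lambda>N. \<integral>x. \<bar>F N x - g x\<bar> powr p \<partial>M) \<longlonglongrightarrow> 0)"

end

theory Submission
  imports Defs
begin

text \<open>
  Let \<open>S n u v\<close> be the sum of the operators \<open>T\<^sub>l\<close> over the paths of length \<open>n\<close> from \<open>u\<close> to \<open>v\<close>.
  Splitting off the last arc turns \<open>n \<mapsto> S n u v \<phi>\<close> into an orbit of a matrix of positive operators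
  whose scalar shadow (its action on constants) is the adjacency matrix. Passing to a power \<open>d\<close> for which
  the zero pattern of the adjacency matrix is idempotent, every recurrent class becomes a strictly positive
  block, so its powers are asymptotic to \<open>L u v * \<lambda>\<^sup>n\<close>. Conjugating the block by its Perron eigenvectors gives
  a Markov operator with an invariant measure, to which a pointwise ergodic theorem applies.
  Going through the classes in topological order, each new class contributes a convolution, which is
  handled according to whether \<open>\<lambda>\<close> is smaller than, equal to or larger than the previous growth rate.
  In every residue class modulo \<open>d\<close> the number of paths is thus asymptotic to \<open>c * n\<^sup>k * \<lambda>\<^sup>n\<close> (or vanishes), and
  Abel summation converts averages weighted by \<open>n\<^sup>k * \<lambda>\<^sup>n\<close> into the averages of the normalised sums.
  Convergence in \<open>L\<^sup>p\<close> follows by truncation, since the averages contract the \<open>L\<^sup>p\<close> norm.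
\<close>

section \<open>Positive operators preserving the integral\<close>

text \<open>The last arc is the right one to split off: \<open>T\<^sub>l\<close> applies it to
  points first, so as an operator it acts outermost, and the family \<open>S (n + 1) u v\<close> is
  a fixed operator matrix applied to the family \<open>S n u z\<close>. Two obstacles shape the
  argument. Path counts oscillate with \<open>n\<close> when cycle lengths have a common divisor;
  hence the passage to residue classes. And along a chain of recurrent classes sharing the growth
  rate \<open>\<lambda>\<close> the counts pick up powers of \<open>n\<close>, while the block
  operators divided by \<open>\<lambda>\<^sup>n\<close> need not converge: only their averages do.
  In that resonant case no limit can be taken inside the convolution term by term, so the induction
  carries convergence of weighted partial sums instead of convergence of single terms. The blocks
  are sums over several maps, which is why the ergodic theorem is proved for operators. Bounds and
  operator identities are required at every point, so that operators act on functions themselves;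
  exceptional null sets enter only with limits.\<close>

definition bmf :: "'x measure \<Rightarrow> ('x \<Rightarrow> real) \<Rightarrow> bool" where
  "bmf M f \<longleftrightarrow> f \<in> borel_measurable M \<and> (\<exists>K. \<forall>x. \<bar>f x\<bar> \<le> K)"

text \<open>Finite sums of Koopman operators \<open>f \<mapsto> f \<circ> \<tau>\<close> with \<open>\<tau>\<close> measure preserving are of this kind, \<open>b\<close> being the
  number of summands; keeping the class abstract makes it closed under composition and positive weights.\<close>

definition pos_op :: "'x measure \<Rightarrow> real \<Rightarrow> (('x \<Rightarrow> real) \<Rightarrow> 'x \<Rightarrow> real) \<Rightarrow> bool" where
  "pos_op M b A \<longleftrightarrow>
     (\<forall>f\<in>borel_measurable M. A f \<in> borel_measurable M) \<and>
     (\<forall>f g x. A (\<lambda>y. f y + g y) x = A f x + A g x) \<and>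
     (\<forall>c f x. A (\<lambda>y. c * f y) x = c * A f x) \<and>
     (\<forall>f g x. (\<forall>y. f y \<le> g y) \<longrightarrow> A f x \<le> A g x) \<and>
     (\<forall>x. A (\<lambda>_. 1) x = b) \<and>
     (\<forall>f. bmf M f \<longrightarrow> (\<integral>x. A f x \<partial>M) = b * (\<integral>x. f x \<partial>M)) \<and>
     (\<forall>(F :: nat \<Rightarrow> 'x \<Rightarrow> real) f. (\<forall>y. (\<lambda>n. F n y) \<longlonglongrightarrow> f y) \<longrightarrow> (\<forall>x. (\<lambda>n. A (F n) x) \<longlonglongrightarrow> A f x))"

lemma bmfI: "f \<in> borel_measurable M \<Longrightarrow> (\<And>x. \<bar>f x\<bar> \<le> K) \<Longrightarrow> bmf M f"
  by (auto simp: bmf_def)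

lemma bmf_measurable[measurable_dest]: "bmf M f \<Longrightarrow> f \<in> borel_measurable M"
  by (simp add: bmf_def)

lemma bmfE:
  assumes "bmf M f" obtains K where "K \<ge> 0" "\<And>x. \<bar>f x\<bar> \<le> K"
  using assms unfolding bmf_def by (meson abs_ge_zero order_trans)

lemma bmf_const: "bmf M (\<lambda>_. c)"
  by (rule bmfI[where K="\<bar>c\<bar>"]) auto

lemma bmf_add: assumes "bmf M f" "bmf M g" shows "bmf M (\<lambda>x. f x + g x)"
proof -
  obtain K L where "\<And>x. \<bar>f x\<bar> \<le> K" "\<And>x. \<bar>g x\<bar> \<le> L" using assms by (meson bmfE)
  then have "\<bar>f x + g x\<bar> \<le> K + L" for x
    by (meson abs_triangle_ineq add_mono order_trans)
  then show ?thesis using assms by (intro bmfI[where K="K+L"]) auto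
qed

lemma bmf_mult: assumes "bmf M f" "bmf M g" shows "bmf M (\<lambda>x. f x * g x)"
proof -
  obtain K L where "\<And>x. \<bar>f x\<bar> \<le> K" "\<And>x. \<bar>g x\<bar> \<le> L" "K \<ge> 0" using assms by (meson bmfE)
  then have "\<bar>f x * g x\<bar> \<le> K * L" for x
    by (simp add: abs_mult mult_mono)
  then show ?thesis using assms by (intro bmfI[where K="K*L"]) auto
qed

lemma bmf_cmult: "bmf M f \<Longrightarrow> bmf M (\<lambda>x. c * f x)"
  using bmf_mult[OF bmf_const] by blast

lemma bmf_diff: "bmf M f \<Longrightarrow> bmf M g \<Longrightarrow> bmf M (\<lambda>x. f x - g x)"
  using bmf_add[OF _ bmf_cmult[of M g "-1"], of f] by simp

lemma bmf_sum: "(\<And>i. i \<in> I \<Longrightarrow> bmf M (f i)) \<Longrightarrow> bmf M (\<lambda>x. \<Sum>i\<in>I. f i x)"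
  by (induction I rule: infinite_finite_induct) (auto intro: bmf_add bmf_const)

lemma bmf_max: assumes "bmf M f" "bmf M g" shows "bmf M (\<lambda>x. max (f x) (g x))"
proof -
  obtain K L where "\<And>x. \<bar>f x\<bar> \<le> K" "\<And>x. \<bar>g x\<bar> \<le> L" using assms by (meson bmfE)
  then have "\<bar>max (f x) (g x)\<bar> \<le> max K L" for x
    by (smt (verit))
  then show ?thesis using assms by (intro bmfI[where K="max K L"]) auto
qed

lemma bmf_abs: "bmf M f \<Longrightarrow> bmf M (\<lambda>x. \<bar>f x\<bar>)"
  unfolding bmf_def by auto

lemma bmf_indicator: "S \<in> sets M \<Longrightarrow> bmf M (indicator S)"
  by (rule bmfI[where K=1]) (auto simp: indicator_def)

lemma bmf_integrable: "finite_measure M \<Longrightarrow> bmf M f \<Longrightarrow> integrable M f"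
  unfolding bmf_def by (metis (no_types, lifting) AE_I2 finite_measure.integrable_const_bound real_norm_def)

lemma
  assumes "pos_op M b A"
  shows pos_op_measurable: "f \<in> borel_measurable M \<Longrightarrow> A f \<in> borel_measurable M"
    and pos_op_add: "A (\<lambda>y. f y + g y) x = A f x + A g x"
    and pos_op_cmult: "A (\<lambda>y. c * f y) x = c * A f x"
    and pos_op_mono: "(\<And>y. f y \<le> g y) \<Longrightarrow> A f x \<le> A g x"
    and pos_op_one: "A (\<lambda>_. 1) x = b"
    and pos_op_integral: "bmf M f \<Longrightarrow> (\<integral>x. A f x \<partial>M) = b * (\<integral>x. f x \<partial>M)"
    and pos_op_lim: "(\<And>y. (\<lambda>n. F n y) \<longlonglongrightarrow> f y) \<Longrightarrow> (\<lambda>n. A (F n) x) \<longlonglongrightarrow> A f x"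
  using assms unfolding pos_op_def by blast+

lemma pos_op_const: assumes "pos_op M b A" shows "A (\<lambda>_. c) x = b * c"
  using pos_op_cmult[OF assms, of c "\<lambda>_. 1" x] pos_op_one[OF assms, of x] by simp

lemma pos_op_diff: assumes "pos_op M b A" shows "A (\<lambda>y. f y - g y) x = A f x - A g x"
  using pos_op_add[OF assms, of f "\<lambda>y. (-1) * g y" x] pos_op_cmult[OF assms, of "-1" g x] by simp

lemma pos_op_uminus: assumes "pos_op M b A" shows "A (\<lambda>y. - g y) x = - A g x"
  using pos_op_cmult[OF assms, of "-1" g x] by simp

lemma pos_op_nonneg: assumes "pos_op M b A" "\<And>y. 0 \<le> f y" shows "0 \<le> A f x"
  using pos_op_mono[OF assms(1), of "\<lambda>_. 0" f x] pos_op_const[OF assms(1), of 0 x] assms(2) by simp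

lemma pos_op_factor_nonneg: assumes "pos_op M b A" shows "0 \<le> b"
  using pos_op_nonneg[OF assms, of "\<lambda>_. 1"] pos_op_one[OF assms] by simp

lemma pos_op_abs_le_op: assumes "pos_op M b A" "\<And>y. \<bar>f y\<bar> \<le> g y" shows "\<bar>A f x\<bar> \<le> A g x"
proof -
  have "A f x \<le> A g x" using assms(2) by (intro pos_op_mono[OF assms(1)]) (meson abs_le_D1)
  moreover have "A (\<lambda>y. - f y) x \<le> A g x" using assms(2) by (intro pos_op_mono[OF assms(1)]) (meson abs_le_D2)
  ultimately show ?thesis by (simp add: pos_op_uminus[OF assms(1)])
qed

lemma pos_op_abs_le: assumes "pos_op M b A" "\<And>y. \<bar>f y\<bar> \<le> K" shows "\<bar>A f x\<bar> \<le> b * K"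
  using pos_op_abs_le_op[OF assms(1), of f "\<lambda>_. K"] assms(2) by (simp add: pos_op_const[OF assms(1)])

lemma pos_op_sum:
  assumes "pos_op M b A" shows "A (\<lambda>y. \<Sum>i\<in>I. f i y) x = (\<Sum>i\<in>I. A (f i) x)"
  by (induction I rule: infinite_finite_induct)
    (auto simp: pos_op_add[OF assms] pos_op_const[OF assms])

lemma pos_op_bmf: assumes "pos_op M b A" "bmf M f" shows "bmf M (A f)"
proof -
  obtain K where "\<And>x. \<bar>f x\<bar> \<le> K" using assms(2) by (meson bmfE)
  then show ?thesis
    using assms by (intro bmfI[where K="b*K"] pos_op_measurable[OF assms(1)] pos_op_abs_le[OF assms(1)]) (auto simp: bmf_def)
qed

text \<open>\<open>A\<close> is defined on functions, so compatibility with null sets needs an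
  argument: the integral of \<open>A \<bar>f - g\<bar>\<close> is \<open>b\<close> times that of
  \<open>\<bar>f - g\<bar>\<close>, hence 0, and this nonnegative function dominates
  \<open>\<bar>A f - A g\<bar>\<close>.\<close>

lemma pos_op_AE_eq:
  assumes A: "pos_op M b A" and M: "finite_measure M" and f: "bmf M f" and g: "bmf M g"
    and eq: "AE x in M. f x = g x"
  shows "AE x in M. A f x = A g x"
proof -
  define h where "h = (\<lambda>x. \<bar>f x - g x\<bar>)"
  have h: "bmf M h" unfolding h_def by (intro bmf_abs bmf_diff f g)
  have "(\<integral>x. h x \<partial>M) = (\<integral>x. 0 \<partial>M)"
    using h f g eq by (intro integral_cong_AE) (auto simp: h_def)
  then have "(\<integral>x. A h x \<partial>M) = 0" using pos_op_integral[OF A h] by simp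
  then have "AE x in M. A h x = 0"
    using integral_nonneg_eq_0_iff_AE[OF bmf_integrable[OF M pos_op_bmf[OF A h]]]
      pos_op_nonneg[OF A, of h] by (auto simp: h_def)
  then show ?thesis
  proof eventually_elim
    case (elim x)
    have "\<bar>A (\<lambda>y. f y - g y) x\<bar> \<le> A h x" by (rule pos_op_abs_le_op[OF A]) (simp add: h_def)
    then show ?case using elim by (simp add: pos_op_diff[OF A])
  qed
qed

text \<open>The continuity built into \<open>pos_op\<close> asks for convergence at every point.
  Multiplying by the indicator of the measurable set of convergence provides that, and
  \<open>pos_op_AE_eq\<close> removes the indicator again, for all \<open>n\<close> outside one null
  set.\<close>

lemma pos_op_AE_lim:
  fixes F :: "nat \<Rightarrow> 'x \<Rightarrow> real"
  assumes A: "pos_op M b A" and M: "finite_measure M" and F: "\<And>n. bmf M (F n)" and f: "bmf M f"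
    and lim: "AE x in M. (\<lambda>n. F n x) \<longlonglongrightarrow> f x"
  shows "AE x in M. (\<lambda>n. A (F n) x) \<longlonglongrightarrow> A f x"
proof -
  define S where "S = {x \<in> space M. (\<lambda>n. F n x - f x) \<longlonglongrightarrow> 0}"
  have [measurable]: "\<And>n. F n \<in> borel_measurable M" "f \<in> borel_measurable M"
    using F f by (auto simp: bmf_def)
  have S[measurable]: "S \<in> sets M"
    unfolding S_def by measurable
  have AES: "AE x in M. x \<in> S"
    using lim AE_space by eventually_elim (auto simp: S_def LIM_zero_iff)
  have conv: "(\<lambda>n. indicator S y * F n y) \<longlonglongrightarrow> indicator S y * f y" for y
    by (cases "y \<in> S") (auto simp: S_def LIM_zero_iff)
  have 1: "AE x in M. \<forall>n. A (\<lambda>y. indicator S y * F n y) x = A (F n) x"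
    unfolding AE_all_countable
  proof
    fix n show "AE x in M. A (\<lambda>y. indicator S y * F n y) x = A (F n) x"
      by (intro pos_op_AE_eq[OF A M] bmf_mult bmf_indicator F S, use AES in eventually_elim) auto
  qed
  have 2: "AE x in M. A (\<lambda>y. indicator S y * f y) x = A f x"
    by (intro pos_op_AE_eq[OF A M] bmf_mult bmf_indicator f S, use AES in eventually_elim) auto
  show ?thesis using 1 2
  proof eventually_elim
    case (elim x)
    have "(\<lambda>n. A (\<lambda>y. indicator S y * F n y) x) \<longlonglongrightarrow> A (\<lambda>y. indicator S y * f y) x"
      by (rule pos_op_lim[OF A]) (rule conv)
    then show ?case using elim by simp
  qed
qed

lemma pos_op_id: "pos_op M 1 (\<lambda>f. f)"
  unfolding pos_op_def by auto

lemma pos_op_zero: "pos_op M 0 (\<lambda>f x. 0)"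
  unfolding pos_op_def by auto

lemma pos_op_comp:
  assumes A: "pos_op M a A" and B: "pos_op M b B"
  shows "pos_op M (a * b) (\<lambda>f. B (A f))"
  unfolding pos_op_def
proof (intro conjI allI ballI impI)
  fix f :: "'a \<Rightarrow> real" assume "f \<in> borel_measurable M"
  then show "B (A f) \<in> borel_measurable M" by (intro pos_op_measurable[OF B] pos_op_measurable[OF A])
next
  fix f g x
  have "A (\<lambda>y. f y + g y) = (\<lambda>y. A f y + A g y)" using pos_op_add[OF A] by blast
  then show "B (A (\<lambda>y. f y + g y)) x = B (A f) x + B (A g) x" by (simp add: pos_op_add[OF B])
next
  fix c f x
  have "A (\<lambda>y. c * f y) = (\<lambda>y. c * A f y)" using pos_op_cmult[OF A] by blast
  then show "B (A (\<lambda>y. c * f y)) x = c * B (A f) x" by (simp add: pos_op_cmult[OF B])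
next
  fix f g :: "'a \<Rightarrow> real" and x assume "\<forall>y. f y \<le> g y"
  then show "B (A f) x \<le> B (A g) x" by (intro pos_op_mono[OF B] pos_op_mono[OF A]) auto
next
  fix x
  have "A (\<lambda>_. 1) = (\<lambda>_. a)" using pos_op_one[OF A] by blast
  then show "B (A (\<lambda>_. 1)) x = a * b" by (simp add: pos_op_const[OF B])
next
  fix f :: "'a \<Rightarrow> real" assume f: "bmf M f"
  show "(\<integral>x. B (A f) x \<partial>M) = a * b * (\<integral>x. f x \<partial>M)"
    by (simp add: pos_op_integral[OF B pos_op_bmf[OF A f]] pos_op_integral[OF A f])
next
  fix F :: "nat \<Rightarrow> 'a \<Rightarrow> real" and f x assume "\<forall>y. (\<lambda>n. F n y) \<longlonglongrightarrow> f y"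
  then show "(\<lambda>n. B (A (F n)) x) \<longlonglongrightarrow> B (A f) x"
    by (intro pos_op_lim[OF B] pos_op_lim[OF A]) auto
qed

lemma pos_op_plus:
  assumes M: "finite_measure M" and A: "pos_op M a A" and B: "pos_op M b B"
  shows "pos_op M (a + b) (\<lambda>f x. A f x + B f x)"
  unfolding pos_op_def
proof (intro conjI allI ballI impI)
  fix f :: "'a \<Rightarrow> real" assume "f \<in> borel_measurable M"
  then show "(\<lambda>x. A f x + B f x) \<in> borel_measurable M"
    by (intro borel_measurable_add pos_op_measurable[OF B] pos_op_measurable[OF A])
next
  fix f :: "'a \<Rightarrow> real" assume f: "bmf M f"
  show "(\<integral>x. A f x + B f x \<partial>M) = (a + b) * (\<integral>x. f x \<partial>M)"
    using bmf_integrable[OF M pos_op_bmf[OF A f]] bmf_integrable[OF M pos_op_bmf[OF B f]]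
    by (simp add: pos_op_integral[OF A f] pos_op_integral[OF B f] algebra_simps)
qed (auto simp: pos_op_add[OF A] pos_op_add[OF B] pos_op_cmult[OF A] pos_op_cmult[OF B]
    pos_op_one[OF A] pos_op_one[OF B] algebra_simps
    intro!: add_mono tendsto_add pos_op_mono[OF A] pos_op_mono[OF B] pos_op_lim[OF A] pos_op_lim[OF B])

lemma pos_op_sum_op:
  assumes M: "finite_measure M" and A: "\<And>i. i \<in> I \<Longrightarrow> pos_op M (a i) (A i)"
  shows "pos_op M (\<Sum>i\<in>I. a i) (\<lambda>f x. \<Sum>i\<in>I. A i f x)"
  using A by (induction I rule: infinite_finite_induct) (auto intro!: pos_op_plus M pos_op_zero)

lemma pos_op_scale:
  assumes A: "pos_op M a A" and c: "c \<ge> 0"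
  shows "pos_op M (c * a) (\<lambda>f x. c * A f x)"
  unfolding pos_op_def
  by (auto simp: pos_op_add[OF A] pos_op_cmult[OF A] pos_op_one[OF A] algebra_simps
      pos_op_integral[OF A] c pos_op_measurable[OF A]
      intro!: borel_measurable_times mult_left_mono tendsto_mult pos_op_mono[OF A] pos_op_lim[OF A])

lemma pos_op_mpt:
  assumes M: "finite_measure M" and T: "mpt M T"
  shows "pos_op M 1 (\<lambda>f x. f (T x))"
  unfolding pos_op_def
proof (intro conjI allI ballI impI)
  have [measurable]: "T \<in> M \<rightarrow>\<^sub>M M" using T by (simp add: mpt_def)
  fix f :: "'a \<Rightarrow> real"
  show "(\<lambda>x. f (T x)) \<in> borel_measurable M" if [measurable]: "f \<in> borel_measurable M" by measurable
  assume [measurable_dest]: "bmf M f"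
  then have [measurable]: "f \<in> borel_measurable M" by measurable
  have "(\<integral>x. f x \<partial>distr M M T) = (\<integral>x. f (T x) \<partial>M)" by (rule integral_distr) measurable
  then show "(\<integral>x. f (T x) \<partial>M) = 1 * (\<integral>x. f x \<partial>M)" using T by (simp add: mpt_def)
qed auto

lemma pos_op_funpow: "pos_op M 1 P \<Longrightarrow> pos_op M 1 (P ^^ n)"
proof (induction n)
  case 0
  then show ?case using pos_op_id by (simp add: id_def)
next
  case (Suc n)
  from pos_op_comp[OF Suc.IH[OF Suc.prems] Suc.prems] show ?case by (simp add: comp_def)
qed

section \<open>The ergodic theorem for Markov operators\<close>

text \<open>Garsia's argument, run on the recursion \<open>m (n + 1) = max 0 (f + P (m n))\<close>, which dominates the partial sums.\<close>

lemma maximal_ergodic: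
  assumes M: "finite_measure M" and P: "pos_op M 1 P" and f: "bmf M f"
    and ex: "AE x in M. \<exists>n. (\<Sum>j<n. (P ^^ j) f x) > 0"
  shows "0 \<le> (\<integral>x. f x \<partial>M)"
proof -
  define m where "m n = ((\<lambda>g x. max 0 (f x + P g x)) ^^ n) (\<lambda>_. 0)" for n
  have m0: "m 0 = (\<lambda>_. 0)" and mS: "m (Suc n) = (\<lambda>x. max 0 (f x + P (m n) x))" for n
    by (auto simp: m_def)
  have bm: "bmf M (m n)" for n
    by (induction n) (auto simp: m0 mS intro!: bmf_max bmf_add bmf_const f pos_op_bmf[OF P])
  have mono1: "m n x \<le> m (Suc n) x" for n x
  proof (induction n arbitrary: x)
    case 0 then show ?case by (simp add: m0 mS)
  next
    case (Suc n)
    have "P (m n) x \<le> P (m (Suc n)) x" by (rule pos_op_mono[OF P]) (rule Suc)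
    then show ?case by (subst (2) mS, subst mS) auto
  qed
  have le_m: "(\<Sum>j<k. (P ^^ j) f x) \<le> m n x" if "k \<le> n" for k n x
    using that
  proof (induction n arbitrary: k x)
    case 0 then show ?case by (simp add: m0)
  next
    case (Suc n)
    show ?case
    proof (cases k)
      case 0
      then show ?thesis by (simp add: mS)
    next
      case k: (Suc k')
      have "(\<Sum>j<k. (P ^^ j) f x) = f x + (\<Sum>j<k'. P ((P ^^ j) f) x)"
        unfolding k by (simp add: sum.lessThan_Suc_shift del: sum.lessThan_Suc)
      also have "\<dots> = f x + P (\<lambda>y. \<Sum>j<k'. (P ^^ j) f y) x" by (simp add: pos_op_sum[OF P])
      also have "P (\<lambda>y. \<Sum>j<k'. (P ^^ j) f y) x \<le> P (m n) x"
        using Suc k by (intro pos_op_mono[OF P]) auto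
      finally show ?thesis by (simp add: mS)
    qed
  qed
  have E: "{x\<in>space M. m n x > 0} \<in> sets M" for n using bmf_measurable[OF bm] by measurable
  have step: "0 \<le> (\<integral>x. indicator {x\<in>space M. m (Suc n) x > 0} x * f x \<partial>M)" for n
  proof -
    let ?E = "{x\<in>space M. m (Suc n) x > 0}"
    \<comment> \<open>On \<open>?E\<close> the maximum is attained by \<open>f + P (m n)\<close>,
      and \<open>m n \<le> m (n + 1)\<close>; off \<open>?E\<close> the left side is at most 0.
      Since \<open>P\<close> preserves integrals, the left side integrates to 0.\<close>
    have "m (Suc n) x - P (m (Suc n)) x \<le> indicator ?E x * f x" if "x \<in> space M" for x
    proof (cases "m (Suc n) x > 0")
      case True
      then have "m (Suc n) x = f x + P (m n) x" by (simp add: mS max_def split: if_splits)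
      moreover have "P (m n) x \<le> P (m (Suc n)) x" by (rule pos_op_mono[OF P]) (rule mono1)
      ultimately show ?thesis using True that by simp
    next
      case False
      have "P (m (Suc n)) x \<ge> 0" by (rule pos_op_nonneg[OF P]) (simp add: mS)
      then show ?thesis using False that by simp
    qed
    then have "(\<integral>x. m (Suc n) x - P (m (Suc n)) x \<partial>M) \<le> (\<integral>x. indicator ?E x * f x \<partial>M)"
      by (intro integral_mono bmf_integrable[OF M] bmf_diff bmf_mult bmf_indicator E f bm pos_op_bmf[OF P])
    moreover have "(\<integral>x. m (Suc n) x - P (m (Suc n)) x \<partial>M) = 0"
      using bmf_integrable[OF M bm] bmf_integrable[OF M pos_op_bmf[OF P bm]]
      by (simp add: pos_op_integral[OF P bm])
    ultimately show ?thesis by simp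
  qed
  have "(\<lambda>n. \<integral>x. indicator {x\<in>space M. m (Suc n) x > 0} x * f x \<partial>M) \<longlonglongrightarrow> (\<integral>x. f x \<partial>M)"
  proof (rule integral_dominated_convergence[where w="\<lambda>x. \<bar>f x\<bar>"])
    show "AE x in M. (\<lambda>n. indicator {x\<in>space M. m (Suc n) x > 0} x * f x) \<longlonglongrightarrow> f x"
      using ex AE_space
    proof eventually_elim
      case (elim x)
      then obtain k where k: "(\<Sum>j<k. (P ^^ j) f x) > 0" by blast
      have "\<forall>\<^sub>F n in sequentially. indicator {x\<in>space M. m (Suc n) x > 0} x * f x = f x"
        using eventually_ge_at_top[of k]
      proof eventually_elim
        case (elim n)
        then have "m (Suc n) x > 0" using le_m[of k "Suc n" x] k by simp
        then show ?case using \<open>x \<in> space M\<close> by simp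
      qed
      then show ?case by (rule tendsto_eventually)
    qed
    show "integrable M (\<lambda>x. \<bar>f x\<bar>)" by (intro bmf_integrable[OF M] bmf_abs f)
    show "\<And>n. (\<lambda>x. indicator {x \<in> space M. 0 < m (Suc n) x} x * f x) \<in> borel_measurable M"
      using E bmf_measurable[OF f] by measurable
  qed (use f in \<open>auto simp: bmf_def indicator_def\<close>)
  then show ?thesis by (rule LIMSEQ_le_const) (use step in auto)
qed

lemma funpow_pos_op_fixed_AE:
  assumes M: "finite_measure M" and P: "pos_op M 1 P" and F: "bmf M F" and inv: "AE x in M. P F x = F x"
  shows "AE x in M. (P ^^ j) F x = F x"
proof (induction j)
  case (Suc j)
  have "bmf M ((P ^^ j) F)" by (rule pos_op_bmf[OF pos_op_funpow[OF P] F])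
  from pos_op_AE_eq[OF P M this F Suc] inv show ?case by eventually_elim simp
qed simp

text \<open>The upper limit \<open>F\<close> of the averages satisfies \<open>F \<le> P F\<close>, hence \<open>P F = F\<close> almost everywhere by integrating;
  the maximal inequality applied to \<open>f - F + e\<close> then bounds the integral of \<open>F\<close>.\<close>

lemma ergodic_upper_limit:
  assumes M: "prob_space M" and P: "pos_op M 1 P" and f: "bmf M f"
  obtains F where "bmf M F" "(\<integral>x. F x \<partial>M) \<le> (\<integral>x. f x \<partial>M)"
    "\<And>x e. e > 0 \<Longrightarrow> \<forall>\<^sub>F n in sequentially. (\<Sum>j<n. (P ^^ j) f x) / real n < F x + e"
proof -
  interpret prob_space M by fact
  have fm: "finite_measure M" by unfold_locales
  obtain K where K: "\<And>x. \<bar>f x\<bar> \<le> K" "K \<ge> 0" using f by (meson bmfE)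
  define a where "a n x = (\<Sum>j<n. (P ^^ j) f x) / real n" for n x
  have Pj: "\<bar>(P ^^ j) f x\<bar> \<le> K" for j x using pos_op_abs_le[OF pos_op_funpow[OF P] K(1)] by simp
  have aK: "\<bar>a n x\<bar> \<le> K" for n x
  proof (cases "n = 0")
    case False
    have "\<bar>\<Sum>j<n. (P ^^ j) f x\<bar> \<le> (\<Sum>j<n. K)" by (rule order_trans[OF sum_abs sum_mono]) (rule Pj)
    then show ?thesis using False by (simp add: a_def field_simps)
  qed (simp add: a_def K)
  have abm: "bmf M (a n)" for n unfolding a_def divide_inverse mult.commute[of _ "inverse _"]
    by (intro bmf_cmult bmf_sum pos_op_bmf[OF pos_op_funpow[OF P]] f)
  have [measurable]: "a n \<in> borel_measurable M" for n using abm by (simp add: bmf_def)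
  define g where "g k x = (SUP n\<in>{k..}. a n x)" for k x
  have bdd: "bdd_above ((\<lambda>n. a n x) ` S)" for S x
    using aK by (intro bdd_aboveI2[where M=K]) (simp add: abs_le_iff)
  have gm[measurable]: "g k \<in> borel_measurable M" for k
    unfolding g_def by (rule borel_measurable_cSUP) (auto intro: bdd)
  have a_le_g: "a n x \<le> g k x" if "k \<le> n" for n k x
    unfolding g_def using that by (intro cSUP_upper bdd) auto
  have gK: "\<bar>g k x\<bar> \<le> K" for k x
  proof -
    have "g k x \<le> K" unfolding g_def using aK by (intro cSUP_least) (auto simp: abs_le_iff)
    moreover have "- K \<le> g k x" using a_le_g[of k k x] aK[of k x] by (simp add: abs_le_iff)
    ultimately show ?thesis by simp
  qed
  have g_dec: "decseq (\<lambda>k. g k x)" for x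
    unfolding decseq_def g_def by (intro allI impI cSUP_subset_mono bdd) auto
  define F where "F x = (INF k. g k x)" for x
  have bddg: "bdd_below (range (\<lambda>k. g k x))" for x
  proof (rule bdd_belowI2[where m="-K"])
    show "- K \<le> g k x" for k using gK[of k x] by linarith
  qed
  have g_lim: "(\<lambda>k. g k x) \<longlonglongrightarrow> F x" for x
    unfolding F_def by (rule LIMSEQ_decseq_INF[OF bddg g_dec])
  have Fm[measurable]: "F \<in> borel_measurable M"
    by (rule borel_measurable_LIMSEQ_real[of _ g]) (auto intro: g_lim)
  have Fb: "bmf M F"
  proof (rule bmfI[where K=K])
    fix x
    have "(\<lambda>k. \<bar>g k x\<bar>) \<longlonglongrightarrow> \<bar>F x\<bar>" by (intro tendsto_rabs g_lim)
    then show "\<bar>F x\<bar> \<le> K" by (rule LIMSEQ_le_const2) (use gK in auto)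
  qed simp
  have F_le_g: "F x \<le> g k x" for k x unfolding F_def by (rule cINF_lower[OF bddg]) simp
  \<comment> \<open>The error comes from \<open>n * (a (n + 1) - P (a n)) = f - a (n + 1)\<close>,
    whose right side is at most \<open>2 * K\<close>.\<close>
  have P_a: "a (Suc n) x \<le> P (a n) x + 2 * K / n" if "n > 0" for n x
  proof -
    have "P (a n) x = (\<Sum>j<n. (P ^^ Suc j) f x) / n"
      unfolding a_def divide_inverse mult.commute[of _ "inverse _"]
      by (simp add: pos_op_cmult[OF P] pos_op_sum[OF P])
    moreover have "(\<Sum>j<Suc n. (P ^^ j) f x) = f x + (\<Sum>j<n. (P ^^ Suc j) f x)"
      by (simp add: sum.lessThan_Suc_shift del: sum.lessThan_Suc)
    ultimately have "a (Suc n) x * (n + 1) = f x + n * P (a n) x"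
      using that by (simp add: a_def field_simps)
    then have "n * (a (Suc n) x - P (a n) x) = f x - a (Suc n) x" by (simp add: algebra_simps)
    also have "\<dots> \<le> 2 * K" using K(1)[of x] aK[of "Suc n" x] by (simp add: abs_le_iff)
    finally show ?thesis using that by (simp add: field_simps)
  qed
  \<comment> \<open>Monotonicity gives only this direction: a supremum of the \<open>P (a i)\<close>
    is at most \<open>P\<close> of the supremum of the \<open>a i\<close>. The error of
    \<open>P_a\<close> disappears as the starting index of the supremum tends to infinity.\<close>
  have F_le_Pg: "F x \<le> P (g k) x" for k x
  proof -
    have "F x \<le> P (g k) x + 2 * K / real n" if n: "n \<ge> Suc k" for n
    proof -
      have "a i x \<le> P (g k) x + 2 * K / real n" if i: "i \<ge> Suc n" for i
      proof -
        obtain i' where i': "i = Suc i'" "i' \<ge> n" using i by (cases i) auto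
        have "a i x \<le> P (a i') x + 2 * K / i'" unfolding i' using P_a[of i' x] i' n by simp
        also have "P (a i') x \<le> P (g k) x" using i' n by (intro pos_op_mono[OF P] a_le_g) simp
        also have "2 * K / i' \<le> 2 * K / n" using i' n K by (intro divide_left_mono) auto
        finally show ?thesis by simp
      qed
      then have "g (Suc n) x \<le> P (g k) x + 2 * K / n" unfolding g_def by (intro cSUP_least) auto
      then show ?thesis using F_le_g[of x "Suc n"] by simp
    qed
    moreover have "(\<lambda>n. P (g k) x + 2 * K / real n) \<longlonglongrightarrow> P (g k) x + 0"
      by (intro tendsto_intros tendsto_divide_0[OF tendsto_const] filterlim_at_top_imp_at_infinity filterlim_real_sequentially)
    ultimately show ?thesis by (intro LIMSEQ_le_const[of "\<lambda>n. P (g k) x + 2 * K / real n"]) auto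
  qed
  have F_le_PF: "F x \<le> P F x" for x
    by (rule LIMSEQ_le_const[OF pos_op_lim[OF P g_lim]]) (use F_le_Pg in auto)
  have iF: "integrable M F" and iPF: "integrable M (P F)"
    using bmf_integrable[OF fm Fb] bmf_integrable[OF fm pos_op_bmf[OF P Fb]] by auto
  have "(\<integral>x. P F x - F x \<partial>M) = 0" using iF iPF by (simp add: pos_op_integral[OF P Fb])
  then have "AE x in M. P F x - F x = 0"
    using integral_nonneg_eq_0_iff_AE[of M "\<lambda>x. P F x - F x"] iF iPF F_le_PF by auto
  then have "AE x in M. P F x = F x" by eventually_elim simp
  then have fixF: "AE x in M. \<forall>j. (P ^^ j) F x = F x"
    unfolding AE_all_countable using funpow_pos_op_fixed_AE[OF fm P Fb] by blast
  have "(\<integral>x. F x \<partial>M) \<le> (\<integral>x. f x \<partial>M) + e" if e: "e > 0" for e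
  proof -
    define q where "q x = f x - F x + e" for x
    have q: "bmf M q" unfolding q_def by (intro bmf_add bmf_diff bmf_const f Fb)
    have Pq: "(P ^^ j) q x = (P ^^ j) f x - (P ^^ j) F x + e" for j x
      unfolding q_def
      by (simp add: pos_op_add[OF pos_op_funpow[OF P]] pos_op_diff[OF pos_op_funpow[OF P]] pos_op_const[OF pos_op_funpow[OF P]])
    have "AE x in M. \<exists>n. (\<Sum>j<n. (P ^^ j) q x) > 0"
      using fixF
    proof eventually_elim
      case (elim x)
      \<comment> \<open>The supremum starts at 1 because \<open>a 0\<close> is 0 by the convention
        on division and says nothing about \<open>f\<close>.\<close>
      have "F x - e < g 1 x" using F_le_g[of x 1] e by simp
      then obtain n where n: "n \<ge> 1" "F x - e < a n x"
        unfolding g_def by (subst (asm) less_cSUP_iff) (auto intro: bdd)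
      have "(\<Sum>j<n. (P ^^ j) q x) = n * a n x - n * F x + n * e"
        using n by (simp add: Pq elim sum.distrib sum_subtractf a_def)
      also have "\<dots> = n * (a n x - F x + e)" by (simp add: algebra_simps)
      also have "\<dots> > 0" using n by simp
      finally show ?case by blast
    qed
    from maximal_ergodic[OF fm P q this]
    show ?thesis using iF bmf_integrable[OF fm f] by (simp add: q_def prob_space)
  qed
  then have "(\<integral>x. F x \<partial>M) \<le> (\<integral>x. f x \<partial>M)" by (rule field_le_epsilon)
  moreover have "\<forall>\<^sub>F n in sequentially. a n x < F x + e" if "e > 0" for x e
  proof -
    have "\<forall>\<^sub>F k in sequentially. g k x < F x + e" using order_tendstoD(2)[OF g_lim] that by simp
    then obtain k where "g k x < F x + e" by (auto simp: eventually_sequentially)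
    then show ?thesis unfolding eventually_sequentially using a_le_g[of k _ x] by (intro exI[of _ k]) force
  qed
  ultimately show ?thesis using that[OF Fb] by (simp add: a_def)
qed

text \<open>Apply the upper bound to \<open>f\<close> and to \<open>- f\<close>. The resulting
  \<open>F\<close> and \<open>F'\<close> satisfy \<open>F + F' \<ge> 0\<close> at every point, while
  the integral of the sum is at most that of \<open>f - f\<close>; so \<open>F + F' = 0\<close>
  almost everywhere and the averages are squeezed between \<open>- F'\<close> and
  \<open>F\<close>.\<close>

theorem ergodic_theorem:
  assumes M: "prob_space M" and P: "pos_op M 1 P" and f: "bmf M f"
  shows "AE x in M. convergent (\<lambda>n. (\<Sum>j<n. (P ^^ j) f x) / real n)"
proof -
  interpret prob_space M by fact
  have fm: "finite_measure M" by unfold_locales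
  define a where "a n x = (\<Sum>j<n. (P ^^ j) f x) / real n" for n x
  obtain F where F: "bmf M F" "(\<integral>x. F x \<partial>M) \<le> (\<integral>x. f x \<partial>M)"
    "\<And>x e. e > 0 \<Longrightarrow> \<forall>\<^sub>F n in sequentially. a n x < F x + e"
    using ergodic_upper_limit[OF M P f] unfolding a_def by blast
  have mf: "bmf M (\<lambda>x. - f x)" using bmf_cmult[OF f, of "-1"] by simp
  obtain F' where F': "bmf M F'" "(\<integral>x. F' x \<partial>M) \<le> (\<integral>x. - f x \<partial>M)"
    "\<And>x e. e > 0 \<Longrightarrow> \<forall>\<^sub>F n in sequentially. - a n x < F' x + e"
    using ergodic_upper_limit[OF M P mf]
    by (auto simp: a_def pos_op_uminus[OF pos_op_funpow[OF P]] sum_negf)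
  have pos: "0 \<le> F x + F' x" for x
  proof (rule field_le_epsilon)
    fix e :: real assume "e > 0"
    then have "\<forall>\<^sub>F n in sequentially. a n x < F x + e/2 \<and> - a n x < F' x + e/2"
      by (intro eventually_conj F F') auto
    then have "\<exists>n. a n x < F x + e/2 \<and> - a n x < F' x + e/2"
      by (rule eventually_happens'[OF sequentially_bot])
    then show "0 \<le> F x + F' x + e" by auto
  qed
  have i: "integrable M F" "integrable M F'" using bmf_integrable[OF fm] F F' by auto
  have "(\<integral>x. F x + F' x \<partial>M) = 0"
    using F(2) F'(2) i integral_nonneg_AE[where M=M and f="\<lambda>x. F x + F' x"] pos by simp
  then have "AE x in M. F x + F' x = 0"
    using integral_nonneg_eq_0_iff_AE[of M "\<lambda>x. F x + F' x"] i pos by auto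
  then show ?thesis
  proof eventually_elim
    case (elim x)
    have "(\<lambda>n. a n x) \<longlonglongrightarrow> F x"
    proof (rule LIMSEQ_I)
      fix e :: real assume "e > 0"
      then have "\<forall>\<^sub>F n in sequentially. a n x < F x + e \<and> - a n x < F' x + e"
        by (intro eventually_conj F F') auto
      then show "\<exists>no. \<forall>n\<ge>no. norm (a n x - F x) < e"
        using elim by (auto simp: eventually_sequentially abs_less_iff) (smt (verit))
    qed
    then show ?case unfolding a_def by (rule convergentI)
  qed
qed

section \<open>Cesaro sums of sequences of polynomial growth\<close>

lemma weighted_cesaro:
  fixes w e :: "nat \<Rightarrow> real"
  assumes w: "\<And>n. w n \<ge> 0" and W: "filterlim (\<lambda>N. \<Sum>n<N. w n) at_top sequentially"
    and e: "e \<longlonglongrightarrow> l"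
  shows "(\<lambda>N. (\<Sum>n<N. w n * e n) / (\<Sum>n<N. w n)) \<longlonglongrightarrow> l"
proof (rule LIM_zero_cancel, rule LIMSEQ_I)
  fix r :: real assume r: "r > 0"
  obtain n0 where n0: "\<And>n. n \<ge> n0 \<Longrightarrow> \<bar>e n - l\<bar> < r/2"
    using LIMSEQ_D[OF e, of "r/2"] r by auto
  define C where "C = (\<Sum>n<n0. w n * \<bar>e n - l\<bar>)"
  have C: "C \<ge> 0" unfolding C_def using w by (intro sum_nonneg) auto
  have "\<forall>\<^sub>F N in sequentially. (\<Sum>n<N. w n) > 2 * C / r + 1"
    using W unfolding filterlim_at_top_dense by blast
  then obtain N0 where N0: "\<And>N. N \<ge> N0 \<Longrightarrow> (\<Sum>n<N. w n) > 2 * C / r + 1"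
    by (auto simp: eventually_sequentially)
  show "\<exists>no. \<forall>N\<ge>no. norm ((\<Sum>n<N. w n * e n) / (\<Sum>n<N. w n) - l - 0) < r"
  proof (intro exI allI impI)
    fix N assume N: "N \<ge> max n0 N0"
    define S where "S = (\<Sum>n<N. w n)"
    have S: "S > 2 * C / r + 1" unfolding S_def using N0 N by simp
    have "2 * C / r \<ge> 0" using C r by simp
    then have S0: "S > 0" using S by linarith
    have eq: "(\<Sum>n<N. w n * e n) - l * S = (\<Sum>n<N. w n * (e n - l))"
      by (simp add: S_def right_diff_distrib sum_subtractf sum_distrib_right mult.commute[of l])
    have "\<bar>\<Sum>n<N. w n * (e n - l)\<bar> \<le> (\<Sum>n<N. w n * \<bar>e n - l\<bar>)"
      by (rule order_trans[OF sum_abs]) (use w in \<open>simp add: abs_mult\<close>)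
    also have "\<dots> = C + (\<Sum>n=n0..<N. w n * \<bar>e n - l\<bar>)"
    proof -
      have split: "{..<N} = {..<n0} \<union> {n0..<N}" using N by auto
      show ?thesis unfolding C_def by (subst split, subst sum.union_disjoint) auto
    qed
    also have "(\<Sum>n=n0..<N. w n * \<bar>e n - l\<bar>) \<le> (\<Sum>n=n0..<N. w n * (r/2))"
      using n0 w by (intro sum_mono mult_left_mono) (auto intro: less_imp_le)
    also have "\<dots> \<le> (\<Sum>n<N. w n * (r/2))"
      using w r by (intro sum_mono2) auto
    also have "\<dots> = S * (r/2)" by (simp add: S_def sum_distrib_right)
    finally have "\<bar>(\<Sum>n<N. w n * e n) - l * S\<bar> \<le> C + S * (r/2)" using eq by simp
    also have "C < S * (r / 2)"
    proof -
      have "2 * C / r < S" using S by simp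
      then show ?thesis using r by (simp add: field_simps)
    qed
    finally have "\<bar>(\<Sum>n<N. w n * e n) - l * S\<bar> < r * S" by (simp add: mult.commute)
    moreover have "(\<Sum>n<N. w n * e n) / S - l = ((\<Sum>n<N. w n * e n) - l * S) / S"
      using S0 by (simp add: field_simps)
    ultimately show "norm ((\<Sum>n<N. w n * e n) / (\<Sum>n<N. w n) - l - 0) < r"
      using S0 by (simp add: S_def[symmetric] abs_divide pos_divide_less_eq)
  qed
qed

lemma Suc_over_lim: "(\<lambda>n. (real (Suc n) / real n)) \<longlonglongrightarrow> 1"
proof -
  have "(\<lambda>n. 1 + 1 / real n) \<longlonglongrightarrow> 1 + 0"
    by (intro tendsto_add tendsto_const lim_1_over_n)
  then have "(\<lambda>n. 1 + 1 / real n) \<longlonglongrightarrow> 1" by simp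
  then show ?thesis
    by (rule Lim_transform_eventually, intro eventually_mono[OF eventually_gt_at_top[of 0]])
      (auto simp: field_simps)
qed

text \<open>Stolz-Cesaro with the weights \<open>(n + 1) ^ (k + 1) - n ^ (k + 1)\<close>: they
  telescope exactly to \<open>N ^ (k + 1)\<close> and are asymptotic to
  \<open>(k + 1) * n ^ k\<close>, which is where the factor in the limit comes from.\<close>

lemma cesaro_power:
  fixes a :: "nat \<Rightarrow> real"
  assumes a: "(\<lambda>n. a n / real n ^ k) \<longlonglongrightarrow> c"
  shows "(\<lambda>N. (\<Sum>n<N. a n) / real N ^ Suc k) \<longlonglongrightarrow> c / real (Suc k)"
proof -
  define w where "w n = real (Suc n) ^ Suc k - real n ^ Suc k" for n
  have W: "(\<Sum>n<N. w n) = real N ^ Suc k" for N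
    unfolding w_def by (subst sum_lessThan_telescope) simp
  have w0: "w n > 0" for n unfolding w_def using power_strict_mono[of "real n" "real (Suc n)" "Suc k"] by simp
  have "(\<lambda>n. \<Sum>i<Suc k. (real (Suc n) / real n) ^ i) \<longlonglongrightarrow> (\<Sum>i<Suc k. 1 ^ i)"
    by (intro tendsto_sum tendsto_power Suc_over_lim)
  moreover have "\<forall>\<^sub>F n in sequentially. (\<Sum>i<Suc k. (real (Suc n) / real n) ^ i) = w n / real n ^ k"
    using eventually_gt_at_top[of 0]
  proof eventually_elim
    case (elim n)
    have "w n = (\<Sum>i<Suc k. real n ^ (Suc k - Suc i) * real (Suc n) ^ i)"
      unfolding w_def power_diff_sumr2 by simp
    also have "\<dots> / real n ^ k = (\<Sum>i<Suc k. (real (Suc n) / real n) ^ i)"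
      unfolding sum_divide_distrib using elim
      by (intro sum.cong refl) (auto simp: power_diff field_simps)
    finally show ?case by simp
  qed
  ultimately have "(\<lambda>n. w n / real n ^ k) \<longlonglongrightarrow> real (Suc k)"
    by (auto intro: Lim_transform_eventually)
  then have "(\<lambda>n. (a n / real n ^ k) / (w n / real n ^ k)) \<longlonglongrightarrow> c / real (Suc k)"
    by (intro tendsto_divide a) auto
  then have "(\<lambda>n. a n / w n) \<longlonglongrightarrow> c / real (Suc k)"
    by (rule Lim_transform_eventually, intro eventually_mono[OF eventually_gt_at_top[of 0]]) auto
  moreover have "filterlim (\<lambda>N. real N ^ Suc k) at_top sequentially"
    by (rule filterlim_pow_at_top) (auto intro: filterlim_real_sequentially)
  ultimately have "(\<lambda>N. (\<Sum>n<N. w n * (a n / w n)) / (\<Sum>n<N. w n)) \<longlonglongrightarrow> c / real (Suc k)"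
    using w0 by (intro weighted_cesaro) (auto simp: W less_imp_le)
  moreover have "w n * (a n / w n) = a n" for n using w0[of n] by simp
  ultimately show ?thesis by (simp add: W)
qed

lemma cesaro_mean: "(a :: nat \<Rightarrow> real) \<longlonglongrightarrow> c \<Longrightarrow> (\<lambda>N. (\<Sum>n<N. a n) / real N) \<longlonglongrightarrow> c"
  using cesaro_power[of a 0 c] by simp

text \<open>Only the partial sums \<open>Z\<close> of \<open>z\<close> are controlled, not
  \<open>z\<close> itself, so the factor \<open>1 / (n + 1)\<close> is handled by summation by
  parts. Both resulting terms have order \<open>N ^ (k + 1)\<close>, the second one by
  \<open>cesaro_power\<close>.\<close>

lemma cesaro_divide_Suc:
  fixes z :: "nat \<Rightarrow> real"
  assumes "convergent (\<lambda>N. (\<Sum>n<N. z n) / real N ^ Suc (Suc k))"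
  shows "convergent (\<lambda>N. (\<Sum>n<N. z n / real (Suc n)) / real N ^ Suc k)"
proof -
  define Z where "Z N = (\<Sum>n<N. z n)" for N
  obtain c where c: "(\<lambda>N. Z N / real N ^ Suc (Suc k)) \<longlonglongrightarrow> c"
    using assms by (auto simp: convergent_def Z_def)
  \<comment> \<open>At \<open>N = 0\<close> and for the summand \<open>n = 0\<close> the divisions
    by zero give 0, in agreement with \<open>Z 0 = 0\<close>.\<close>
  have abel: "(\<Sum>n<N. z n / real (Suc n)) = Z N / real N + (\<Sum>n<N. Z n / (real n * real (Suc n)))" for N
  proof (induction N)
    case (Suc N)
    show ?case
    proof (cases "N = 0")
      case False
      have "Z (Suc N) = Z N + z N" by (simp add: Z_def)
      then show ?thesis using Suc False by (simp add: divide_simps) (simp add: algebra_simps)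
    qed (simp add: Z_def)
  qed (simp add: Z_def)
  have "(\<lambda>n. (Z n / real n ^ Suc (Suc k)) / (real (Suc n) / real n)) \<longlonglongrightarrow> c / 1"
    by (intro tendsto_divide c Suc_over_lim) auto
  then have "(\<lambda>n. (Z n / (real n * real (Suc n))) / real n ^ k) \<longlonglongrightarrow> c / 1"
    by (rule Lim_transform_eventually)
      (auto intro!: eventually_mono[OF eventually_gt_at_top[of 0]] simp del: of_nat_Suc)
  then have "(\<lambda>n. (Z n / (real n * real (Suc n))) / real n ^ k) \<longlonglongrightarrow> c" by simp
  from tendsto_add[OF c cesaro_power[OF this]]
  have "(\<lambda>N. Z N / real N ^ Suc (Suc k) + (\<Sum>n<N. Z n / (real n * real (Suc n))) / real N ^ Suc k)
     \<longlonglongrightarrow> c + c / real (Suc k)" .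
  then show ?thesis unfolding abel by (auto simp: convergent_def add_divide_distrib mult.commute)
qed

lemma cesaro_divide_power:
  fixes z :: "nat \<Rightarrow> real"
  assumes "convergent (\<lambda>N. (\<Sum>n<N. z n) / real N ^ Suc k)"
  shows "convergent (\<lambda>N. (\<Sum>n<N. z n / real (Suc n) ^ k) / real N)"
  using assms
proof (induction k arbitrary: z)
  case (Suc k)
  have "convergent (\<lambda>N. (\<Sum>n<N. (z n / real (Suc n)) / real (Suc n) ^ k) / real N)"
    by (rule Suc.IH) (rule cesaro_divide_Suc[OF Suc.prems])
  then show ?case by (simp add: field_simps)
qed simp

text \<open>The kernel \<open>(N - 1 - j) choose k\<close> is that of \<open>k\<close>-fold iterated
  summation, by Pascal's rule; each summation raises the exponent by one through
  \<open>cesaro_power\<close>.\<close>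

lemma cesaro_binomial:
  fixes a :: "nat \<Rightarrow> real"
  assumes "convergent (\<lambda>N. (\<Sum>n<N. a n) / real N)"
  shows "convergent (\<lambda>N. (\<Sum>j<N. real ((N - 1 - j) choose k) * a j) / real N ^ Suc k)"
proof (induction k)
  case 0
  then show ?case using assms by simp
next
  case (Suc k)
  have *: "(\<Sum>j<N. real ((N - 1 - j) choose Suc k) * a j) =
     (\<Sum>M<N. \<Sum>j<M. real ((M - 1 - j) choose k) * a j)" for N
  proof (induction N)
    case (Suc N)
    have "(\<Sum>j<Suc N. real ((Suc N - 1 - j) choose Suc k) * a j) = (\<Sum>j<N. real ((N - j) choose Suc k) * a j)"
      by simp
    also have "\<dots> = (\<Sum>j<N. real ((N - 1 - j) choose Suc k) * a j + real ((N - 1 - j) choose k) * a j)"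
    proof (intro sum.cong refl)
      fix j assume "j \<in> {..<N}"
      then have "N - j = Suc (N - 1 - j)" by auto
      then show "real ((N - j) choose Suc k) * a j = real ((N - 1 - j) choose Suc k) * a j + real ((N - 1 - j) choose k) * a j"
        by (simp add: algebra_simps)
    qed
    finally show ?case using Suc by (simp add: sum.distrib)
  qed simp
  from Suc obtain c where "(\<lambda>N. (\<Sum>j<N. real ((N - 1 - j) choose k) * a j) / real N ^ Suc k) \<longlonglongrightarrow> c"
    by (auto simp: convergent_def)
  from cesaro_power[OF this] show ?case unfolding * by (rule convergentI)
qed

section \<open>Convolutions with sequences of polynomial growth\<close>

lemma power_bound:
  fixes g :: "nat \<Rightarrow> real"
  assumes "(\<lambda>n. g n / real n ^ k) \<longlonglongrightarrow> c"
  obtains K where "K \<ge> 0" "\<And>n m. n \<ge> 1 \<Longrightarrow> m \<le> n \<Longrightarrow> \<bar>g m\<bar> \<le> K * real n ^ k"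
proof -
  have "Bseq (\<lambda>n. g n / real n ^ k)" using assms convergentI convergent_imp_Bseq by blast
  then obtain B where B: "B > 0" "\<And>n. \<bar>g n / real n ^ k\<bar> \<le> B" by (auto simp: Bseq_def)
  \<comment> \<open>The term \<open>\<bar>g 0\<bar>\<close> is there for \<open>m = 0\<close>: when
    \<open>k > 0\<close> the quotient \<open>g 0 / 0 ^ k\<close> is 0 by convention and bounds
    nothing.\<close>
  show ?thesis
  proof (rule that[of "max B \<bar>g 0\<bar>"])
    fix n m :: nat assume nm: "n \<ge> 1" "m \<le> n"
    show "\<bar>g m\<bar> \<le> max B \<bar>g 0\<bar> * real n ^ k"
    proof (cases "m = 0")
      case True
      have "\<bar>g 0\<bar> * 1 \<le> max B \<bar>g 0\<bar> * real n ^ k" using nm by (intro mult_mono) auto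
      then show ?thesis using True by simp
    next
      case False
      then have "\<bar>g m\<bar> \<le> B * real m ^ k" using B(2)[of m] by (simp add: field_simps)
      also have "\<dots> \<le> max B \<bar>g 0\<bar> * real n ^ k" using nm B by (intro mult_mono power_mono) auto
      finally show ?thesis .
    qed
  qed (use B in auto)
qed

lemma shift_ratio_lim:
  fixes g :: "nat \<Rightarrow> real"
  assumes g: "(\<lambda>n. g n / real n ^ k) \<longlonglongrightarrow> c"
  shows "(\<lambda>n. g (n - j) / real n ^ k) \<longlonglongrightarrow> c"
proof -
  have "(\<lambda>n. g (n - j) / real (n - j) ^ k) \<longlonglongrightarrow> c"
    using filterlim_compose[OF g filterlim_minus_const_nat_at_top] .
  moreover have "(\<lambda>n. 1 - real j / real n) \<longlonglongrightarrow> 1 - 0"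
    by (intro tendsto_diff tendsto_const tendsto_divide_0[OF tendsto_const]
        filterlim_at_top_imp_at_infinity filterlim_real_sequentially)
  ultimately have "(\<lambda>n. g (n - j) / real (n - j) ^ k * (1 - real j / real n) ^ k) \<longlonglongrightarrow> c * (1 - 0) ^ k"
    by (intro tendsto_mult tendsto_power)
  then have "(\<lambda>n. g (n - j) / real (n - j) ^ k * (1 - real j / real n) ^ k) \<longlonglongrightarrow> c" by simp
  then show ?thesis
  proof (rule Lim_transform_eventually)
    show "\<forall>\<^sub>F n in sequentially. g (n - j) / real (n - j) ^ k * (1 - real j / real n) ^ k = g (n - j) / real n ^ k"
      using eventually_gt_at_top[of j]
    proof eventually_elim
      case (elim n)
      have "(1 - real j / real n) ^ k = (real (n - j) / real n) ^ k" using elim by (simp add: field_simps of_nat_diff)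
      then show ?case using elim by (simp add: power_divide)
    qed
  qed
qed

text \<open>Tannery's theorem: after extension by 0 beyond \<open>j = n\<close>, the summands have
  the limits \<open>b j * c\<close> and are dominated by \<open>K * \<bar>b j\<bar>\<close>.\<close>

lemma conv_summable_lim:
  fixes b g :: "nat \<Rightarrow> real"
  assumes b: "summable (\<lambda>n. \<bar>b n\<bar>)" and g: "(\<lambda>n. g n / real n ^ k) \<longlonglongrightarrow> c"
  shows "(\<lambda>n. (\<Sum>j\<le>n. b j * g (n - j)) / real n ^ k) \<longlonglongrightarrow> c * (\<Sum>j. b j)"
proof -
  obtain K where K: "K \<ge> 0" "\<And>n m. n \<ge> 1 \<Longrightarrow> m \<le> n \<Longrightarrow> \<bar>g m\<bar> \<le> K * real n ^ k"
    using power_bound[OF g] by blast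
  have lim: "(\<lambda>n. if j \<le> n then b j * g (n - j) / real n ^ k else 0) \<longlonglongrightarrow> b j * c" for j
  proof -
    have "(\<lambda>n. b j * (g (n - j) / real n ^ k)) \<longlonglongrightarrow> b j * c"
      by (intro tendsto_mult tendsto_const shift_ratio_lim g)
    then show ?thesis
      by (rule Lim_transform_eventually) (auto intro: eventually_mono[OF eventually_ge_at_top[of j]])
  qed
  have bound: "\<forall>\<^sub>F (j, n) in sequentially \<times>\<^sub>F sequentially.
      norm (if j \<le> n then b j * g (n - j) / real n ^ k else 0) \<le> K * \<bar>b j\<bar>"
    unfolding eventually_prod_filter
  proof (rule exI[of _ "\<lambda>_. True"], rule exI[of _ "\<lambda>n. n \<ge> 1"], intro conjI allI impI)
    fix j n :: nat assume n: "n \<ge> 1"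
    show "case (j, n) of (j, n) \<Rightarrow> norm (if j \<le> n then b j * g (n - j) / real n ^ k else 0) \<le> K * \<bar>b j\<bar>"
    proof (cases "j \<le> n")
      case True
      have "\<bar>g (n - j)\<bar> / real n ^ k \<le> K" using K(2)[of n "n - j"] n by (simp add: field_simps)
      then show ?thesis using True mult_left_mono[of "\<bar>g (n - j)\<bar> / real n ^ k" K "\<bar>b j\<bar>"]
        by (simp add: abs_mult mult.commute)
    qed (use K in simp)
  qed (auto intro: eventually_ge_at_top)
  have "(\<lambda>n. \<Sum>j. if j \<le> n then b j * g (n - j) / real n ^ k else 0) \<longlonglongrightarrow> (\<Sum>j. b j * c)"
    using tannerys_theorem[OF lim bound] summable_mult[OF b] by auto
  moreover have "(\<Sum>j. if j \<le> n then b j * g (n - j) / real n ^ k else 0) = (\<Sum>j\<le>n. b j * g (n - j)) / real n ^ k" for n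
  proof -
    have "(\<Sum>j. if j \<le> n then b j * g (n - j) / real n ^ k else 0) = (\<Sum>j\<le>n. if j \<le> n then b j * g (n - j) / real n ^ k else 0)"
      by (rule suminf_finite) auto
    then show ?thesis by (simp add: sum_divide_distrib)
  qed
  moreover have "(\<Sum>j. b j * c) = c * (\<Sum>j. b j)"
    using suminf_mult[of b c] summable_rabs_cancel[OF b] by (simp add: mult.commute)
  ultimately show ?thesis by simp
qed

text \<open>Split \<open>b\<close> into \<open>L\<close> and \<open>b - L\<close>. The constant part
  yields the partial sums of \<open>g\<close>, which cost one more power of \<open>n\<close>; the
  rest is at most \<open>K * n ^ k\<close> times the sum of the \<open>\<bar>b j - L\<bar>\<close>,
  which is of smaller order than \<open>n\<close>.\<close>

lemma conv_convergent_lim: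
  fixes b g :: "nat \<Rightarrow> real"
  assumes b: "b \<longlonglongrightarrow> L" and g: "(\<lambda>n. g n / real n ^ k) \<longlonglongrightarrow> c"
  shows "(\<lambda>n. (\<Sum>j\<le>n. b j * g (n - j)) / real n ^ Suc k) \<longlonglongrightarrow> L * c / real (Suc k)"
proof -
  obtain K where K: "K \<ge> 0" "\<And>n m. n \<ge> 1 \<Longrightarrow> m \<le> n \<Longrightarrow> \<bar>g m\<bar> \<le> K * real n ^ k"
    using power_bound[OF g] by blast
  have rat: "(\<lambda>n. (real (Suc n) / real n) ^ i) \<longlonglongrightarrow> 1" for i
    using tendsto_power[OF Suc_over_lim, of i] by simp
  have S: "(\<lambda>n. (\<Sum>i<Suc n. s i) / real n ^ Suc i) \<longlonglongrightarrow> d"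
    if "(\<lambda>N. (\<Sum>i<N. s i) / real N ^ Suc i) \<longlonglongrightarrow> d" for s :: "nat \<Rightarrow> real" and i d
  proof -
    have "(\<lambda>n. (\<Sum>i<Suc n. s i) / real (Suc n) ^ Suc i * (real (Suc n) / real n) ^ Suc i) \<longlonglongrightarrow> d * 1"
      by (intro tendsto_mult rat LIMSEQ_Suc[OF that])
    then have "(\<lambda>n. (\<Sum>i<Suc n. s i) / real (Suc n) ^ Suc i * (real (Suc n) / real n) ^ Suc i) \<longlonglongrightarrow> d" by simp
    then show ?thesis
      by (rule Lim_transform_eventually)
        (auto intro!: eventually_mono[OF eventually_gt_at_top[of 0]] simp: power_divide simp del: of_nat_Suc power_Suc sum.lessThan_Suc)
  qed
  have 1: "(\<lambda>n. L * ((\<Sum>i<Suc n. g i) / real n ^ Suc k)) \<longlonglongrightarrow> L * (c / real (Suc k))"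
    by (intro tendsto_mult tendsto_const S cesaro_power g)
  have "(\<lambda>n. \<bar>b n - L\<bar>) \<longlonglongrightarrow> 0" using b by (simp add: LIM_zero_iff tendsto_rabs_zero_iff)
  then have "(\<lambda>n. K * ((\<Sum>j<Suc n. \<bar>b j - L\<bar>) / real n ^ Suc 0)) \<longlonglongrightarrow> K * 0"
    using cesaro_power[of "\<lambda>n. \<bar>b n - L\<bar>" 0 0] by (intro tendsto_mult tendsto_const S) simp
  then have bnd: "(\<lambda>n. K * ((\<Sum>j<Suc n. \<bar>b j - L\<bar>) / real n)) \<longlonglongrightarrow> 0" by simp
  have 2: "(\<lambda>n. (\<Sum>j\<le>n. (b j - L) * g (n - j)) / real n ^ Suc k) \<longlonglongrightarrow> 0"
  proof (rule Lim_null_comparison[OF _ bnd], use eventually_ge_at_top[of 1] in eventually_elim)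
    case (elim n)
    have "\<bar>\<Sum>j\<le>n. (b j - L) * g (n - j)\<bar> \<le> (\<Sum>j\<le>n. \<bar>b j - L\<bar> * (K * real n ^ k))"
      by (rule order_trans[OF sum_abs sum_mono]) (auto simp: abs_mult intro!: mult_left_mono K elim)
    also have "\<dots> = (K * real n ^ k) * (\<Sum>j<Suc n. \<bar>b j - L\<bar>)"
      unfolding lessThan_Suc_atMost by (simp only: sum_distrib_left mult.commute)
    finally show ?case using elim by (simp add: field_simps)
  qed
  have "(\<Sum>j\<le>n. b j * g (n - j)) = L * (\<Sum>i<Suc n. g i) + (\<Sum>j\<le>n. (b j - L) * g (n - j))" for n
  proof -
    have "(\<Sum>j\<le>n. g (n - j)) = (\<Sum>i<Suc n. g i)"
      unfolding lessThan_Suc_atMost by (rule sum.reindex_bij_witness[of _ "\<lambda>i. n - i" "\<lambda>i. n - i"]) auto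
    then have "L * (\<Sum>i<Suc n. g i) = (\<Sum>j\<le>n. L * g (n - j))" by (metis sum_distrib_left)
    then show ?thesis by (simp add: sum.distrib[symmetric] algebra_simps)
  qed
  then show ?thesis using tendsto_add[OF 1 2] by (simp add: add_divide_distrib del: sum.lessThan_Suc power_Suc of_nat_Suc)
qed

section \<open>Powers of positive matrices\<close>

text \<open>The index set is an argument because powers are taken both over all vertices and inside
  a single recurrent class.\<close>

primrec mat_pow :: "'a set \<Rightarrow> ('a \<Rightarrow> 'a \<Rightarrow> real) \<Rightarrow> nat \<Rightarrow> 'a \<Rightarrow> 'a \<Rightarrow> real" where
  "mat_pow C B 0 w v = (if w = v then 1 else 0)"
| "mat_pow C B (Suc n) w v = (\<Sum>z\<in>C. mat_pow C B n w z * B z v)"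

lemma mat_pow_add:
  assumes "finite C" "u \<in> C" "v \<in> C"
  shows "mat_pow C B (m + n) u v = (\<Sum>w\<in>C. mat_pow C B m u w * mat_pow C B n w v)"
  using assms(3)
proof (induction n arbitrary: v)
  case 0
  have "(\<Sum>w\<in>C. mat_pow C B m u w * mat_pow C B 0 w v) = (\<Sum>w\<in>C. if w = v then mat_pow C B m u w else 0)"
    by (intro sum.cong) auto
  then show ?case using 0 assms by (simp add: sum.delta)
next
  case (Suc n)
  have "mat_pow C B (m + Suc n) u v = (\<Sum>z\<in>C. (\<Sum>w\<in>C. mat_pow C B m u w * mat_pow C B n w z) * B z v)"
    by (simp add: Suc.IH cong: sum.cong)
  also have "\<dots> = (\<Sum>z\<in>C. \<Sum>w\<in>C. mat_pow C B m u w * (mat_pow C B n w z * B z v))"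
    by (simp add: sum_distrib_right mult.assoc)
  also have "\<dots> = (\<Sum>w\<in>C. \<Sum>z\<in>C. mat_pow C B m u w * (mat_pow C B n w z * B z v))"
    by (rule sum.swap)
  finally show ?case by (simp add: sum_distrib_left)
qed

lemma mat_pow_Suc_left:
  assumes "finite C" "u \<in> C" "v \<in> C"
  shows "mat_pow C B (Suc n) u v = (\<Sum>w\<in>C. B u w * mat_pow C B n w v)"
proof -
  have "mat_pow C B 1 u w = B u w" for w
  proof -
    have "mat_pow C B 1 u w = (\<Sum>z\<in>C. if z = u then B z w else 0)" by (auto intro: sum.cong)
    then show ?thesis using assms by (simp add: sum.delta)
  qed
  then show ?thesis using mat_pow_add[OF assms, of B 1 n] by simp
qed

lemma mat_pow_nonneg:
  assumes "\<And>w v. w \<in> C \<Longrightarrow> v \<in> C \<Longrightarrow> B w v \<ge> 0" "v \<in> C"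
  shows "mat_pow C B n u v \<ge> 0"
  using assms(2) by (induction n arbitrary: v) (auto intro!: sum_nonneg mult_nonneg_nonneg assms(1))

text \<open>Doeblin's argument: a minimiser \<open>w0\<close> carries weight at least
  \<open>d\<close>, and this mass alone pulls the average down from \<open>s\<close> by
  \<open>d * (s - m)\<close>.\<close>

lemma average_contraction:
  fixes t r :: "'a \<Rightarrow> real"
  assumes C: "finite C" and sum1: "(\<Sum>w\<in>C. t w) = 1" and t: "\<And>w. w \<in> C \<Longrightarrow> t w \<ge> d" "d \<ge> 0"
    and r: "\<And>w. w \<in> C \<Longrightarrow> m \<le> r w" "\<And>w. w \<in> C \<Longrightarrow> r w \<le> s" and w0: "w0 \<in> C" "r w0 = m"
  shows "m \<le> (\<Sum>w\<in>C. t w * r w)" "(\<Sum>w\<in>C. t w * r w) \<le> s - d * (s - m)"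
proof -
  have t0: "t w \<ge> 0" if "w \<in> C" for w using t that by fastforce
  have "(\<Sum>w\<in>C. t w * m) \<le> (\<Sum>w\<in>C. t w * r w)" using r t0 by (intro sum_mono mult_left_mono) auto
  then show "m \<le> (\<Sum>w\<in>C. t w * r w)" by (simp add: sum_distrib_right[symmetric] sum1)
  have "t w0 * (s - m) \<le> (\<Sum>w\<in>C. t w * (s - r w))"
    using member_le_sum[of w0 C "\<lambda>w. t w * (s - r w)"] w0 C t0 r by auto
  also have "\<dots> = s - (\<Sum>w\<in>C. t w * r w)"
    by (simp add: right_diff_distrib sum_subtractf sum_distrib_right[symmetric] sum1)
  finally have "(\<Sum>w\<in>C. t w * r w) \<le> s - t w0 * (s - m)" by simp
  moreover have "d * (s - m) \<le> t w0 * (s - m)" using t w0 r by (intro mult_right_mono) (auto intro: order_trans)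
  ultimately show "(\<Sum>w\<in>C. t w * r w) \<le> s - d * (s - m)" by simp
qed

text \<open>The ratios \<open>x (n + 1) v / x n v\<close> at time \<open>n + 1\<close> are averages of those at time \<open>n\<close>, with weights bounded away
  from \<open>0\<close>, so their oscillation decays geometrically.\<close>

lemma perron_row:
  fixes B :: "'a \<Rightarrow> 'a \<Rightarrow> real"
  assumes C: "finite C" and B: "\<And>w v. w \<in> C \<Longrightarrow> v \<in> C \<Longrightarrow> B w v > 0" and u: "u \<in> C"
  obtains l where "l > 0" "\<And>v. v \<in> C \<Longrightarrow> \<exists>L>0. (\<lambda>n. mat_pow C B n u v / l ^ n) \<longlonglongrightarrow> L"
proof -
  define b1 where "b1 = Min ((\<lambda>(w, v). B w v) ` (C \<times> C))"
  define b2 where "b2 = Max ((\<lambda>(w, v). B w v) ` (C \<times> C))"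
  have fin: "finite ((\<lambda>(w, v). B w v) ` (C \<times> C))" "(\<lambda>(w, v). B w v) ` (C \<times> C) \<noteq> {}" using C u by auto
  have b1: "b1 > 0" unfolding b1_def using fin B by (subst Min_gr_iff) auto
  have b1_le: "b1 \<le> B w v" if "w \<in> C" "v \<in> C" for w v
    unfolding b1_def using that by (intro Min_le[OF fin(1)]) force
  have b2_ge: "B w v \<le> b2" if "w \<in> C" "v \<in> C" for w v
    unfolding b2_def using that by (intro Max_ge[OF fin(1)]) force
  have b2: "b2 > 0" using b2_ge[OF u u] B[OF u u] by simp
  \<comment> \<open>The index is shifted by one because the zeroth power has zeros off the diagonal,
    whereas from the first power on all entries of the row are positive and may be divided
    by.\<close>
  define x where "x n v = mat_pow C B (Suc n) u v" for n v
  have xS: "x (Suc n) v = (\<Sum>z\<in>C. x n z * B z v)" for n v by (simp add: x_def)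
  have bp0: "mat_pow C B n u v \<ge> 0" if "v \<in> C" for n v using that B by (intro mat_pow_nonneg) (auto intro: less_imp_le)
  define S where "S n = (\<Sum>z\<in>C. mat_pow C B n u z)" for n
  have x_lb: "b1 * S n \<le> x n v" and x_ub: "x n v \<le> b2 * S n" if "v \<in> C" for n v
    unfolding x_def S_def sum_distrib_left mat_pow.simps mult.commute[of _ "B _ _"]
    using that b1_le b2_ge bp0 by (auto intro!: sum_mono mult_right_mono)
  have S0: "S n > 0" for n
  proof (induction n)
    case 0
    have "S 0 = (\<Sum>z\<in>C. if z = u then 1 else 0)" by (auto simp: S_def intro!: sum.cong)
    then show ?case using u C by (simp add: sum.delta)
  next
    case (Suc n)
    then have "x n u > 0" using x_lb[OF u, of n] b1 by (metis mult_pos_pos order_less_le_trans)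
    then show ?case unfolding S_def x_def[symmetric] using u C bp0
      by (intro sum_pos2[of C u]) (auto simp: x_def simp del: mat_pow.simps)
  qed
  have x0: "x n v > 0" if "v \<in> C" for n v using x_lb[OF that, of n] b1 S0[of n] by (meson mult_pos_pos order_less_le_trans)
  have xcmp: "x n w \<le> (b2 / b1) * x n v" if "w \<in> C" "v \<in> C" for n w v
  proof -
    have "x n w \<le> b2 * S n" by (rule x_ub[OF that(1)])
    also have "S n \<le> x n v / b1" using x_lb[OF that(2)] b1 by (simp add: field_simps)
    finally show ?thesis using b2 by (simp add: mult.commute)
  qed
  define t where "t n w v = x n w * B w v / x (Suc n) v" for n w v
  \<comment> \<open>Entries of \<open>x n\<close> differ at most by the factor
    \<open>b2 / b1\<close>, so \<open>x (n + 1) v \<le> card C * (b2 / b1) * x n w * b2\<close>,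
    while the numerator of \<open>t n w v\<close> is at least \<open>b1 * x n w\<close>.\<close>
  define d where "d = b1 ^ 2 / (real (card C) * b2 ^ 2)"
  have card0: "card C > 0" using u C by (auto simp: card_gt_0_iff)
  have d0: "d > 0" unfolding d_def using b1 b2 card0 by simp
  have sum_t: "(\<Sum>w\<in>C. t n w v) = 1" if "v \<in> C" for n v
    unfolding t_def sum_divide_distrib[symmetric] xS[symmetric] using x0[OF that, of "Suc n"] by simp
  have t_ge: "t n w v \<ge> d" if w: "w \<in> C" and v: "v \<in> C" for n w v
  proof -
    have "x (Suc n) v \<le> (\<Sum>z\<in>C. ((b2 / b1) * x n w) * b2)"
      unfolding xS using w v xcmp b2_ge x0[OF w, of n] B b1 b2
      by (intro sum_mono mult_mono mult_nonneg_nonneg divide_nonneg_nonneg) (auto intro: less_imp_le)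
    also have "\<dots> = real (card C) * b2 ^ 2 / b1 * x n w" by (simp add: power2_eq_square)
    finally have "d * x (Suc n) v \<le> d * (real (card C) * b2 ^ 2 / b1 * x n w)" using d0 by (intro mult_left_mono) auto
    also have "\<dots> = b1 * x n w" unfolding d_def using b1 b2 card0 by (simp add: field_simps power2_eq_square)
    also have "\<dots> \<le> B w v * x n w" using b1_le[OF w v] x0[OF w, of n] by (intro mult_right_mono) auto
    finally show ?thesis unfolding t_def using x0[OF v, of "Suc n"] by (simp add: field_simps)
  qed
  have d1: "d \<le> 1"
  proof -
    have "d \<le> t 0 u u" by (rule t_ge[OF u u])
    also have "\<dots> \<le> (\<Sum>w\<in>C. t 0 w u)" using C u t_ge d0 by (intro member_le_sum) (auto intro: order_trans less_imp_le)
    finally show ?thesis using sum_t[OF u, of 0] by simp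
  qed
  define \<rho> where "\<rho> n v = x (Suc n) v / x n v" for n v
  have \<rho>S: "\<rho> (Suc n) v = (\<Sum>w\<in>C. t n w v * \<rho> n w)" if "v \<in> C" for n v
  proof -
    have "(\<Sum>w\<in>C. t n w v * \<rho> n w) = (\<Sum>w\<in>C. x (Suc n) w * B w v / x (Suc n) v)"
    proof (intro sum.cong refl)
      fix w assume "w \<in> C"
      then show "t n w v * \<rho> n w = x (Suc n) w * B w v / x (Suc n) v"
        using x0[of w n] by (simp add: t_def \<rho>_def)
    qed
    then show ?thesis by (simp add: \<rho>_def xS[of "Suc n"] sum_divide_distrib)
  qed
  define hi where "hi n = Max (\<rho> n ` C)" for n
  define lo where "lo n = Min (\<rho> n ` C)" for n
  have fr: "finite (\<rho> n ` C)" "\<rho> n ` C \<noteq> {}" for n using C u by auto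
  have hi: "\<rho> n v \<le> hi n" and lo: "lo n \<le> \<rho> n v" if "v \<in> C" for n v
    unfolding hi_def lo_def using that C by auto
  have lohi: "lo n \<le> hi n" for n using hi[OF u, of n] lo[OF u, of n] by simp
  have step: "lo n \<le> \<rho> (Suc n) v" "\<rho> (Suc n) v \<le> hi n - d * (hi n - lo n)" if v: "v \<in> C" for n v
  proof -
    obtain w0 where w0: "w0 \<in> C" "\<rho> n w0 = lo n" using Min_in[OF fr[of n]] by (auto simp: lo_def)
    show "lo n \<le> \<rho> (Suc n) v" "\<rho> (Suc n) v \<le> hi n - d * (hi n - lo n)"
      unfolding \<rho>S[OF v] using average_contraction[OF C sum_t[OF v, of n] t_ge[OF _ v, of _ n], of "lo n" "\<rho> n" "hi n" w0]
        d0 lo hi w0 by auto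
  qed
  have loS: "lo n \<le> lo (Suc n)" for n unfolding lo_def[of "Suc n"] using step(1) fr by (intro Min.boundedI) auto
  have hiS: "hi (Suc n) \<le> hi n - d * (hi n - lo n)" for n unfolding hi_def[of "Suc n"] using step(2) fr by (intro Max.boundedI) auto
  have osc: "hi n - lo n \<le> (1 - d) ^ n * (hi 0 - lo 0)" for n
  proof (induction n)
    case (Suc n)
    have "hi (Suc n) - lo (Suc n) \<le> (1 - d) * (hi n - lo n)" using hiS[of n] loS[of n] by (simp add: algebra_simps)
    also have "\<dots> \<le> (1 - d) * ((1 - d) ^ n * (hi 0 - lo 0))" using Suc d1 by (intro mult_left_mono) auto
    finally show ?case by simp
  qed simp
  have inc: "incseq lo" using loS by (intro incseq_SucI)
  have "hi (Suc n) \<le> hi n" for n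
    using hiS[of n] lohi[of n] d0 mult_nonneg_nonneg[of d "hi n - lo n"] by linarith
  then have dec: "decseq hi" by (intro decseq_SucI)
  have lo_hi: "lo n \<le> hi m" for n m
  proof -
    have "lo n \<le> lo (max n m)" using inc by (simp add: incseqD)
    also have "\<dots> \<le> hi (max n m)" by (rule lohi)
    also have "\<dots> \<le> hi m" using dec by (simp add: decseqD)
    finally show ?thesis .
  qed
  define l where "l = (SUP n. lo n)"
  have bdd: "bdd_above (range lo)" using lo_hi by (intro bdd_aboveI2)
  have lo_l: "lo n \<le> l" for n unfolding l_def using bdd by (intro cSUP_upper) auto
  have l_hi: "l \<le> hi n" for n unfolding l_def using lo_hi by (intro cSUP_least) auto
  have l0: "l > 0"
  proof -
    obtain w0 where w0: "w0 \<in> C" "\<rho> 0 w0 = lo 0" using Min_in[OF fr[of 0]] by (auto simp: lo_def)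
    have "lo 0 > 0" using w0 x0[of w0] by (simp add: \<rho>_def flip: w0(2))
    then show ?thesis using lo_l[of 0] by simp
  qed
  show ?thesis
  proof (rule that[OF l0])
    fix v assume v: "v \<in> C"
    \<comment> \<open>The product of these factors telescopes to
      \<open>x (n + 1) v / l ^ (n + 1)\<close>, up to the constant \<open>x 0 v\<close>. The
      geometric decay of the oscillation makes \<open>f n - 1\<close> absolutely summable, and an
      absolutely convergent product of nonzero factors has a nonzero limit; this gives
      \<open>L > 0\<close>.\<close>
    define f where "f n = \<rho> n v / l" for n
    have f0: "f n \<noteq> 0" for n using x0[OF v, of n] x0[OF v, of "Suc n"] l0 by (simp add: f_def \<rho>_def)
    have "summable (\<lambda>n. norm (f n - 1))"
    proof (rule summable_comparison_test)
      have "norm (norm (f n - 1)) \<le> (1 - d) ^ n * ((hi 0 - lo 0) / l)" for n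
      proof -
        have "\<bar>\<rho> n v - l\<bar> \<le> hi n - lo n" using lo[OF v, of n] hi[OF v, of n] lo_l[of n] l_hi[of n] by linarith
        then have "\<bar>\<rho> n v - l\<bar> \<le> (1 - d) ^ n * (hi 0 - lo 0)" using osc[of n] by linarith
        moreover have "f n - 1 = (\<rho> n v - l) / l" using l0 by (simp add: f_def field_simps)
        ultimately show ?thesis using l0 by (simp add: abs_divide divide_right_mono)
      qed
      then show "\<exists>N. \<forall>n\<ge>N. norm (norm (f n - 1)) \<le> (1 - d) ^ n * ((hi 0 - lo 0) / l)" by blast
      show "summable (\<lambda>n. (1 - d) ^ n * ((hi 0 - lo 0) / l))"
        using d0 d1 by (intro summable_mult2 summable_geometric) auto
    qed
    then have cp: "convergent_prod f"
      using abs_convergent_prod_conv_summable abs_convergent_prod_imp_convergent_prod by blast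
    then have lim: "(\<lambda>n. \<Prod>i\<le>n. f i) \<longlonglongrightarrow> prodinf f" by (rule convergent_prod_LIMSEQ)
    have nz: "prodinf f \<noteq> 0" using prodinf_nonzero[OF cp] f0 by simp
    have prod: "(\<Prod>i\<le>n. f i) = (x (Suc n) v / l ^ Suc n) / x 0 v" for n
    proof (induction n)
      case 0 then show ?case by (simp add: f_def \<rho>_def)
    next
      case (Suc n)
      have "(\<Prod>i\<le>Suc n. f i) = (x (Suc n) v / l ^ Suc n) / x 0 v * f (Suc n)" using Suc by simp
      then show ?case using x0[OF v, of "Suc n"] by (simp add: f_def \<rho>_def)
    qed
    have "(\<lambda>n. (x 0 v / l) * (\<Prod>i\<le>n. f i)) \<longlonglongrightarrow> (x 0 v / l) * prodinf f" by (intro tendsto_mult tendsto_const lim)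
    moreover have "(x 0 v / l) * (\<Prod>i\<le>n. f i) = mat_pow C B (n + 2) u v / l ^ (n + 2)" for n
      unfolding prod using x0[OF v, of 0] by (simp add: x_def del: mat_pow.simps)
    ultimately have lim2: "(\<lambda>n. mat_pow C B (n + 2) u v / l ^ (n + 2)) \<longlonglongrightarrow> (x 0 v / l) * prodinf f" by simp
    have "(x 0 v / l) * prodinf f \<ge> 0"
      by (rule LIMSEQ_le_const[OF lim2], intro exI[of _ 0] allI impI divide_nonneg_nonneg bp0 v) (use l0 in simp)
    moreover have "(x 0 v / l) * prodinf f \<noteq> 0" using nz x0[OF v, of 0] l0 by simp
    ultimately have "(x 0 v / l) * prodinf f > 0" by linarith
    then show "\<exists>L>0. (\<lambda>n. mat_pow C B n u v / l ^ n) \<longlonglongrightarrow> L"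
      using LIMSEQ_offset[OF lim2] by blast
  qed
qed

text \<open>\<open>perron_row\<close> yields a rate for each row separately. They agree because
  \<open>u\<close> reaches \<open>u'\<close> in one step:
  \<open>B u u' * mat_pow C B n u' u \<le> mat_pow C B (n + 1) u u\<close>, so a rate of
  \<open>u'\<close> larger than that of \<open>u\<close> would force
  \<open>L u' u \<le> 0\<close>.\<close>

lemma perron:
  fixes B :: "'a \<Rightarrow> 'a \<Rightarrow> real"
  assumes C: "finite C" "C \<noteq> {}" and B: "\<And>w v. w \<in> C \<Longrightarrow> v \<in> C \<Longrightarrow> B w v > 0"
  obtains l L where "l > 0" "\<And>u v. u \<in> C \<Longrightarrow> v \<in> C \<Longrightarrow> L u v > 0"
    "\<And>u v. u \<in> C \<Longrightarrow> v \<in> C \<Longrightarrow> (\<lambda>n. mat_pow C B n u v / l ^ n) \<longlonglongrightarrow> L u v"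
proof -
  have "\<forall>u\<in>C. \<exists>l>0. \<forall>v\<in>C. \<exists>L>0. (\<lambda>n. mat_pow C B n u v / l ^ n) \<longlonglongrightarrow> L"
  proof
    fix u assume u: "u \<in> C"
    show "\<exists>l>0. \<forall>v\<in>C. \<exists>L>0. (\<lambda>n. mat_pow C B n u v / l ^ n) \<longlonglongrightarrow> L"
      by (rule perron_row[where C=C and B=B and u=u]) (use C B u in blast)+
  qed
  then obtain lu L where lu: "\<And>u. u \<in> C \<Longrightarrow> lu u > 0"
    and L: "\<And>u v. u \<in> C \<Longrightarrow> v \<in> C \<Longrightarrow> L u v > 0 \<and> (\<lambda>n. mat_pow C B n u v / lu u ^ n) \<longlonglongrightarrow> L u v"
    by metis
  have le: "lu u' \<le> lu u" if u: "u \<in> C" "u' \<in> C" for u u'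
  proof (rule ccontr)
    assume "\<not> lu u' \<le> lu u"
    then have lt: "lu u < lu u'" by simp
    have "(\<lambda>n. (mat_pow C B (Suc n) u u / lu u ^ Suc n) * (lu u / B u u') * (lu u / lu u') ^ n) \<longlonglongrightarrow>
       L u u * (lu u / B u u') * 0"
      using LIMSEQ_Suc[OF conjunct2[OF L[OF u(1) u(1)]]] lu[OF u(1)] lt
      by (intro tendsto_mult tendsto_const LIMSEQ_power_zero) auto
    then have z: "(\<lambda>n. (mat_pow C B (Suc n) u u / lu u ^ Suc n) * (lu u / B u u') * (lu u / lu u') ^ n) \<longlonglongrightarrow> 0"
      by simp
    have "mat_pow C B n u' u / lu u' ^ n \<le> (mat_pow C B (Suc n) u u / lu u ^ Suc n) * (lu u / B u u') * (lu u / lu u') ^ n" for n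
    proof -
      have "B u u' * mat_pow C B n u' u \<le> mat_pow C B (Suc n) u u"
        unfolding mat_pow_Suc_left[OF C(1) u(1) u(1)]
      proof (rule member_le_sum[OF u(2) _ C(1), of "\<lambda>w. B u w * mat_pow C B n w u"])
        fix w assume w: "w \<in> C - {u'}"
        have "mat_pow C B n w u \<ge> 0" using B u by (intro mat_pow_nonneg) (auto intro: less_imp_le)
        then show "0 \<le> B u w * mat_pow C B n w u" using B[OF u(1), of w] w by simp
      qed
      then have "mat_pow C B n u' u \<le> mat_pow C B (Suc n) u u / B u u'" using B[OF u] by (simp add: field_simps)
      moreover have "(mat_pow C B (Suc n) u u / lu u ^ Suc n) * (lu u / B u u') * (lu u / lu u') ^ n
          = (mat_pow C B (Suc n) u u / B u u') / lu u' ^ n"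
        using lu[OF u(1)] by (simp add: power_divide del: mat_pow.simps)
      moreover have "0 \<le> lu u' ^ n" using lu[OF u(2)] by simp
      ultimately show ?thesis by (metis divide_right_mono)
    qed
    then have "L u' u \<le> 0"
      using L[OF u(2) u(1)] z by (intro LIMSEQ_le[OF conjunct2[OF L[OF u(2) u(1)]] z]) auto
    then show False using L[OF u(2) u(1)] by simp
  qed
  obtain u0 where u0: "u0 \<in> C" using C by auto
  have "lu u = lu u0" if "u \<in> C" for u using le[OF that u0] le[OF u0 that] by simp
  then show ?thesis using that[of "lu u0" L] lu[OF u0] L by auto
qed

section \<open>Sequences of regular growth\<close>

definition growth :: "nat \<Rightarrow> real \<Rightarrow> nat \<Rightarrow> real" where
  "growth k l n = real n ^ k * l ^ n"

text \<open>Sequences that vanish eventually have no growth rate and form a case of their own; they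
  arise from vertices that no long path of the given residue reaches. Positivity of \<open>c\<close>
  makes the pair \<open>(k, l)\<close> unique, see \<open>asymp_unique\<close>.\<close>

definition regular_growth :: "(nat \<Rightarrow> real) \<Rightarrow> bool" where
  "regular_growth a \<longleftrightarrow> (\<forall>n. 0 \<le> a n) \<and> ((\<forall>\<^sub>F n in sequentially. a n = 0) \<or>
     (\<exists>k l c. l > 0 \<and> c > 0 \<and> (\<lambda>n. a n / growth k l n) \<longlonglongrightarrow> c))"

lemma growth_pos: "l > 0 \<Longrightarrow> n > 0 \<Longrightarrow> growth k l n > 0"
  by (simp add: growth_def)

lemma summable_power_geometric:
  assumes x: "0 < x" "x < (1::real)"
  shows "summable (\<lambda>n. real n ^ k * x ^ n)"
proof -
  define c where "c = (1 + x) / 2"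
  have c: "x < c" "c < 1" using x by (auto simp: c_def)
  have "(\<lambda>n. (real (Suc n) / real n) ^ k * x) \<longlonglongrightarrow> 1 ^ k * x"
    by (intro tendsto_mult tendsto_power Suc_over_lim tendsto_const)
  then have "\<forall>\<^sub>F n in sequentially. (real (Suc n) / real n) ^ k * x < c"
    using c by (intro order_tendstoD) auto
  then have "\<forall>\<^sub>F n in sequentially. norm (real (Suc n) ^ k * x ^ Suc n) \<le> c * norm (real n ^ k * x ^ n)"
    using eventually_gt_at_top[of 0]
  proof eventually_elim
    case (elim n)
    then have "real (Suc n) ^ k * x \<le> c * real n ^ k" by (simp add: power_divide field_simps del: of_nat_Suc)
    then have "(real (Suc n) ^ k * x) * x ^ n \<le> (c * real n ^ k) * x ^ n" using x by (intro mult_right_mono) auto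
    then show ?case using x by (simp add: mult_ac del: of_nat_Suc)
  qed
  then obtain N where "\<And>n. n \<ge> N \<Longrightarrow> norm (real (Suc n) ^ k * x ^ Suc n) \<le> c * norm (real n ^ k * x ^ n)"
    by (auto simp: eventually_sequentially)
  then show ?thesis by (rule summable_ratio_test[OF c(2)])
qed

lemma growth_less_base:
  assumes "0 < l" "l < l'" shows "(\<lambda>n. growth k l n / growth k' l' n) \<longlonglongrightarrow> 0"
proof (rule Lim_null_comparison)
  have "summable (\<lambda>n. real n ^ k * (l / l') ^ n)" using assms by (intro summable_power_geometric) auto
  then show "(\<lambda>n. real n ^ k * (l / l') ^ n) \<longlonglongrightarrow> 0" by (rule summable_LIMSEQ_zero)
  show "\<forall>\<^sub>F n in sequentially. norm (growth k l n / growth k' l' n) \<le> real n ^ k * (l / l') ^ n"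
    using eventually_gt_at_top[of 0]
  proof eventually_elim
    case (elim n)
    have "growth k l n / growth k' l' n = real n ^ k * (l / l') ^ n * (1 / real n ^ k')"
      by (simp add: growth_def power_divide)
    also have "norm \<dots> \<le> real n ^ k * (l / l') ^ n * 1"
      unfolding norm_mult using assms elim by (intro mult_mono) auto
    finally show ?case by simp
  qed
qed

lemma growth_less_power:
  assumes "0 < l" "k < k'" shows "(\<lambda>n. growth k l n / growth k' l n) \<longlonglongrightarrow> 0"
proof -
  have "(\<lambda>n. (1 / real n) ^ (k' - k)) \<longlonglongrightarrow> 0 ^ (k' - k)"
    by (intro tendsto_power lim_1_over_n)
  then have "(\<lambda>n. (1 / real n) ^ (k' - k)) \<longlonglongrightarrow> 0" using assms by (simp only: zero_power zero_less_diff)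
  then show ?thesis
  proof (rule Lim_transform_eventually, use eventually_gt_at_top[of 0] in eventually_elim)
    case (elim n)
    have "real n ^ k' = real n ^ (k' - k) * real n ^ k" using assms by (simp add: power_add[symmetric])
    then show ?case using elim assms by (simp add: growth_def power_divide)
  qed
qed

text \<open>The scales are totally ordered: first by the base, and for equal bases by the exponent
  of \<open>n\<close>.\<close>

lemma growth_cases:
  assumes "0 < l" "0 < l'"
  obtains "(\<lambda>n. growth k l n / growth k' l' n) \<longlonglongrightarrow> 0" | "(\<lambda>n. growth k' l' n / growth k l n) \<longlonglongrightarrow> 0" | "k = k'" "l = l'"
  using growth_less_base[of l l' k k'] growth_less_base[of l' l k' k] growth_less_power[of l k k'] growth_less_power[of l k' k] assms
  by (metis linorder_neqE_linordered_idom linorder_neqE_nat)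

lemma growth_trans_lim:
  assumes "l > 0" "(\<lambda>n. a n / growth k l n) \<longlonglongrightarrow> c" "(\<lambda>n. growth k l n / growth k' l' n) \<longlonglongrightarrow> d"
  shows "(\<lambda>n. a n / growth k' l' n) \<longlonglongrightarrow> c * d"
proof -
  from tendsto_mult[OF assms(2,3)] show ?thesis
    by (rule Lim_transform_eventually, intro eventually_mono[OF eventually_gt_at_top[of 0]])
      (use growth_pos[OF assms(1), of _ k] in \<open>auto simp: less_imp_neq[symmetric]\<close>)
qed

lemma regular_growth_nonneg: "regular_growth a \<Longrightarrow> 0 \<le> a n"
  by (simp add: regular_growth_def)

lemma regular_growthI:
  "(\<And>n. 0 \<le> a n) \<Longrightarrow> l > 0 \<Longrightarrow> c > 0 \<Longrightarrow> (\<lambda>n. a n / growth k l n) \<longlonglongrightarrow> c \<Longrightarrow> regular_growth a"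
  unfolding regular_growth_def by blast

lemma regular_growth_zero: "regular_growth (\<lambda>_. 0)"
  by (simp add: regular_growth_def)

text \<open>The scale of \<open>a\<close> cannot exceed that of \<open>b\<close>: otherwise
  \<open>b\<close> divided by the scale of \<open>a\<close> would tend to 0 and force the positive
  limit of \<open>a\<close> to be nonpositive. For a smaller scale the limit is 0.\<close>

lemma regular_growth_dom:
  assumes a: "regular_growth a" and ab: "\<And>n. a n \<le> b n" and l: "l > 0" and b: "(\<lambda>n. b n / growth k l n) \<longlonglongrightarrow> c"
  shows "convergent (\<lambda>n. a n / growth k l n)"
  using a unfolding regular_growth_def
proof (elim conjE disjE exE)
  assume "\<forall>\<^sub>F n in sequentially. a n = 0"
  then have "(\<lambda>n. a n / growth k l n) \<longlonglongrightarrow> 0" by (intro tendsto_eventually) (auto elim: eventually_mono)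
  then show ?thesis by (rule convergentI)
next
  fix k' l' c' assume l': "l' > 0" and c': "c' > 0" and lim: "(\<lambda>n. a n / growth k' l' n) \<longlonglongrightarrow> c'"
  show ?thesis
  proof (rule growth_cases[OF l' l, of k' k])
    assume "(\<lambda>n. growth k' l' n / growth k l n) \<longlonglongrightarrow> 0"
    from growth_trans_lim[OF l' lim this] show ?thesis by (rule convergentI)
  next
    assume "(\<lambda>n. growth k l n / growth k' l' n) \<longlonglongrightarrow> 0"
    from growth_trans_lim[OF l b this] have "(\<lambda>n. b n / growth k' l' n) \<longlonglongrightarrow> 0" by simp
    from LIMSEQ_le[OF lim this] have "c' \<le> 0"
      using ab l' by (auto simp: growth_def divide_right_mono)
    then show ?thesis using c' by simp
  next
    assume "k' = k" "l' = l" then show ?thesis using lim convergentI by blast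
  qed
qed

lemma regular_growth_add:
  assumes a: "regular_growth a" and b: "regular_growth b" shows "regular_growth (\<lambda>n. a n + b n)"
proof -
  have nn: "0 \<le> a n + b n" for n using assms by (simp add: regular_growth_nonneg)
  have ev0: "regular_growth (\<lambda>n. a n + b n)" if a: "regular_growth a" and b: "regular_growth b" and z: "\<forall>\<^sub>F n in sequentially. b n = 0" for a b
  proof -
    from a have nn: "0 \<le> a n + b n" for n using a b by (simp add: regular_growth_nonneg)
    from a show ?thesis unfolding regular_growth_def
    proof (elim conjE disjE exE)
      assume "\<forall>\<^sub>F n in sequentially. a n = 0"
      with z have "\<forall>\<^sub>F n in sequentially. a n + b n = 0" by eventually_elim simp
      then show "(\<forall>n. 0 \<le> a n + b n) \<and> ((\<forall>\<^sub>F n in sequentially. a n + b n = 0) \<or>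
        (\<exists>k l c. 0 < l \<and> 0 < c \<and> (\<lambda>n. (a n + b n) / growth k l n) \<longlonglongrightarrow> c))" using nn by blast
    next
      fix k l c assume l: "l > 0" and c: "c > 0" and lim: "(\<lambda>n. a n / growth k l n) \<longlonglongrightarrow> c"
      have "(\<lambda>n. (a n + b n) / growth k l n) \<longlonglongrightarrow> c"
        by (rule Lim_transform_eventually[OF lim], use z in eventually_elim) simp
      then show "(\<forall>n. 0 \<le> a n + b n) \<and> ((\<forall>\<^sub>F n in sequentially. a n + b n = 0) \<or>
        (\<exists>k l c. 0 < l \<and> 0 < c \<and> (\<lambda>n. (a n + b n) / growth k l n) \<longlonglongrightarrow> c))" using nn l c by blast
    qed
  qed
  show ?thesis
  proof (cases "(\<forall>\<^sub>F n in sequentially. a n = 0) \<or> (\<forall>\<^sub>F n in sequentially. b n = 0)")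
    case True
    then show ?thesis using ev0[OF a b] ev0[OF b a] by (auto simp: add.commute)
  next
    case False
    then obtain k l c k' l' c' where 1: "l > 0" "c > 0" "(\<lambda>n. a n / growth k l n) \<longlonglongrightarrow> c"
      and 2: "l' > 0" "c' > 0" "(\<lambda>n. b n / growth k' l' n) \<longlonglongrightarrow> c'"
      using a b unfolding regular_growth_def by blast
    show ?thesis
    proof (rule growth_cases[OF 1(1) 2(1), of k k'])
      assume "(\<lambda>n. growth k l n / growth k' l' n) \<longlonglongrightarrow> 0"
      from tendsto_add[OF growth_trans_lim[OF 1(1,3) this] 2(3)] show ?thesis
        by (intro regular_growthI[where k=k', OF nn 2(1,2)]) (simp add: add_divide_distrib)
    next
      assume "(\<lambda>n. growth k' l' n / growth k l n) \<longlonglongrightarrow> 0"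
      from tendsto_add[OF 1(3) growth_trans_lim[OF 2(1,3) this]] show ?thesis
        by (intro regular_growthI[where k=k, OF nn 1(1,2)]) (simp add: add_divide_distrib)
    next
      assume "k = k'" "l = l'"
      with tendsto_add[OF 1(3) 2(3)] show ?thesis
        using 1 2 by (intro regular_growthI[where c="c + c'" and k=k, OF nn 1(1)]) (auto simp add: add_divide_distrib)
    qed
  qed
qed

lemma regular_growth_cmult:
  assumes "regular_growth a" "0 < b" shows "regular_growth (\<lambda>n. b * a n)"
proof -
  have nn: "0 \<le> b * a n" for n using assms by (simp add: regular_growth_nonneg)
  from assms(1) consider "\<forall>\<^sub>F n in sequentially. a n = 0"
    | k l c where "l > 0" "c > 0" "(\<lambda>n. a n / growth k l n) \<longlonglongrightarrow> c" unfolding regular_growth_def by blast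
  then show ?thesis
  proof cases
    case 1
    then have "\<forall>\<^sub>F n in sequentially. b * a n = 0" by eventually_elim simp
    then show ?thesis using nn by (simp add: regular_growth_def)
  next
    case 2
    from tendsto_mult[OF tendsto_const[of b] 2(3)] show ?thesis
      using 2 assms by (intro regular_growthI[where c="b * c" and k=k, OF nn 2(1)]) auto
  qed
qed

lemma growth_Suc_lim: "l > 0 \<Longrightarrow> (\<lambda>n. growth k l (Suc n) / growth k l n) \<longlonglongrightarrow> l"
proof -
  assume l: "l > 0"
  have "(\<lambda>n. (real (Suc n) / real n) ^ k * l) \<longlonglongrightarrow> 1 ^ k * l"
    by (intro tendsto_mult tendsto_power Suc_over_lim tendsto_const)
  then show ?thesis using l by (simp add: growth_def power_divide)
qed

lemma asymp_Suc_iff: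
  assumes l: "l > 0"
  shows "(\<lambda>n. a (Suc n) / growth k l n) \<longlonglongrightarrow> c * l \<longleftrightarrow> (\<lambda>n. a n / growth k l n) \<longlonglongrightarrow> c"
proof
  assume "(\<lambda>n. a n / growth k l n) \<longlonglongrightarrow> c"
  from tendsto_mult[OF LIMSEQ_Suc[OF this] growth_Suc_lim[OF l, of k]]
  show "(\<lambda>n. a (Suc n) / growth k l n) \<longlonglongrightarrow> c * l"
    by (rule Lim_transform_eventually, intro eventually_mono[OF eventually_gt_at_top[of 0]])
      (use growth_pos[OF l, of "Suc _" k] in \<open>auto simp: less_imp_neq[symmetric]\<close>)
next
  assume "(\<lambda>n. a (Suc n) / growth k l n) \<longlonglongrightarrow> c * l"
  from tendsto_divide[OF this growth_Suc_lim[OF l, of k]] l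
  have "(\<lambda>n. a (Suc n) / growth k l n / (growth k l (Suc n) / growth k l n)) \<longlonglongrightarrow> c" by simp
  then have "(\<lambda>n. a (Suc n) / growth k l (Suc n)) \<longlonglongrightarrow> c"
    by (rule Lim_transform_eventually, intro eventually_mono[OF eventually_gt_at_top[of 0]])
      (use growth_pos[OF l, of _ k] in \<open>auto simp: less_imp_neq[symmetric]\<close>)
  then show "(\<lambda>n. a n / growth k l n) \<longlonglongrightarrow> c" by (rule LIMSEQ_imp_Suc)
qed

lemma regular_growth_unshift:
  assumes "regular_growth (\<lambda>n. a (Suc n))" "0 \<le> a 0" shows "regular_growth a"
proof -
  have nn: "0 \<le> a n" for n using assms regular_growth_nonneg[OF assms(1)] by (cases n) auto
  from assms(1) consider "\<forall>\<^sub>F n in sequentially. a (Suc n) = 0"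
    | k l c where "l > 0" "c > 0" "(\<lambda>n. a (Suc n) / growth k l n) \<longlonglongrightarrow> c" unfolding regular_growth_def by blast
  then show ?thesis
  proof cases
    case 1
    then have "\<forall>\<^sub>F n in sequentially. a n = 0"
      using eventually_sequentially_Suc[of "\<lambda>n. a n = 0"] by simp
    then show ?thesis using nn by (simp add: regular_growth_def)
  next
    case 2
    then have "(\<lambda>n. a n / growth k l n) \<longlonglongrightarrow> c / l" using asymp_Suc_iff[OF 2(1), of a k "c / l"] by simp
    then show ?thesis using 2 nn by (intro regular_growthI[where l=l and c="c / l" and k=k]) auto
  qed
qed

text \<open>These are the regimes of a convolution with a sequence of order \<open>l ^ n\<close>:
  \<open>a\<close> is summable after scaling, is resonant with \<open>l\<close>, or grows faster. A
  base below \<open>l\<close> falls under the first whatever the power of \<open>n\<close>.\<close>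

lemma regular_growth_trichotomy:
  assumes a: "regular_growth a" and l: "l > 0"
  obtains "summable (\<lambda>n. a n / l ^ n)"
    | k c where "c > 0" "(\<lambda>n. a n / growth k l n) \<longlonglongrightarrow> c"
    | k l' c where "l' > l" "c > 0" "(\<lambda>n. a n / growth k l' n) \<longlonglongrightarrow> c"
proof -
  from a consider (z) "\<forall>\<^sub>F n in sequentially. a n = 0"
    | (asy) k l c where "l > 0" "c > 0" "(\<lambda>n. a n / growth k l n) \<longlonglongrightarrow> c" unfolding regular_growth_def by blast
  then show ?thesis
  proof cases
    case z
    have "summable (\<lambda>n. a n / l ^ n)"
    proof (rule summable_comparison_test_ev)
      show "\<forall>\<^sub>F n in sequentially. norm (a n / l ^ n) \<le> 0" using z by eventually_elim simp
      show "summable (\<lambda>n::nat. 0::real)" by simp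
    qed
    then show ?thesis by (rule that(1))
  next
    case (asy k l' c)
    consider "l' < l" | "l' = l" | "l' > l" by linarith
    then show ?thesis
    proof cases
      case 1
      have "\<forall>\<^sub>F n in sequentially. a n / growth k l' n < c + 1" using asy(3) by (intro order_tendstoD) auto
      then have ev: "\<forall>\<^sub>F n in sequentially. norm (a n / l ^ n) \<le> (c + 1) * (real n ^ k * (l' / l) ^ n)"
        using eventually_gt_at_top[of 0]
      proof eventually_elim
        case (elim n)
        then have "a n \<le> (c + 1) * growth k l' n" using growth_pos[OF asy(1), of n k] by (simp add: field_simps)
        then have "a n / l ^ n \<le> (c + 1) * growth k l' n / l ^ n" using l by (intro divide_right_mono) auto
        then show ?case using regular_growth_nonneg[OF a, of n] l by (simp add: growth_def power_divide)
      qed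
      have "summable (\<lambda>n. (c + 1) * (real n ^ k * (l' / l) ^ n))"
        using 1 asy l by (intro summable_mult summable_power_geometric) auto
      from summable_comparison_test_ev[OF ev this] show ?thesis by (rule that(1))
    qed (use that asy in blast)+
  qed
qed

lemma suminf_pos_if_nonzero:
  fixes b :: "nat \<Rightarrow> real"
  assumes "summable b" "\<And>n. 0 \<le> b n" "b i \<noteq> 0" shows "suminf b > 0"
  using suminf_pos2[OF assms(1,2), of i] assms(2)[of i] assms(3) by force

section \<open>Convolution with a sequence of exact order \<open>l ^ n\<close>\<close>

lemma conv_scale:
  fixes b a :: "nat \<Rightarrow> real"
  assumes "l > 0"
  shows "(\<Sum>j\<le>n. b j * a (n - j)) / l ^ n = (\<Sum>j\<le>n. (b j / l ^ j) * (a (n - j) / l ^ (n - j)))"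
  unfolding sum_divide_distrib
proof (intro sum.cong refl)
  fix j assume "j \<in> {..n}"
  then have "l ^ n = l ^ j * l ^ (n - j)" by (simp add: power_add[symmetric])
  then show "b j * a (n - j) / l ^ n = (b j / l ^ j) * (a (n - j) / l ^ (n - j))" by simp
qed

lemma conv_commute: "(\<Sum>j\<le>n. b j * a (n - j)) = (\<Sum>j\<le>n. a j * (b (n - j) :: real))" for n :: nat
  by (rule sum.reindex_bij_witness[of _ "\<lambda>j. n - j" "\<lambda>j. n - j"]) auto

lemma asymp_divide_base: "(\<lambda>n. a n / growth k l n) \<longlonglongrightarrow> c \<longleftrightarrow> (\<lambda>n. (a n / l ^ n) / real n ^ k) \<longlonglongrightarrow> c"
  by (simp add: growth_def mult.commute)

lemma conv_asymp_summable:
  assumes "l > 0" "summable (\<lambda>n. \<bar>a n / l ^ n\<bar>)" "(\<lambda>n. b n / l ^ n) \<longlonglongrightarrow> L"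
  shows "(\<lambda>n. (\<Sum>j\<le>n. b j * a (n - j)) / growth 0 l n) \<longlonglongrightarrow> L * (\<Sum>n. a n / l ^ n)"
  unfolding asymp_divide_base conv_commute[of b a] conv_scale[OF assms(1)]
  using conv_summable_lim[OF assms(2), of "\<lambda>n. b n / l ^ n" 0 L] assms(3) by simp

text \<open>The resonant regime: neither factor is summable after scaling, and the exponent of
  \<open>n\<close> increases by one.\<close>

lemma conv_asymp_eq:
  assumes "l > 0" "(\<lambda>n. a n / growth k l n) \<longlonglongrightarrow> c" "(\<lambda>n. b n / l ^ n) \<longlonglongrightarrow> L"
  shows "(\<lambda>n. (\<Sum>j\<le>n. b j * a (n - j)) / growth (Suc k) l n) \<longlonglongrightarrow> L * c / real (Suc k)"
  unfolding asymp_divide_base conv_scale[OF assms(1)]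
  using conv_convergent_lim[OF assms(3) assms(2)[unfolded asymp_divide_base]] by simp

lemma summable_smaller_base:
  fixes b :: "nat \<Rightarrow> real"
  assumes "l > 0" "l' > l" "(\<lambda>n. b n / l ^ n) \<longlonglongrightarrow> L"
  shows "summable (\<lambda>n. \<bar>b n / l' ^ n\<bar>)"
proof -
  have "Bseq (\<lambda>n. b n / l ^ n)" using assms(3) convergentI convergent_imp_Bseq by blast
  then obtain K where K: "\<And>n. \<bar>b n / l ^ n\<bar> \<le> K" by (auto simp: Bseq_def)
  show ?thesis
  proof (rule summable_comparison_test)
    have "norm \<bar>b n / l' ^ n\<bar> \<le> K * (l / l') ^ n" for n
    proof -
      have "\<bar>b n / l' ^ n\<bar> = \<bar>b n / l ^ n\<bar> * (l / l') ^ n" using assms by (simp add: power_divide)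
      also have "\<dots> \<le> K * (l / l') ^ n" using K assms by (intro mult_right_mono) auto
      finally show ?thesis by simp
    qed
    then show "\<exists>N. \<forall>n\<ge>N. norm \<bar>b n / l' ^ n\<bar> \<le> K * (l / l') ^ n" by blast
    show "summable (\<lambda>n. K * (l / l') ^ n)" using assms by (intro summable_mult summable_geometric) auto
  qed
qed

text \<open>Scaled by the larger base \<open>l'\<close>, it is \<open>b\<close> that becomes
  summable, so the roles are opposite to those in \<open>conv_asymp_summable\<close>.\<close>

lemma conv_asymp_larger:
  assumes "l > 0" "l' > l" "(\<lambda>n. a n / growth k l' n) \<longlonglongrightarrow> c" "(\<lambda>n. b n / l ^ n) \<longlonglongrightarrow> L"
  shows "(\<lambda>n. (\<Sum>j\<le>n. b j * a (n - j)) / growth k l' n) \<longlonglongrightarrow> c * (\<Sum>n. b n / l' ^ n)"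
proof -
  have l': "l' > 0" using assms by simp
  show ?thesis
    unfolding asymp_divide_base conv_scale[OF l']
    by (rule conv_summable_lim[OF summable_smaller_base[OF assms(1,2,4)] assms(3)[unfolded asymp_divide_base]])
qed

lemma regular_growth_conv:
  assumes a: "regular_growth a" and l: "l > 0" and b: "(\<lambda>n. b n / l ^ n) \<longlonglongrightarrow> L" "L > 0" "\<And>n. b n \<ge> 0"
  shows "regular_growth (\<lambda>n. \<Sum>j\<le>n. b j * a (n - j))"
proof -
  have nn: "0 \<le> (\<Sum>j\<le>n. b j * a (n - j))" for n by (intro sum_nonneg mult_nonneg_nonneg b regular_growth_nonneg[OF a])
  show ?thesis
  proof (rule regular_growth_trichotomy[OF a l])
    assume s: "summable (\<lambda>n. a n / l ^ n)"
    \<comment> \<open>Regular growth requires a positive constant, here \<open>L\<close> times the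
      total mass of the scaled \<open>a\<close>; it could vanish only for \<open>a\<close>
      identically zero.\<close>
    show ?thesis
    proof (cases "\<forall>n. a n = 0")
      case True
      then show ?thesis by (simp add: regular_growth_zero)
    next
      case False
      then obtain i where i: "a i \<noteq> 0" by blast
      have "(\<Sum>n. a n / l ^ n) > 0"
        using i l by (intro suminf_pos_if_nonzero[OF s, of i]) (auto simp: regular_growth_nonneg[OF a])
      then show ?thesis
        using conv_asymp_summable[OF l _ b(1), of a] s regular_growth_nonneg[OF a] l b
        by (intro regular_growthI[where c="L * (\<Sum>n. a n / l ^ n)" and k=0, OF nn l]) auto
    qed
  next
    fix k c assume "c > 0" "(\<lambda>n. a n / growth k l n) \<longlonglongrightarrow> c"
    then show ?thesis using conv_asymp_eq[OF l _ b(1)] b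
      by (intro regular_growthI[where c="L * c / real (Suc k)" and k="Suc k", OF nn l]) auto
  next
    fix k l' c assume l': "l' > l" and c: "c > 0" and lim: "(\<lambda>n. a n / growth k l' n) \<longlonglongrightarrow> c"
    have s: "summable (\<lambda>n. b n / l' ^ n)" using summable_rabs_cancel[OF summable_smaller_base[OF l l' b(1)]] .
    have "\<exists>i. b i \<noteq> 0"
    proof (rule ccontr)
      assume "\<nexists>i. b i \<noteq> 0"
      then have "L = 0" using b(1) by (auto simp: LIMSEQ_const_iff)
      then show False using b by simp
    qed
    then obtain i where "b i \<noteq> 0" by blast
    then have "(\<Sum>n. b n / l' ^ n) > 0" using l l' b by (intro suminf_pos_if_nonzero[OF s, of i]) auto
    then show ?thesis using l l' c
      by (intro regular_growthI[OF nn _ _ conv_asymp_larger[OF l l' lim b(1)]]) auto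
  qed
qed

section \<open>Convolution with an ergodic family of operators\<close>

lemma AE_convergent_bmf:
  fixes F :: "nat \<Rightarrow> 'x \<Rightarrow> real"
  assumes F: "\<And>n. F n \<in> borel_measurable M" and K: "\<And>n y. \<bar>F n y\<bar> \<le> K"
    and conv: "AE y in M. convergent (\<lambda>n. F n y)"
  obtains f where "bmf M f" "\<And>y. \<bar>f y\<bar> \<le> K" "AE y in M. (\<lambda>n. F n y) \<longlonglongrightarrow> f y"
proof -
  have K0: "K \<ge> 0" using K[of 0 undefined] by simp
  \<comment> \<open>Where the sequence diverges, \<open>lim\<close> has an unspecified value.
    Clamping restores the bound at every point and changes nothing where the sequence
    converges.\<close>
  define f where "f y = max (- K) (min K (lim (\<lambda>n. F n y)))" for y
  have [measurable]: "\<And>n. F n \<in> borel_measurable M" by (rule F)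
  have m: "f \<in> borel_measurable M" unfolding f_def by measurable
  have b: "\<bar>f y\<bar> \<le> K" for y using K0 by (auto simp: f_def abs_le_iff)
  have "AE y in M. (\<lambda>n. F n y) \<longlonglongrightarrow> f y"
    using conv
  proof eventually_elim
    case (elim y)
    then have l: "(\<lambda>n. F n y) \<longlonglongrightarrow> lim (\<lambda>n. F n y)" by (simp add: convergent_LIMSEQ_iff)
    have "\<bar>lim (\<lambda>n. F n y)\<bar> \<le> K"
      by (rule LIMSEQ_le_const2[OF tendsto_rabs[OF l]]) (use K in auto)
    then have "f y = lim (\<lambda>n. F n y)" by (auto simp: f_def)
    then show ?case using l by simp
  qed
  then show ?thesis using that bmfI[OF m b] b by blast
qed

text \<open>For \<open>m > 0\<close> this is the falling factorial
  \<open>(m - 1) * (m - 2) * ... * (m - k)\<close>, asymptotic to \<open>m ^ k\<close>. It replaces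
  \<open>m ^ k\<close> because convolving with a binomial coefficient is exactly an iterated
  summation, to which \<open>cesaro_binomial\<close> applies.\<close>

definition falling_weight :: "nat \<Rightarrow> nat \<Rightarrow> real" where
  "falling_weight k m = fact k * real ((m - 1) choose k)"

lemma falling_weight_le: "\<bar>falling_weight k m\<bar> \<le> real m ^ k"
proof (cases "m = 0")
  case True
  then show ?thesis by (cases k) (auto simp: falling_weight_def)
next
  case False
  have "((m - 1) choose k) * fact k \<le> (m - 1) ^ k" by (rule binomial_fact_pow)
  also have "\<dots> \<le> m ^ k" by (intro power_mono) auto
  finally have "real (((m - 1) choose k) * fact k) \<le> real (m ^ k)" by (rule of_nat_mono)
  then show ?thesis by (simp add: falling_weight_def mult.commute)
qed

lemma falling_weight_lim: "(\<lambda>m. falling_weight k m / real m ^ k) \<longlonglongrightarrow> 1"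
proof -
  have "(\<lambda>m. 1 - (1 + real i) / real m) \<longlonglongrightarrow> 1 - 0" for i
    by (intro tendsto_diff tendsto_const tendsto_divide_0[OF tendsto_const]
        filterlim_at_top_imp_at_infinity filterlim_real_sequentially)
  then have "(\<lambda>m. \<Prod>i=0..<k. 1 - (1 + real i) / real m) \<longlonglongrightarrow> (\<Prod>i=0..<k. 1)"
    by (intro tendsto_prod) auto
  then have "(\<lambda>m. \<Prod>i=0..<k. 1 - (1 + real i) / real m) \<longlonglongrightarrow> 1" by simp
  then show ?thesis
  proof (rule Lim_transform_eventually, use eventually_gt_at_top[of 0] in eventually_elim)
    case (elim m)
    have "falling_weight k m = (\<Prod>i=0..<k. real (m - 1) - real i)"
      unfolding falling_weight_def binomial_gbinomial gbinomial_prod_rev by simp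
    also have "\<dots> / real m ^ k = (\<Prod>i=0..<k. (real (m - 1) - real i) / real m)"
      by (simp add: prod_dividef)
    also have "\<dots> = (\<Prod>i=0..<k. 1 - (1 + real i) / real m)"
      using elim by (intro prod.cong refl) (auto simp: field_simps of_nat_diff)
    finally show ?case by simp
  qed
qed

text \<open>The operator version of \<open>conv_summable_lim\<close>. Countably many null sets, one
  for each \<open>Q j\<close>, are discarded; at the remaining points the normalised terms converge
  for every \<open>j\<close> and are dominated by \<open>K * \<beta> j\<close>.\<close>

lemma conv_tannery_AE:
  fixes F :: "nat \<Rightarrow> 'x \<Rightarrow> real"
  assumes M: "finite_measure M" and Q: "\<And>j. pos_op M (\<beta> j) (Q j)" and \<beta>: "summable \<beta>"
    and F: "\<And>m. F m \<in> borel_measurable M" and K: "\<And>m y. \<bar>F m y\<bar> \<le> K * real m ^ k"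
    and conv: "AE y in M. convergent (\<lambda>m. F m y / real m ^ k)"
  shows "AE y in M. convergent (\<lambda>N. (\<Sum>j<N. Q j (F (N - j)) y) / real N ^ k)"
proof -
  define G where "G m y = (1 / real m ^ k) * F m y" for m y
  have \<beta>0: "\<beta> j \<ge> 0" for j by (rule pos_op_factor_nonneg[OF Q])
  have K0: "K \<ge> 0" using K[of 1 undefined] by simp
  have GK: "\<bar>G m y\<bar> \<le> K" for m y
  proof (cases "real m ^ k = 0")
    case True show ?thesis unfolding G_def True using K0 by simp
  next
    case False
    then have "real m ^ k > 0" using zero_le_power[of "real m" k] by linarith
    then show ?thesis using K[of m y] by (simp add: G_def abs_mult field_simps)
  qed
  have Gm: "G m \<in> borel_measurable M" for m unfolding G_def using F by measurable
  have "AE y in M. convergent (\<lambda>m. G m y)" using conv by (simp add: G_def)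
  from AE_convergent_bmf[OF Gm GK this]
  obtain f where f: "bmf M f" "\<And>y. \<bar>f y\<bar> \<le> K" "AE y in M. (\<lambda>m. G m y) \<longlonglongrightarrow> f y" by blast
  have "AE y in M. \<forall>j. (\<lambda>m. Q j (G m) y) \<longlonglongrightarrow> Q j f y"
    unfolding AE_all_countable using pos_op_AE_lim[OF Q M bmfI[OF Gm GK] f(1,3)] by blast
  then show ?thesis
  proof eventually_elim
    case (elim y)
    have QG: "Q j (G m) y = Q j (F m) y / real m ^ k" for j m
      unfolding G_def pos_op_cmult[OF Q] by simp
    have lim: "(\<lambda>N. if j < N then Q j (F (N - j)) y / real N ^ k else 0) \<longlonglongrightarrow> Q j f y" for j
    proof -
      have "(\<lambda>N. Q j (F (N - j)) y / real N ^ k) \<longlonglongrightarrow> Q j f y"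
        using shift_ratio_lim[of "\<lambda>m. Q j (F m) y" k] elim by (auto simp: QG)
      then show ?thesis
        by (rule Lim_transform_eventually, intro eventually_mono[OF eventually_gt_at_top[of j]]) auto
    qed
    have bound: "\<forall>\<^sub>F (j, N) in sequentially \<times>\<^sub>F sequentially.
        norm (if j < N then Q j (F (N - j)) y / real N ^ k else 0) \<le> K * \<beta> j"
    proof (rule always_eventually, clarify)
      fix j N
      show "norm (if j < N then Q j (F (N - j)) y / real N ^ k else 0) \<le> K * \<beta> j"
      proof (cases "j < N")
        case True
        have "\<bar>F (N - j) z\<bar> \<le> K * real N ^ k" for z
          by (rule order_trans[OF K]) (intro mult_left_mono power_mono K0, auto)
        then have "\<bar>Q j (F (N - j)) y\<bar> \<le> \<beta> j * (K * real N ^ k)" by (rule pos_op_abs_le[OF Q])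
        then show ?thesis using True by (simp add: field_simps)
      qed (use K0 \<beta>0 in simp)
    qed
    have "(\<lambda>N. \<Sum>j. if j < N then Q j (F (N - j)) y / real N ^ k else 0) \<longlonglongrightarrow> (\<Sum>j. Q j f y)"
      using tannerys_theorem[OF lim bound] summable_mult[OF \<beta>] by auto
    moreover have "(\<Sum>j. if j < N then Q j (F (N - j)) y / real N ^ k else 0) = (\<Sum>j<N. Q j (F (N - j)) y) / real N ^ k" for N
    proof -
      have "(\<Sum>j. if j < N then Q j (F (N - j)) y / real N ^ k else 0) = (\<Sum>j<N. if j < N then Q j (F (N - j)) y / real N ^ k else 0)"
        by (rule suminf_finite) auto
      then show ?thesis by (simp add: sum_divide_distrib)
    qed
    ultimately show ?case by (auto simp: convergent_def)
  qed
qed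

text \<open>Write \<open>F m = falling_weight k m * f + m\<^sup>k * e m\<close> with \<open>e m \<rightarrow> 0\<close>. The first part is an iterated Cesaro sum. The second
  is dominated by the ergodic averages of \<open>\<eta> i = (SUP m \<ge> i. \<bar>e m\<bar>)\<close>, whose limits have integrals tending to \<open>0\<close>.\<close>

lemma conv_ergodic_AE:
  fixes F :: "nat \<Rightarrow> 'x \<Rightarrow> real"
  assumes M: "prob_space M" and Q: "\<And>j. pos_op M (\<beta> j) (Q j)" and \<beta>: "\<beta> \<longlonglongrightarrow> L"
    and erg: "\<And>f. bmf M f \<Longrightarrow> AE y in M. convergent (\<lambda>N. (\<Sum>j<N. Q j f y) / real N)"
    and F: "\<And>m. F m \<in> borel_measurable M" and K: "\<And>m y. \<bar>F m y\<bar> \<le> K * real m ^ k"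
    and conv: "AE y in M. convergent (\<lambda>m. F m y / real m ^ k)"
  shows "AE y in M. convergent (\<lambda>N. (\<Sum>j<N. Q j (F (N - j)) y) / real N ^ Suc k)"
proof -
  interpret prob_space M by fact
  have fm: "finite_measure M" by unfold_locales
  define G where "G m y = (1 / real m ^ k) * F m y" for m y
  have \<beta>0: "\<beta> j \<ge> 0" for j by (rule pos_op_factor_nonneg[OF Q])
  have "Bseq \<beta>" using \<beta> convergentI convergent_imp_Bseq by blast
  then obtain b where b: "b > 0" "\<And>j. \<bar>\<beta> j\<bar> \<le> b" by (auto simp: Bseq_def)
  then have \<beta>b: "\<beta> j \<le> b" for j using abs_le_D1 by blast
  have K0: "K \<ge> 0" using K[of 1 undefined] by simp
  have GK: "\<bar>G m y\<bar> \<le> K" for m y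
  proof (cases "real m ^ k = 0")
    case True show ?thesis unfolding G_def True using K0 by simp
  next
    case False
    then have "real m ^ k > 0" using zero_le_power[of "real m" k] by linarith
    then show ?thesis using K[of m y] by (simp add: G_def abs_mult field_simps)
  qed
  have Gm: "G m \<in> borel_measurable M" for m unfolding G_def using F by measurable
  have "AE y in M. convergent (\<lambda>m. G m y)" using conv by (simp add: G_def)
  from AE_convergent_bmf[OF Gm GK this]
  obtain f where f: "bmf M f" "\<And>y. \<bar>f y\<bar> \<le> K" "AE y in M. (\<lambda>m. G m y) \<longlonglongrightarrow> f y" by blast
  define e where "e m y = G m y - falling_weight k m / real m ^ k * f y" for m y
  have e_bound: "\<bar>e m y\<bar> \<le> 2 * K" for m y
  proof -
    have "\<bar>falling_weight k m / real m ^ k\<bar> \<le> 1"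
      using falling_weight_le[of k m] by (cases "real m ^ k = 0") (auto simp: abs_divide divide_le_eq_1)
    then have "\<bar>falling_weight k m / real m ^ k * f y\<bar> \<le> 1 * K"
      unfolding abs_mult using f(2)[of y] by (intro mult_mono) auto
    then show ?thesis unfolding e_def using GK[of m y] by linarith
  qed
  have em[measurable]: "e m \<in> borel_measurable M" for m unfolding e_def using Gm f(1)[THEN bmf_measurable] by measurable
  have e_lim: "AE y in M. (\<lambda>m. e m y) \<longlonglongrightarrow> 0"
    using f(3)
  proof eventually_elim
    case (elim y)
    have "(\<lambda>m. e m y) \<longlonglongrightarrow> f y - 1 * f y"
      unfolding e_def by (intro tendsto_diff elim tendsto_mult falling_weight_lim tendsto_const)
    then show ?case by simp
  qed
  \<comment> \<open>In \<open>Q j (e (N - j))\<close> the function moves with \<open>j\<close>, so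
    the ergodic hypothesis \<open>erg\<close> does not apply to it. The majorant
    \<open>\<eta> i\<close> is fixed and dominates \<open>e (N - j)\<close> whenever
    \<open>N - j \<ge> i\<close>.\<close>
  define \<eta> where "\<eta> i y = (SUP m\<in>{i..}. \<bar>e m y\<bar>)" for i y
  have bdd: "bdd_above ((\<lambda>m. \<bar>e m y\<bar>) ` S)" for S y using e_bound by (intro bdd_aboveI2)
  have e_le: "\<bar>e m y\<bar> \<le> \<eta> i y" if "m \<ge> i" for m i y
    unfolding \<eta>_def using that by (intro cSUP_upper bdd) auto
  have \<eta>0: "0 \<le> \<eta> i y" for i y using e_le[of i i y] by simp
  have \<eta>K: "\<bar>\<eta> i y\<bar> \<le> 2 * K" for i y
    using \<eta>0[of i y] e_bound unfolding \<eta>_def by (auto intro!: cSUP_least)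
  have \<eta>m[measurable]: "\<eta> i \<in> borel_measurable M" for i
    unfolding \<eta>_def by (rule borel_measurable_cSUP) (auto intro: bdd)
  have \<eta>b: "bmf M (\<eta> i)" for i by (rule bmfI[OF \<eta>m \<eta>K])
  have \<eta>_dec: "\<eta> (Suc i) y \<le> \<eta> i y" for i y
    unfolding \<eta>_def by (intro cSUP_subset_mono bdd) auto
  have \<eta>_lim: "AE y in M. (\<lambda>i. \<eta> i y) \<longlonglongrightarrow> 0"
    using e_lim
  proof eventually_elim
    case (elim y)
    show ?case
    proof (rule LIMSEQ_I)
      fix r :: real assume r: "r > 0"
      then obtain n where n: "\<And>m. m \<ge> n \<Longrightarrow> \<bar>e m y\<bar> < r / 2" using LIMSEQ_D[OF elim, of "r/2"] by auto
      have "\<eta> i y \<le> r / 2" if "i \<ge> n" for i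
        unfolding \<eta>_def using n that by (intro cSUP_least) (auto intro: less_imp_le)
      then show "\<exists>no. \<forall>i\<ge>no. norm (\<eta> i y - 0) < r" using \<eta>0 r by (intro exI[of _ n]) force
    qed
  qed
  have \<eta>_int: "(\<lambda>i. \<integral>y. \<eta> i y \<partial>M) \<longlonglongrightarrow> (\<integral>y. 0 \<partial>M)"
    by (rule integral_dominated_convergence[where w="\<lambda>_. 2 * K"]) (use \<eta>_lim \<eta>K in auto)
  define A where "A i N y = (\<Sum>j<N. Q j (\<eta> i) y) / real N" for i N y
  have Am[measurable]: "A i N \<in> borel_measurable M" for i N
    unfolding A_def using pos_op_measurable[OF Q \<eta>m] by measurable
  have AK: "\<bar>A i N y\<bar> \<le> b * (2 * K)" for i N y
  proof (cases "N = 0")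
    case False
    have "\<bar>\<Sum>j<N. Q j (\<eta> i) y\<bar> \<le> (\<Sum>j<N. b * (2 * K))"
    proof (rule order_trans[OF sum_abs sum_mono])
      fix j
      have "\<bar>Q j (\<eta> i) y\<bar> \<le> \<beta> j * (2 * K)" by (rule pos_op_abs_le[OF Q \<eta>K])
      also have "\<dots> \<le> b * (2 * K)" using \<beta>b K0 by (intro mult_right_mono) auto
      finally show "\<bar>Q j (\<eta> i) y\<bar> \<le> b * (2 * K)" .
    qed
    then show ?thesis using False by (simp add: A_def field_simps)
  qed (use b K0 in \<open>simp add: A_def\<close>)
  have "\<forall>i. \<exists>E. bmf M E \<and> (\<forall>y. \<bar>E y\<bar> \<le> b * (2 * K)) \<and> (AE y in M. (\<lambda>N. A i N y) \<longlonglongrightarrow> E y)"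
  proof
    fix i
    have "AE y in M. convergent (\<lambda>N. A i N y)" unfolding A_def by (rule erg[OF \<eta>b])
    from AE_convergent_bmf[OF Am AK this]
    show "\<exists>E. bmf M E \<and> (\<forall>y. \<bar>E y\<bar> \<le> b * (2 * K)) \<and> (AE y in M. (\<lambda>N. A i N y) \<longlonglongrightarrow> E y)" by metis
  qed
  then obtain E where E: "\<And>i. bmf M (E i)" "\<And>i y. \<bar>E i y\<bar> \<le> b * (2 * K)"
    and A_E: "\<And>i. AE y in M. (\<lambda>N. A i N y) \<longlonglongrightarrow> E i y" by metis
  have [measurable]: "E i \<in> borel_measurable M" for i using E(1) by (rule bmf_measurable)
  have E_int: "(\<integral>y. E i y \<partial>M) = L * (\<integral>y. \<eta> i y \<partial>M)" for i
  proof (rule LIMSEQ_unique)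
    show "(\<lambda>N. \<integral>y. A i N y \<partial>M) \<longlonglongrightarrow> (\<integral>y. E i y \<partial>M)"
      by (rule integral_dominated_convergence[where w="\<lambda>_. b * (2 * K)"]) (use A_E AK in auto)
    have "(\<integral>y. A i N y \<partial>M) = (\<Sum>j<N. \<beta> j) / real N * (\<integral>y. \<eta> i y \<partial>M)" for N
      unfolding A_def
      by (simp add: Bochner_Integration.integral_sum bmf_integrable[OF fm pos_op_bmf[OF Q \<eta>b]] pos_op_integral[OF Q \<eta>b] sum_distrib_right)
    then show "(\<lambda>N. \<integral>y. A i N y \<partial>M) \<longlonglongrightarrow> L * (\<integral>y. \<eta> i y \<partial>M)"
      by (simp only:) (intro tendsto_mult tendsto_const cesaro_mean \<beta>)
  qed
  have AA: "AE y in M. \<forall>i. (\<lambda>N. A i N y) \<longlonglongrightarrow> E i y" unfolding AE_all_countable using A_E by blast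
  have A_mono: "A (Suc i) N y \<le> A i N y" for i N y
    unfolding A_def by (intro divide_right_mono sum_mono pos_op_mono[OF Q] \<eta>_dec) auto
  have A0: "0 \<le> A i N y" for i N y
    unfolding A_def by (intro divide_nonneg_nonneg sum_nonneg pos_op_nonneg[OF Q] \<eta>0) auto
  \<comment> \<open>Integrals tending to 0 alone would give convergence to 0 only in the mean. Since
    \<open>E i\<close> decreases in \<open>i\<close>, it has a limit almost everywhere, and the
    vanishing integral identifies this limit as 0.\<close>
  have E_conv: "AE y in M. convergent (\<lambda>i. E i y) \<and> (\<forall>i. 0 \<le> E i y)"
    using AA
  proof eventually_elim
    case (elim y)
    have nn: "0 \<le> E i y" for i by (rule LIMSEQ_le_const[of "\<lambda>N. A i N y"]) (use elim A0 in auto)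
    have "E (Suc i) y \<le> E i y" for i by (rule LIMSEQ_le[of "\<lambda>N. A (Suc i) N y" _ "\<lambda>N. A i N y"]) (use elim A_mono in auto)
    then have "decseq (\<lambda>i. E i y)" by (rule decseq_SucI)
    then obtain s where "(\<lambda>i. E i y) \<longlonglongrightarrow> s" using decseq_convergent[of "\<lambda>i. E i y" 0] nn by metis
    then show ?case using nn convergentI by blast
  qed
  then have "AE y in M. convergent (\<lambda>i. E i y)" by eventually_elim simp
  then obtain E' where E': "bmf M E'" "AE y in M. (\<lambda>i. E i y) \<longlonglongrightarrow> E' y"
    using AE_convergent_bmf[of E M "b * (2 * K)"] E by (metis bmf_measurable)
  have E'0: "AE y in M. 0 \<le> E' y"
    using E_conv E'(2)
  proof eventually_elim
    case (elim y) show ?case by (rule LIMSEQ_le_const[of "\<lambda>i. E i y"]) (use elim in auto)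
  qed
  have "(\<integral>y. E' y \<partial>M) = 0"
  proof (rule LIMSEQ_unique)
    show "(\<lambda>i. \<integral>y. E i y \<partial>M) \<longlonglongrightarrow> (\<integral>y. E' y \<partial>M)"
      by (rule integral_dominated_convergence[where w="\<lambda>_. b * (2 * K)"]) (use E' E bmf_measurable in auto)
    show "(\<lambda>i. \<integral>y. E i y \<partial>M) \<longlonglongrightarrow> 0"
      unfolding E_int using tendsto_mult[OF tendsto_const[of L] \<eta>_int] by simp
  qed
  then have "AE y in M. E' y = 0"
    using integral_nonneg_eq_0_iff_AE[OF bmf_integrable[OF fm E'(1)] E'0] by simp
  then have E_lim: "AE y in M. (\<lambda>i. E i y) \<longlonglongrightarrow> 0" using E'(2) by eventually_elim simp
  have split: "(\<Sum>j<N. Q j (F (N - j)) y) = fact k * (\<Sum>j<N. real ((N - 1 - j) choose k) * Q j f y)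
      + (\<Sum>j<N. real (N - j) ^ k * Q j (e (N - j)) y)" for N y
    unfolding sum_distrib_left sum.distrib[symmetric]
  proof (intro sum.cong refl)
    fix j assume j: "j \<in> {..<N}"
    have F_eq: "F (N - j) = (\<lambda>z. falling_weight k (N - j) * f z + real (N - j) ^ k * e (N - j) z)"
    proof
      fix z show "F (N - j) z = falling_weight k (N - j) * f z + real (N - j) ^ k * e (N - j) z"
        using j by (simp add: e_def G_def right_diff_distrib)
    qed
    show "Q j (F (N - j)) y = fact k * (real ((N - 1 - j) choose k) * Q j f y) + real (N - j) ^ k * Q j (e (N - j)) y"
      unfolding F_eq pos_op_add[OF Q] pos_op_cmult[OF Q] by (simp add: falling_weight_def diff_commute)
  qed
  show ?thesis
    using AA E_lim erg[OF f(1)]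
  proof eventually_elim
    case (elim y)
    have "(\<lambda>N. (\<Sum>j<N. real (N - j) ^ k * Q j (e (N - j)) y) / real N ^ Suc k) \<longlonglongrightarrow> 0"
    proof (rule LIMSEQ_I)
      fix r :: real assume r: "r > 0"
      obtain i where i: "\<bar>E i y\<bar> < r / 3" using LIMSEQ_D[OF elim(2), of "r/3"] r by auto
      have "(\<lambda>N. A i N y) \<longlonglongrightarrow> E i y" using elim(1) by blast
      then have "\<forall>\<^sub>F N in sequentially. A i N y < r / 3" by (rule order_tendstoD) (use i in auto)
      moreover have "(\<lambda>N. (2 * K * b * real i) / real N) \<longlonglongrightarrow> 0"
        by (intro tendsto_divide_0[OF tendsto_const] filterlim_at_top_imp_at_infinity filterlim_real_sequentially)
      then have "\<forall>\<^sub>F N in sequentially. (2 * K * b * real i) / real N < r / 3"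
        by (rule order_tendstoD) (use r in auto)
      ultimately have "\<forall>\<^sub>F N in sequentially. norm ((\<Sum>j<N. real (N - j) ^ k * Q j (e (N - j)) y) / real N ^ Suc k - 0) < r"
        using eventually_gt_at_top[of 0]
      proof eventually_elim
        case (elim N)
        \<comment> \<open>At most \<open>i\<close> indices satisfy \<open>N - j < i\<close>. For
          these the crude bound \<open>2 * K * b\<close> is enough, as their total share of the
          average is at most \<open>2 * K * b * i / N\<close>.\<close>
        have term_bound: "\<bar>real (N - j) ^ k * Q j (e (N - j)) y\<bar> \<le> real N ^ k * (Q j (\<eta> i) y + (if N < j + i then 2 * K * b else 0))"
          if j: "j < N" for j
        proof -
          have "\<bar>Q j (e (N - j)) y\<bar> \<le> Q j (\<eta> i) y + (if N < j + i then 2 * K * b else 0)"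
          proof (cases "N < j + i")
            case True
            have "\<bar>Q j (e (N - j)) y\<bar> \<le> \<beta> j * (2 * K)" by (rule pos_op_abs_le[OF Q e_bound])
            also have "\<dots> \<le> b * (2 * K)" using \<beta>b K0 by (intro mult_right_mono) auto
            finally show ?thesis using True pos_op_nonneg[OF Q, of "\<eta> i" j y] \<eta>0 by (simp add: mult.commute)
          next
            case False
            then have "N - j \<ge> i" using j by simp
            then show ?thesis using False pos_op_abs_le_op[OF Q e_le] by simp
          qed
          then show ?thesis unfolding abs_mult by (intro mult_mono) (auto intro: power_mono)
        qed
        have "\<bar>\<Sum>j<N. real (N - j) ^ k * Q j (e (N - j)) y\<bar>
           \<le> (\<Sum>j<N. real N ^ k * (Q j (\<eta> i) y + (if N < j + i then 2 * K * b else 0)))"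
          by (rule order_trans[OF sum_abs sum_mono]) (use term_bound in auto)
        also have "\<dots> = real N ^ k * ((\<Sum>j<N. Q j (\<eta> i) y) + (\<Sum>j<N. if N < j + i then 2 * K * b else 0))"
          by (simp only: sum_distrib_left[symmetric] sum.distrib)
        also have "(\<Sum>j<N. if N < j + i then 2 * K * b else 0) = real (card {j. j < N \<and> N < j + i}) * (2 * K * b)"
          by (simp add: sum.If_cases Int_def)
        also have "card {j. j < N \<and> N < j + i} \<le> i"
        proof -
          have "card {j. j < N \<and> N < j + i} \<le> card {N - i..<N}" by (intro card_mono) auto
          then show ?thesis by simp
        qed
        finally have "\<bar>\<Sum>j<N. real (N - j) ^ k * Q j (e (N - j)) y\<bar> \<le> real N ^ k * ((\<Sum>j<N. Q j (\<eta> i) y) + real i * (2 * K * b))"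
          using K0 b by (simp add: mult_left_mono mult_right_mono)
        then have "\<bar>\<Sum>j<N. real (N - j) ^ k * Q j (e (N - j)) y\<bar> / real N ^ Suc k
            \<le> real N ^ k * ((\<Sum>j<N. Q j (\<eta> i) y) + real i * (2 * K * b)) / real N ^ Suc k"
          by (intro divide_right_mono) auto
        also have "\<dots> = A i N y + (2 * K * b * real i) / real N"
          using elim by (simp add: A_def add_divide_distrib[symmetric] mult_ac)
        finally show ?case using elim r by (simp add: abs_divide)
      qed
      then show "\<exists>no. \<forall>N\<ge>no. norm ((\<Sum>j<N. real (N - j) ^ k * Q j (e (N - j)) y) / real N ^ Suc k - 0) < r"
        by (simp add: eventually_sequentially)
    qed
    then have 1: "convergent (\<lambda>N. (\<Sum>j<N. real (N - j) ^ k * Q j (e (N - j)) y) / real N ^ Suc k)"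
      by (rule convergentI)
    have 2: "convergent (\<lambda>N. fact k * ((\<Sum>j<N. real ((N - 1 - j) choose k) * Q j f y) / real N ^ Suc k))"
      by (intro convergent_mult convergent_const cesaro_binomial elim)
    show ?case unfolding split using convergent_add[OF 2 1] by (simp add: add_divide_distrib)
  qed
qed

section \<open>Sequences of functions with convergent weighted averages\<close>

text \<open>The condition includes pairs \<open>(k, l)\<close> exceeding the true growth of \<open>a\<close> (those with \<open>c = 0\<close>), for which it
  is automatic; this makes the notion stable under sums of sequences of different growth.\<close>

definition cesaro_regular :: "'x measure \<Rightarrow> (nat \<Rightarrow> 'x \<Rightarrow> real) \<Rightarrow> (nat \<Rightarrow> real) \<Rightarrow> bool" where
  "cesaro_regular M x a \<longleftrightarrow> regular_growth a \<and> (\<forall>n. x n \<in> borel_measurable M) \<and> (\<exists>K\<ge>0. \<forall>n y. \<bar>x n y\<bar> \<le> K * a n) \<and>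
     (\<forall>k l c. l > 0 \<longrightarrow> (\<lambda>n. a n / growth k l n) \<longlonglongrightarrow> c \<longrightarrow>
        (AE y in M. convergent (\<lambda>N. (\<Sum>n<N. x n y / l ^ n) / real N ^ Suc k)))"

lemma
  assumes "cesaro_regular M x a"
  shows cesaro_regular_reg: "regular_growth a" and cesaro_regular_measurable: "x n \<in> borel_measurable M"
    and cesaro_regular_bounded: "\<exists>K\<ge>0. \<forall>n y. \<bar>x n y\<bar> \<le> K * a n"
    and cesaro_regular_AE: "l > 0 \<Longrightarrow> (\<lambda>n. a n / growth k l n) \<longlonglongrightarrow> c \<Longrightarrow>
        AE y in M. convergent (\<lambda>N. (\<Sum>n<N. x n y / l ^ n) / real N ^ Suc k)"
  using assms unfolding cesaro_regular_def by blast+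

lemma cesaro_regularI:
  fixes x :: "nat \<Rightarrow> 'x \<Rightarrow> real"
  assumes regular_growth: "regular_growth a" and m: "\<And>n. x n \<in> borel_measurable M" and K: "\<And>n y. \<bar>x n y\<bar> \<le> K * a n"
    and pos: "\<And>k l c. l > 0 \<Longrightarrow> c > 0 \<Longrightarrow> (\<lambda>n. a n / growth k l n) \<longlonglongrightarrow> c \<Longrightarrow>
        AE y in M. convergent (\<lambda>N. (\<Sum>n<N. x n y / l ^ n) / real N ^ Suc k)"
  shows "cesaro_regular M x a"
proof -
  have K': "\<bar>x n y\<bar> \<le> \<bar>K\<bar> * a n" for n y
    using K[of n y] regular_growth_nonneg[OF regular_growth, of n] by (meson abs_ge_self mult_right_mono order_trans)
  have "AE y in M. convergent (\<lambda>N. (\<Sum>n<N. x n y / l ^ n) / real N ^ Suc k)"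
    if l: "l > 0" and lim: "(\<lambda>n. a n / growth k l n) \<longlonglongrightarrow> c" for k l c
  proof (cases "c > 0")
    case True
    then show ?thesis using pos l lim by blast
  next
    case False
    moreover have "c \<ge> 0"
      by (rule LIMSEQ_le_const[OF lim]) (use l regular_growth_nonneg[OF regular_growth] in \<open>auto simp: growth_def\<close>)
    ultimately have c: "c = 0" by simp
    have "convergent (\<lambda>N. (\<Sum>n<N. x n y / l ^ n) / real N ^ Suc k)" for y
    proof -
      have "(\<lambda>n. \<bar>K\<bar> * (a n / growth k l n)) \<longlonglongrightarrow> \<bar>K\<bar> * 0" using lim c by (intro tendsto_mult tendsto_const) auto
      then have "(\<lambda>n. \<bar>K\<bar> * (a n / growth k l n)) \<longlonglongrightarrow> 0" by simp
      then have "(\<lambda>n. x n y / l ^ n / real n ^ k) \<longlonglongrightarrow> 0"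
      proof (rule Lim_null_comparison[rotated], intro always_eventually allI)
        fix n
        have "norm (x n y / l ^ n / real n ^ k) = \<bar>x n y\<bar> / growth k l n"
          using l by (simp add: growth_def abs_divide mult.commute)
        also have "\<dots> \<le> \<bar>K\<bar> * a n / growth k l n" using K' l by (intro divide_right_mono) (auto simp: growth_def)
        finally show "norm (x n y / l ^ n / real n ^ k) \<le> \<bar>K\<bar> * (a n / growth k l n)" by simp
      qed
      from cesaro_power[OF this] show ?thesis by (rule convergentI)
    qed
    then show ?thesis by simp
  qed
  then show ?thesis unfolding cesaro_regular_def using regular_growth m K' abs_ge_zero by blast
qed

lemma asymp_unique:
  assumes l: "l > 0" "l' > 0" and c: "c > 0" "c' > 0"
    and lim: "(\<lambda>n. a n / growth k l n) \<longlonglongrightarrow> c" "(\<lambda>n. a n / growth k' l' n) \<longlonglongrightarrow> c'"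
  shows "k = k' \<and> l = l'"
proof (rule growth_cases[OF l, of k k'])
  assume "(\<lambda>n. growth k l n / growth k' l' n) \<longlonglongrightarrow> 0"
  from growth_trans_lim[OF l(1) lim(1) this] lim(2) have "c' = c * 0" by (rule LIMSEQ_unique[rotated])
  then show ?thesis using c by simp
next
  assume "(\<lambda>n. growth k' l' n / growth k l n) \<longlonglongrightarrow> 0"
  from growth_trans_lim[OF l(2) lim(2) this] lim(1) have "c = c' * 0" by (rule LIMSEQ_unique[rotated])
  then show ?thesis using c by simp
qed simp

lemma cesaro_regular_zero: "cesaro_regular M (\<lambda>n y. 0) (\<lambda>n. 0)"
  by (rule cesaro_regularI[where K=0]) (auto intro: regular_growth_zero simp: convergent_const)

lemma cesaro_regular_add:
  assumes x: "cesaro_regular M x a" and y: "cesaro_regular M y b"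
  shows "cesaro_regular M (\<lambda>n z. x n z + y n z) (\<lambda>n. a n + b n)"
proof -
  obtain K L where K: "K \<ge> 0" "\<And>n z. \<bar>x n z\<bar> \<le> K * a n" and L: "L \<ge> 0" "\<And>n z. \<bar>y n z\<bar> \<le> L * b n"
    using cesaro_regular_bounded[OF x] cesaro_regular_bounded[OF y] by blast
  have a0: "a n \<ge> 0" and b0: "b n \<ge> 0" for n using regular_growth_nonneg cesaro_regular_reg x y by blast+
  show ?thesis
  proof (rule cesaro_regularI[where K="max K L"])
    show "regular_growth (\<lambda>n. a n + b n)" by (intro regular_growth_add cesaro_regular_reg[OF x] cesaro_regular_reg[OF y])
    show "(\<lambda>z. x n z + y n z) \<in> borel_measurable M" for n
      by (intro borel_measurable_add cesaro_regular_measurable[OF x] cesaro_regular_measurable[OF y])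
    show "\<bar>x n z + y n z\<bar> \<le> max K L * (a n + b n)" for n z
    proof -
      have "\<bar>x n z\<bar> \<le> max K L * a n" "\<bar>y n z\<bar> \<le> max K L * b n"
        using K(2)[of n z] L(2)[of n z] a0[of n] b0[of n] by (meson max.cobounded1 max.cobounded2 mult_right_mono order_trans)+
      then show ?thesis by (simp add: algebra_simps)
    qed
    fix k l c assume l: "l > 0" and lim: "(\<lambda>n. (a n + b n) / growth k l n) \<longlonglongrightarrow> c"
    obtain c1 where "(\<lambda>n. a n / growth k l n) \<longlonglongrightarrow> c1"
      using regular_growth_dom[OF cesaro_regular_reg[OF x] _ l lim] b0 by (auto simp: convergent_def)
    from cesaro_regular_AE[OF x l this]
    have 1: "AE z in M. convergent (\<lambda>N. (\<Sum>n<N. x n z / l ^ n) / real N ^ Suc k)" .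
    obtain c2 where "(\<lambda>n. b n / growth k l n) \<longlonglongrightarrow> c2"
      using regular_growth_dom[OF cesaro_regular_reg[OF y] _ l lim] a0 by (auto simp: convergent_def)
    from cesaro_regular_AE[OF y l this]
    have 2: "AE z in M. convergent (\<lambda>N. (\<Sum>n<N. y n z / l ^ n) / real N ^ Suc k)" .
    show "AE z in M. convergent (\<lambda>N. (\<Sum>n<N. (x n z + y n z) / l ^ n) / real N ^ Suc k)"
      using 1 2
    proof eventually_elim
      case (elim z)
      from convergent_add[OF elim] show ?case by (simp add: add_divide_distrib sum.distrib)
    qed
  qed
qed

lemma cesaro_regular_sum:
  "(\<And>i. i \<in> I \<Longrightarrow> cesaro_regular M (x i) (a i)) \<Longrightarrow> cesaro_regular M (\<lambda>n y. \<Sum>i\<in>I. x i n y) (\<lambda>n. \<Sum>i\<in>I. a i n)"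
  by (induction I rule: infinite_finite_induct) (auto intro: cesaro_regular_zero cesaro_regular_add)

lemma cesaro_regular_partial_sums_bounded:
  fixes x :: "nat \<Rightarrow> 'x \<Rightarrow> real"
  assumes x: "cesaro_regular M x a" and l: "l > 0" and lim: "(\<lambda>n. a n / growth k l n) \<longlonglongrightarrow> c"
  obtains K where "\<And>N y. \<bar>\<Sum>n<N. x n y / l ^ n\<bar> \<le> K * real N ^ Suc k"
proof -
  obtain K where K: "K \<ge> 0" "\<And>n z. \<bar>x n z\<bar> \<le> K * a n" using cesaro_regular_bounded[OF x] by blast
  obtain K2 where K2: "K2 \<ge> 0" "\<And>n m. n \<ge> 1 \<Longrightarrow> m \<le> n \<Longrightarrow> \<bar>a m / l ^ m\<bar> \<le> K2 * real n ^ k"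
    using power_bound[OF lim[unfolded asymp_divide_base]] by blast
  have "\<bar>\<Sum>n<N. x n y / l ^ n\<bar> \<le> (K * K2) * real N ^ Suc k" for N y
  proof -
    have "\<bar>\<Sum>n<N. x n y / l ^ n\<bar> \<le> (\<Sum>n<N. K * (K2 * real N ^ k))"
    proof (rule order_trans[OF sum_abs sum_mono])
      fix n assume n: "n \<in> {..<N}"
      have "\<bar>x n y / l ^ n\<bar> \<le> K * (a n / l ^ n)" using K(2)[of n y] l by (simp add: abs_divide divide_right_mono)
      also have "\<dots> \<le> K * (K2 * real N ^ k)" using order_trans[OF abs_ge_self K2(2)[of N n]] n K(1) by (intro mult_left_mono) auto
      finally show "\<bar>x n y / l ^ n\<bar> \<le> K * (K2 * real N ^ k)" .
    qed
    then show ?thesis by (simp add: algebra_simps)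
  qed
  then show ?thesis by (rule that)
qed

text \<open>\<open>A\<close> commutes with the weighted partial sums. After normalisation these are
  uniformly bounded and converge almost everywhere, so \<open>pos_op_AE_lim\<close> carries their
  limit through \<open>A\<close>.\<close>

lemma cesaro_regular_op:
  fixes x :: "nat \<Rightarrow> 'x \<Rightarrow> real"
  assumes M: "finite_measure M" and A: "pos_op M b A" and b: "b > 0" and x: "cesaro_regular M x a"
  shows "cesaro_regular M (\<lambda>n. A (x n)) (\<lambda>n. b * a n)"
proof -
  obtain K where K: "K \<ge> 0" "\<And>n z. \<bar>x n z\<bar> \<le> K * a n" using cesaro_regular_bounded[OF x] by blast
  show ?thesis
  proof (rule cesaro_regularI[where K=K])
    show "regular_growth (\<lambda>n. b * a n)" by (rule regular_growth_cmult[OF cesaro_regular_reg[OF x] b])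
    show "A (x n) \<in> borel_measurable M" for n by (intro pos_op_measurable[OF A] cesaro_regular_measurable[OF x])
    show "\<bar>A (x n) y\<bar> \<le> K * (b * a n)" for n y
      using pos_op_abs_le[OF A, of "x n" "K * a n" y] K(2) by (simp add: mult_ac)
    fix k l c assume l: "l > 0" and "(\<lambda>n. b * a n / growth k l n) \<longlonglongrightarrow> c"
    from tendsto_mult[OF tendsto_const[of "1/b"] this(2)] have lim: "(\<lambda>n. a n / growth k l n) \<longlonglongrightarrow> c / b"
      using b by (simp add: mult.commute)
    define F where "F N y = (\<Sum>n<N. x n y / l ^ n) / real N ^ Suc k" for N y
    obtain K' where K': "\<And>N y. \<bar>\<Sum>n<N. x n y / l ^ n\<bar> \<le> K' * real N ^ Suc k"
      using cesaro_regular_partial_sums_bounded[OF x l lim] by blast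
    have K'0: "K' \<ge> 0" using K'[where N=1 and y=undefined] by simp
    have FK: "\<bar>F N y\<bar> \<le> K'" for N y using K'[where N=N and y=y] K'0 by (cases "N = 0") (auto simp: F_def field_simps)
    have [measurable]: "x n \<in> borel_measurable M" for n by (rule cesaro_regular_measurable[OF x])
    have Fm: "F N \<in> borel_measurable M" for N unfolding F_def by measurable
    have "AE y in M. convergent (\<lambda>N. F N y)" unfolding F_def by (rule cesaro_regular_AE[OF x l lim])
    from AE_convergent_bmf[OF Fm FK this] obtain f where f: "bmf M f" "AE y in M. (\<lambda>N. F N y) \<longlonglongrightarrow> f y" by metis
    have AF: "A (F N) y = (\<Sum>n<N. A (x n) y / l ^ n) / real N ^ Suc k" for N y
      unfolding F_def divide_inverse mult.commute[of _ "inverse _"] pos_op_cmult[OF A] pos_op_sum[OF A] by simp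
    from pos_op_AE_lim[OF A M bmfI[OF Fm FK] f]
    show "AE y in M. convergent (\<lambda>N. (\<Sum>n<N. A (x n) y / l ^ n) / real N ^ Suc k)"
      by eventually_elim (auto simp: AF convergent_def)
  qed
qed

text \<open>A recursion expresses \<open>x (n + 1)\<close> through earlier values, so regularity
  first appears with a shifted index. Restoring the index multiplies the sums by
  \<open>1 / l\<close> and adds the single term \<open>x 0\<close>, which is negligible against
  \<open>N ^ (k + 1)\<close>.\<close>

lemma cesaro_regular_unshift:
  fixes x :: "nat \<Rightarrow> 'x \<Rightarrow> real"
  assumes x: "cesaro_regular M (\<lambda>n. x (Suc n)) (\<lambda>n. a (Suc n))" and m: "x 0 \<in> borel_measurable M"
    and bound: "\<And>y. \<bar>x 0 y\<bar> \<le> K0 * a 0" and a0: "a 0 \<ge> 0"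
  shows "cesaro_regular M x a"
proof -
  obtain K where K: "K \<ge> 0" "\<And>n z. \<bar>x (Suc n) z\<bar> \<le> K * a (Suc n)" using cesaro_regular_bounded[OF x] by blast
  have regular_growth: "regular_growth a" by (rule regular_growth_unshift[OF cesaro_regular_reg[OF x] a0])
  show ?thesis
  proof (rule cesaro_regularI[OF regular_growth, where K="max K K0"])
    show "x n \<in> borel_measurable M" for n using m cesaro_regular_measurable[OF x] by (cases n) auto
    show "\<bar>x n y\<bar> \<le> max K K0 * a n" for n y
    proof (cases n)
      case 0
      then show ?thesis using bound[of y] a0 by (meson max.cobounded2 mult_right_mono order_trans)
    next
      case (Suc i)
      then show ?thesis using K(2)[of i y] regular_growth_nonneg[OF regular_growth, of n] by (metis max.cobounded1 mult_right_mono order_trans)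
    qed
    fix k l c assume l: "l > 0" and lim: "(\<lambda>n. a n / growth k l n) \<longlonglongrightarrow> c"
    from lim have "(\<lambda>n. a (Suc n) / growth k l n) \<longlonglongrightarrow> c * l" by (simp add: asymp_Suc_iff[OF l])
    from cesaro_regular_AE[OF x l this]
    show "AE y in M. convergent (\<lambda>N. (\<Sum>n<N. x n y / l ^ n) / real N ^ Suc k)"
    proof eventually_elim
      case (elim y)
      then obtain d where d: "(\<lambda>N. (\<Sum>n<N. x (Suc n) y / l ^ n) / real N ^ Suc k) \<longlonglongrightarrow> d"
        by (auto simp: convergent_def)
      have "filterlim (\<lambda>N. real N ^ Suc k) at_top sequentially"
        by (rule filterlim_pow_at_top) (auto intro: filterlim_real_sequentially)
      then have z: "(\<lambda>N. x 0 y / real N ^ Suc k) \<longlonglongrightarrow> 0"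
        by (intro tendsto_divide_0[OF tendsto_const] filterlim_at_top_imp_at_infinity)
      have rat: "(\<lambda>N. (real (Suc N) / real N) ^ Suc k) \<longlonglongrightarrow> 1 ^ Suc k" by (intro tendsto_power Suc_over_lim)
      have "(\<lambda>N. (1 / l) * ((\<Sum>n<N. x (Suc n) y / l ^ n) / real N ^ Suc k) / (real (Suc N) / real N) ^ Suc k
           + x 0 y / real (Suc N) ^ Suc k) \<longlonglongrightarrow> (1 / l) * d / 1 ^ Suc k + 0"
        by (rule tendsto_add[OF tendsto_divide[OF tendsto_mult[OF tendsto_const d] rat] LIMSEQ_Suc[OF z]]) simp
      then have "(\<lambda>N. (\<Sum>n<Suc N. x n y / l ^ n) / real (Suc N) ^ Suc k) \<longlonglongrightarrow> (1 / l) * d / 1 ^ Suc k + 0"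
      proof (rule Lim_transform_eventually, use eventually_gt_at_top[of 0] in eventually_elim)
        case (elim N)
        have "(\<Sum>n<Suc N. x n y / l ^ n) = x 0 y + (\<Sum>n<N. x (Suc n) y / l ^ Suc n)"
          by (simp add: sum.lessThan_Suc_shift del: sum.lessThan_Suc)
        also have "(\<Sum>n<N. x (Suc n) y / l ^ Suc n) = (1 / l) * (\<Sum>n<N. x (Suc n) y / l ^ n)"
          by (simp add: sum_distrib_left)
        finally show ?case using elim
          by (simp add: power_divide add_divide_distrib del: sum.lessThan_Suc of_nat_Suc power_Suc)
      qed
      from LIMSEQ_imp_Suc[where f="\<lambda>N. (\<Sum>n<N. x n y / l ^ n) / real N ^ Suc k", OF this]
      show ?case by (rule convergentI)
    qed
  qed
qed

text \<open>Interchanging the order of summation moves the partial sums inside the operators. This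
  matters because \<open>cesaro_regular\<close> controls normalised partial sums of \<open>x\<close>
  but says nothing about convergence of the single \<open>x n\<close>.\<close>

lemma conv_partial_sums:
  fixes x :: "nat \<Rightarrow> 'x \<Rightarrow> real"
  assumes Q: "\<And>j. pos_op M (b j) (Q j)" and l: "l > 0"
  shows "(\<Sum>n<N. (\<Sum>j\<le>n. Q j (x (n - j)) y) / l ^ n) =
    (\<Sum>j<N. (1 / l ^ j) * Q j (\<lambda>z. \<Sum>i<N - j. x i z / l ^ i) y)"
proof -
  have "(\<Sum>n<N. (\<Sum>j\<le>n. Q j (x (n - j)) y) / l ^ n) = (\<Sum>n<N. \<Sum>j\<le>n. (1 / l ^ j) * (Q j (x (n - j)) y / l ^ (n - j)))"
    unfolding sum_divide_distrib
  proof (intro sum.cong refl)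
    fix n j :: nat assume "j \<in> {..n}"
    then have "l ^ n = l ^ j * l ^ (n - j)" by (simp add: power_add[symmetric])
    then show "Q j (x (n - j)) y / l ^ n = (1 / l ^ j) * (Q j (x (n - j)) y / l ^ (n - j))" by simp
  qed
  also have "\<dots> = (\<Sum>(j, i)\<in>{(j, i). j + i < N}. (1 / l ^ j) * (Q j (x i) y / l ^ i))"
    by (rule sum.triangle_reindex[symmetric])
  also have "{(j, i). j + i < N} = (SIGMA j:{..<N}. {..<N - j})" by auto
  also have "(\<Sum>(j, i)\<in>(SIGMA j:{..<N}. {..<N - j}). (1 / l ^ j) * (Q j (x i) y / l ^ i)) =
      (\<Sum>j<N. \<Sum>i<N - j. (1 / l ^ j) * (Q j (x i) y / l ^ i))"
    by (rule sum.Sigma[symmetric]) auto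
  also have "\<dots> = (\<Sum>j<N. (1 / l ^ j) * Q j (\<lambda>z. \<Sum>i<N - j. x i z / l ^ i) y)"
    unfolding divide_inverse mult.commute[of _ "inverse _"] pos_op_sum[OF Q] pos_op_cmult[OF Q]
    by (simp add: sum_distrib_left mult_ac)
  finally show ?thesis .
qed

text \<open>The three regimes of the scalar convolution, now with operators. In the summable and in
  the resonant regime the block is not summable and \<open>conv_ergodic_AE\<close> applies, with
  partial sums of order \<open>m ^ 0\<close> and \<open>m ^ (k + 1)\<close> respectively; in the
  third regime the block is summable after scaling by \<open>l'\<close>, and
  \<open>conv_tannery_AE\<close> applies.\<close>

lemma cesaro_regular_conv:
  fixes x :: "nat \<Rightarrow> 'x \<Rightarrow> real"
  assumes M: "prob_space M" and Q: "\<And>j. pos_op M (b j) (Q j)" and l: "l > 0"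
    and b: "(\<lambda>j. b j / l ^ j) \<longlonglongrightarrow> L" "L > 0"
    and erg: "\<And>f. bmf M f \<Longrightarrow> AE y in M. convergent (\<lambda>N. (\<Sum>j<N. Q j f y / l ^ j) / real N)"
    and x: "cesaro_regular M x a"
  shows "cesaro_regular M (\<lambda>n y. \<Sum>j\<le>n. Q j (x (n - j)) y) (\<lambda>n. \<Sum>j\<le>n. b j * a (n - j))"
proof -
  interpret prob_space M by fact
  have fm: "finite_measure M" by unfold_locales
  obtain K where K: "K \<ge> 0" "\<And>n z. \<bar>x n z\<bar> \<le> K * a n" using cesaro_regular_bounded[OF x] by blast
  have xm[measurable]: "x n \<in> borel_measurable M" for n by (rule cesaro_regular_measurable[OF x])
  have a: "regular_growth a" by (rule cesaro_regular_reg[OF x])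
  have a0: "0 \<le> a n" for n by (rule regular_growth_nonneg[OF a])
  have b0: "0 \<le> b j" for j by (rule pos_op_factor_nonneg[OF Q])
  let ?z = "\<lambda>n y. \<Sum>j\<le>n. Q j (x (n - j)) y" and ?c = "\<lambda>n. \<Sum>j\<le>n. b j * a (n - j)"
  have regular_growth: "regular_growth ?c" by (rule regular_growth_conv[OF a l b b0])
  define F where "F l' m y = (\<Sum>i<m. x i y / l' ^ i)" for l' :: real and m y
  have Fm: "F l' m \<in> borel_measurable M" for l' m unfolding F_def by measurable
  have ps: "(\<Sum>n<N. ?z n y / l' ^ n) = (\<Sum>j<N. (1 / l' ^ j) * Q j (F l' (N - j)) y)" if "l' > 0" for l' N y
    using conv_partial_sums[where x=x and y=y and N=N, OF Q that] unfolding F_def[abs_def] .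
  have Ql: "pos_op M (b j / l' ^ j) (\<lambda>f y. (1 / l' ^ j) * Q j f y)" if "l' > 0" for j l'
    using pos_op_scale[OF Q, of "1 / l' ^ j" j] that by simp
  have erg': "AE y in M. convergent (\<lambda>N. (\<Sum>j<N. (1 / l ^ j) * Q j f y) / real N)" if "bmf M f" for f
    using erg[OF that] by simp
  have "\<exists>k0 l0 c0. l0 > 0 \<and> c0 \<ge> 0 \<and> (\<lambda>n. ?c n / growth k0 l0 n) \<longlonglongrightarrow> c0 \<and> (c0 = 0 \<longrightarrow> (\<forall>n. a n = 0)) \<and>
     (AE y in M. convergent (\<lambda>N. (\<Sum>n<N. ?z n y / l0 ^ n) / real N ^ Suc k0))"
  proof (rule regular_growth_trichotomy[OF a l])
    assume s: "summable (\<lambda>n. a n / l ^ n)"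
    have s': "summable (\<lambda>n. \<bar>a n / l ^ n\<bar>)" using s a0 l by simp
    have bound: "\<bar>F l m y\<bar> \<le> (K * (\<Sum>n. a n / l ^ n)) * real m ^ 0" for m y
    proof -
      have "\<bar>F l m y\<bar> \<le> (\<Sum>i<m. K * (a i / l ^ i))"
        unfolding F_def using K l by (intro order_trans[OF sum_abs sum_mono]) (simp add: abs_divide divide_right_mono)
      also have "\<dots> = K * (\<Sum>i<m. a i / l ^ i)" by (simp add: sum_distrib_left)
      also have "\<dots> \<le> K * (\<Sum>n. a n / l ^ n)" using a0 l K by (intro mult_left_mono sum_le_suminf s) auto
      finally show ?thesis by simp
    qed
    have "convergent (\<lambda>m. F l m y)" for y
    proof -
      have "summable (\<lambda>n. x n y / l ^ n)"
      proof (rule summable_comparison_test)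
        show "\<exists>N. \<forall>n\<ge>N. norm (x n y / l ^ n) \<le> K * (a n / l ^ n)"
          using K l by (auto simp: abs_divide divide_right_mono)
      qed (intro summable_mult s)
      then show ?thesis unfolding F_def using summable_iff_convergent by blast
    qed
    then have conv: "AE y in M. convergent (\<lambda>m. F l m y / real m ^ 0)" by simp
    have c: "(\<lambda>n. ?c n / growth 0 l n) \<longlonglongrightarrow> L * (\<Sum>n. a n / l ^ n)" by (rule conv_asymp_summable[OF l s' b(1)])
    have z: "a n = 0" if "(\<Sum>n. a n / l ^ n) = 0" for n
      using suminf_eq_zero_iff[OF s] a0 l that by auto
    have "0 \<le> (\<Sum>n. a n / l ^ n)" using a0 l by (intro suminf_nonneg s) auto
    then show ?thesis
      using conv_ergodic_AE[OF M Ql[OF l] b(1) erg' Fm bound conv] c z b l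
      by (intro exI[of _ 0] exI[of _ l] exI[of _ "L * (\<Sum>n. a n / l ^ n)"]) (auto simp: ps[OF l])
  next
    fix k c assume c: "c > 0" and lim: "(\<lambda>n. a n / growth k l n) \<longlonglongrightarrow> c"
    obtain K' where K': "\<And>N y. \<bar>F l N y\<bar> \<le> K' * real N ^ Suc k"
      using cesaro_regular_partial_sums_bounded[OF x l lim] unfolding F_def by blast
    have conv: "AE y in M. convergent (\<lambda>m. F l m y / real m ^ Suc k)"
      unfolding F_def by (rule cesaro_regular_AE[OF x l lim])
    show ?thesis
      using conv_ergodic_AE[OF M Ql[OF l] b(1) erg' Fm K' conv] conv_asymp_eq[OF l lim b(1)] c b l
      by (intro exI[of _ "Suc k"] exI[of _ l] exI[of _ "L * c / real (Suc k)"]) (auto simp: ps[OF l])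
  next
    fix k l' c assume l': "l' > l" and c: "c > 0" and lim: "(\<lambda>n. a n / growth k l' n) \<longlonglongrightarrow> c"
    have l'0: "l' > 0" using l l' by simp
    have sb: "summable (\<lambda>n. b n / l' ^ n)" using summable_rabs_cancel[OF summable_smaller_base[OF l l' b(1)]] .
    obtain K' where K': "\<And>N y. \<bar>F l' N y\<bar> \<le> K' * real N ^ Suc k"
      using cesaro_regular_partial_sums_bounded[OF x l'0 lim] unfolding F_def by blast
    have conv: "AE y in M. convergent (\<lambda>m. F l' m y / real m ^ Suc k)"
      unfolding F_def by (rule cesaro_regular_AE[OF x l'0 lim])
    have "\<exists>i. b i \<noteq> 0"
    proof (rule ccontr)
      assume "\<nexists>i. b i \<noteq> 0"
      then have "L = 0" using b(1) by (auto simp: LIMSEQ_const_iff)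
      then show False using b by simp
    qed
    then obtain i where "b i \<noteq> 0" by blast
    then have pos: "(\<Sum>n. b n / l' ^ n) > 0" using l'0 b0 by (intro suminf_pos_if_nonzero[OF sb, of i]) auto
    show ?thesis
      using conv_tannery_AE[OF fm Ql[OF l'0] sb Fm K' conv] conv_asymp_larger[OF l l' lim b(1)] c pos l'0
      by (intro exI[of _ k] exI[of _ l'] exI[of _ "c * (\<Sum>n. b n / l' ^ n)"]) (auto simp: ps[OF l'0])
  qed
  then obtain k0 l0 c0 where l0: "l0 > 0" and c0: "c0 \<ge> 0" and lim0: "(\<lambda>n. ?c n / growth k0 l0 n) \<longlonglongrightarrow> c0"
    and z0: "c0 = 0 \<Longrightarrow> (\<forall>n. a n = 0)"
    and AE0: "AE y in M. convergent (\<lambda>N. (\<Sum>n<N. ?z n y / l0 ^ n) / real N ^ Suc k0)" by blast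
  show ?thesis
  proof (rule cesaro_regularI[OF regular_growth, where K=K])
    show "?z n \<in> borel_measurable M" for n by (intro borel_measurable_sum pos_op_measurable[OF Q] xm)
    show "\<bar>?z n y\<bar> \<le> K * ?c n" for n y
    proof -
      have "\<bar>?z n y\<bar> \<le> (\<Sum>j\<le>n. b j * (K * a (n - j)))"
        by (rule order_trans[OF sum_abs sum_mono]) (rule pos_op_abs_le[OF Q K(2)])
      then show ?thesis by (simp add: sum_distrib_left mult_ac)
    qed
    fix k l c assume l: "l > 0" and c: "c > 0" and lim: "(\<lambda>n. ?c n / growth k l n) \<longlonglongrightarrow> c"
    have "c0 \<noteq> 0"
    proof
      assume "c0 = 0"
      with z0 lim have "(\<lambda>n. 0 :: real) \<longlonglongrightarrow> c" by simp
      then show False using c by (auto simp: LIMSEQ_const_iff)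
    qed
    with c0 have "c0 > 0" by simp
    from asymp_unique[OF l l0 c this lim lim0] AE0
    show "AE y in M. convergent (\<lambda>N. (\<Sum>n<N. ?z n y / l ^ n) / real N ^ Suc k)" by simp
  qed
qed

text \<open>Replace \<open>a n\<close> by its model \<open>c * (n + 1) ^ k * l ^ n\<close>. Dividing
  by the model is possible on the level of partial sums, by \<open>cesaro_divide_power\<close>. The
  error is the bounded ratio \<open>x n y / a n\<close> times a null sequence. Where
  \<open>a n = 0\<close>, the bound forces \<open>x n y = 0\<close>, and the quotient is 0.\<close>

lemma cesaro_regular_ratio_mean:
  fixes x :: "nat \<Rightarrow> 'x \<Rightarrow> real"
  assumes x: "cesaro_regular M x a"
  shows "AE y in M. convergent (\<lambda>N. (\<Sum>n<N. x n y / a n) / real N)"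
proof -
  obtain K where K: "K \<ge> 0" "\<And>n z. \<bar>x n z\<bar> \<le> K * a n" using cesaro_regular_bounded[OF x] by blast
  have a0: "0 \<le> a n" for n by (rule regular_growth_nonneg[OF cesaro_regular_reg[OF x]])
  have rK: "\<bar>x n y / a n\<bar> \<le> K" for n y
    using K(2)[of n y] K(1) a0[of n] by (cases "a n = 0") (auto simp: abs_divide divide_le_eq)
  from cesaro_regular_reg[OF x] consider (z) "\<forall>\<^sub>F n in sequentially. a n = 0"
    | (asy) k l c where "l > 0" "c > 0" "(\<lambda>n. a n / growth k l n) \<longlonglongrightarrow> c" unfolding regular_growth_def by blast
  then show ?thesis
  proof cases
    case z
    have "(\<lambda>n. x n y / a n) \<longlonglongrightarrow> 0" for y
      by (intro tendsto_eventually) (use z in eventually_elim, simp)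
    from cesaro_mean[OF this] show ?thesis using convergentI by blast
  next
    case (asy k l c)
    define \<rho> where "\<rho> n = a n / l ^ n / real (Suc n) ^ k" for n
    have "(\<lambda>n. a n / growth k l n / (real (Suc n) / real n) ^ k) \<longlonglongrightarrow> c / 1 ^ k"
      by (intro tendsto_divide asy tendsto_power Suc_over_lim) auto
    then have \<rho>: "\<rho> \<longlonglongrightarrow> c / 1 ^ k"
      by (rule Lim_transform_eventually, intro eventually_mono[OF eventually_gt_at_top[of 0]])
        (auto simp: \<rho>_def growth_def power_divide simp del: of_nat_Suc)
    have "(\<lambda>n. \<bar>1 - \<rho> n / c\<bar>) \<longlonglongrightarrow> \<bar>1 - (c / 1 ^ k) / c\<bar>"
      by (intro tendsto_intros \<rho>) (use asy in auto)
    then have "(\<lambda>n. K * \<bar>1 - \<rho> n / c\<bar>) \<longlonglongrightarrow> K * 0" using asy by (intro tendsto_mult tendsto_const) auto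
    then have err: "(\<lambda>n. K * \<bar>1 - \<rho> n / c\<bar>) \<longlonglongrightarrow> 0" by simp
    from cesaro_regular_AE[OF x asy(1,3)] show ?thesis
    proof eventually_elim
      case (elim y)
      from cesaro_divide_power[OF elim]
      have 1: "convergent (\<lambda>N. (1 / c) * ((\<Sum>n<N. x n y / l ^ n / real (Suc n) ^ k) / real N))"
        by (intro convergent_mult convergent_const)
      have "(\<lambda>n. x n y / a n * (1 - \<rho> n / c)) \<longlonglongrightarrow> 0"
      proof (rule Lim_null_comparison[OF always_eventually err], rule allI)
        show "norm (x n y / a n * (1 - \<rho> n / c)) \<le> K * \<bar>1 - \<rho> n / c\<bar>" for n
          unfolding real_norm_def abs_mult[of "x n y / a n"] by (rule mult_right_mono[OF rK]) simp
      qed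
      from cesaro_mean[OF this] have 2: "convergent (\<lambda>N. (\<Sum>n<N. x n y / a n * (1 - \<rho> n / c)) / real N)"
        by (rule convergentI)
      have eq: "x n y / a n = (1 / c) * (x n y / l ^ n / real (Suc n) ^ k) + x n y / a n * (1 - \<rho> n / c)" for n
      proof (cases "a n = 0")
        case True
        then show ?thesis using K(2)[of n y] by simp
      next
        case False
        then have "x n y / a n * \<rho> n = x n y / l ^ n / real (Suc n) ^ k" by (simp add: \<rho>_def)
        moreover have "r = (1 / c) * (r * \<rho> n) + r * (1 - \<rho> n / c)" for r by (simp add: algebra_simps)
        ultimately show ?thesis by metis
      qed
      have "(\<Sum>n<N. x n y / a n) / real N = (1 / c) * ((\<Sum>n<N. x n y / l ^ n / real (Suc n) ^ k) / real N)
          + (\<Sum>n<N. x n y / a n * (1 - \<rho> n / c)) / real N" for N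
      proof -
        have "(\<Sum>n<N. x n y / a n) = (\<Sum>n<N. (1 / c) * (x n y / l ^ n / real (Suc n) ^ k) + x n y / a n * (1 - \<rho> n / c))"
          by (intro sum.cong refl eq)
        then show ?thesis by (simp only: sum.distrib sum_distrib_left[symmetric] add_divide_distrib) simp
      qed
      then show ?case using convergent_add[OF 1 2] by simp
    qed
  qed
qed

section \<open>Operator matrices\<close>

text \<open>The source \<open>w\<close> is fixed and each new factor acts outermost at the target,
  as the last arc of a path does. The scalar shadow of \<open>op_pow\<close> is
  \<open>mat_pow\<close>.\<close>

primrec op_pow :: "'a set \<Rightarrow> ('a \<Rightarrow> 'a \<Rightarrow> ('x \<Rightarrow> real) \<Rightarrow> 'x \<Rightarrow> real) \<Rightarrow> nat \<Rightarrow> 'a \<Rightarrow> 'a \<Rightarrow> ('x \<Rightarrow> real) \<Rightarrow> 'x \<Rightarrow> real" where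
  "op_pow C A 0 w v f = (if w = v then f else (\<lambda>_. 0))"
| "op_pow C A (Suc n) w v f = (\<lambda>x. \<Sum>z\<in>C. A z v (op_pow C A n w z f) x)"

lemma pos_op_op_pow:
  assumes M: "finite_measure M" and A: "\<And>w v. w \<in> C \<Longrightarrow> v \<in> C \<Longrightarrow> pos_op M (B w v) (A w v)" and v: "v \<in> C"
  shows "pos_op M (mat_pow C B n w v) (op_pow C A n w v)"
  using v
proof (induction n arbitrary: v)
  case 0
  have "op_pow C A 0 w v = (if w = v then (\<lambda>f. f) else (\<lambda>f x. 0))" by auto
  then show ?case by (simp add: pos_op_id pos_op_zero)
next
  case (Suc n)
  have "pos_op M (\<Sum>z\<in>C. mat_pow C B n w z * B z v) (\<lambda>f x. \<Sum>z\<in>C. A z v (op_pow C A n w z f) x)"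
    by (intro pos_op_sum_op[OF M] pos_op_comp Suc.IH A Suc.prems)
  moreover have "op_pow C A (Suc n) w v = (\<lambda>f x. \<Sum>z\<in>C. A z v (op_pow C A n w z f) x)" by auto
  ultimately show ?case by simp
qed

text \<open>With \<open>h\<close>, \<open>k\<close> the left and right Perron eigenvectors, conjugation by \<open>h\<close> turns the operator matrix into a Markov
  operator on \<open>C \<times> X\<close> that preserves the product of the weights \<open>h u * k u\<close> with the given measure.\<close>

lemma class_ergodic:
  fixes A :: "'a \<Rightarrow> 'a \<Rightarrow> ('x \<Rightarrow> real) \<Rightarrow> 'x \<Rightarrow> real"
  assumes M: "prob_space M" and C: "finite C" and A: "\<And>w v. w \<in> C \<Longrightarrow> v \<in> C \<Longrightarrow> pos_op M (B w v) (A w v)"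
    and l: "l > 0" and L: "\<And>u v. u \<in> C \<Longrightarrow> v \<in> C \<Longrightarrow> L u v > 0"
    "\<And>u v. u \<in> C \<Longrightarrow> v \<in> C \<Longrightarrow> (\<lambda>n. mat_pow C B n u v / l ^ n) \<longlonglongrightarrow> L u v"
    and f: "bmf M f" and w: "w \<in> C" and v: "v \<in> C"
  shows "AE y in M. convergent (\<lambda>N. (\<Sum>j<N. op_pow C A j w v f y / l ^ j) / real N)"
proof -
  interpret M: prob_space M by fact
  have fm: "finite_measure M" by unfold_locales
  \<comment> \<open>Passing to the limit in the recursions for the normalised powers shows that the
    row \<open>L w\<close> is a left eigenvector and the column through \<open>w\<close> a right
    one.\<close>
  define h where "h = L w"
  define k where "k u = L u w" for u
  have h0: "h u > 0" and k0: "k u > 0" if "u \<in> C" for u using L(1) w that by (auto simp: h_def k_def)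
  have h_eig: "(\<Sum>z\<in>C. h z * B z u) = l * h u" if u: "u \<in> C" for u
  proof (rule LIMSEQ_unique)
    show "(\<lambda>n. \<Sum>z\<in>C. mat_pow C B n w z / l ^ n * B z u) \<longlonglongrightarrow> (\<Sum>z\<in>C. h z * B z u)"
      unfolding h_def using L(2) w by (intro tendsto_sum tendsto_mult tendsto_const) auto
    have "(\<lambda>n. l * (mat_pow C B (Suc n) w u / l ^ Suc n)) \<longlonglongrightarrow> l * h u"
      unfolding h_def by (intro tendsto_mult tendsto_const LIMSEQ_Suc[OF L(2)] w u)
    moreover have "l * (mat_pow C B (Suc n) w u / l ^ Suc n) = (\<Sum>z\<in>C. mat_pow C B n w z / l ^ n * B z u)" for n
      using l by (simp add: sum_divide_distrib sum_distrib_left)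
    ultimately show "(\<lambda>n. \<Sum>z\<in>C. mat_pow C B n w z / l ^ n * B z u) \<longlonglongrightarrow> l * h u" by (simp only:)
  qed
  have k_eig: "(\<Sum>z\<in>C. B u z * k z) = l * k u" if u: "u \<in> C" for u
  proof (rule LIMSEQ_unique)
    show "(\<lambda>n. \<Sum>z\<in>C. B u z * (mat_pow C B n z w / l ^ n)) \<longlonglongrightarrow> (\<Sum>z\<in>C. B u z * k z)"
      unfolding k_def using L(2) w by (intro tendsto_sum tendsto_mult tendsto_const) auto
    have "(\<lambda>n. l * (mat_pow C B (Suc n) u w / l ^ Suc n)) \<longlonglongrightarrow> l * k u"
      unfolding k_def by (intro tendsto_mult tendsto_const LIMSEQ_Suc[OF L(2)] w u)
    moreover have "l * (mat_pow C B (Suc n) u w / l ^ Suc n) = (\<Sum>z\<in>C. B u z * (mat_pow C B n z w / l ^ n))" for n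
      using l unfolding mat_pow_Suc_left[OF C u w] by (simp add: sum_divide_distrib sum_distrib_left)
    ultimately show "(\<lambda>n. \<Sum>z\<in>C. B u z * (mat_pow C B n z w / l ^ n)) \<longlonglongrightarrow> l * k u" by (simp only:)
  qed
  define S where "S = (\<Sum>u\<in>C. h u * k u)"
  have S0: "S > 0" unfolding S_def using C w h0 k0 by (intro sum_pos) auto
  define p where "p u = h u * k u / S" for u
  have p0: "p u > 0" if "u \<in> C" for u using h0 k0 S0 that by (simp add: p_def)
  have p1: "(\<Sum>u\<in>C. p u) = 1" unfolding p_def sum_divide_distrib[symmetric] S_def[symmetric] using S0 by simp
  define D where "D = point_measure C (\<lambda>u. ennreal (p u))"
  interpret D: prob_space D
    unfolding D_def using C p0 p1 by (intro prob_space_point_measure) (auto simp: less_imp_le sum_ennreal)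
  define Y where "Y = D \<Otimes>\<^sub>M M"
  interpret Y: pair_prob_space D M ..
  have Yp: "prob_space Y" unfolding Y_def by (rule Y.P.prob_space_axioms)
  have Yfm: "finite_measure Y" unfolding Y_def by unfold_locales
  have setsY: "sets Y = sets (count_space C \<Otimes>\<^sub>M M)"
    unfolding Y_def D_def by (intro sets_pair_measure_cong) (auto simp: sets_point_measure)
  have Y_meas: "g \<in> borel_measurable Y \<longleftrightarrow> (\<forall>u\<in>C. (\<lambda>y. g (u, y)) \<in> borel_measurable M)" for g :: "'a \<times> 'x \<Rightarrow> real"
  proof
    assume "\<forall>u\<in>C. (\<lambda>y. g (u, y)) \<in> borel_measurable M"
    then show "g \<in> borel_measurable Y"
      unfolding measurable_cong_sets[OF setsY refl] using C
      by (intro measurable_pair_measure_countable1) (auto intro: countable_finite)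
  next
    assume g: "g \<in> borel_measurable Y"
    show "\<forall>u\<in>C. (\<lambda>y. g (u, y)) \<in> borel_measurable M"
    proof
      fix u assume "u \<in> C"
      then have "Pair u \<in> M \<rightarrow>\<^sub>M count_space C \<Otimes>\<^sub>M M" by (intro measurable_Pair1') simp
      from measurable_compose[OF this g[unfolded measurable_cong_sets[OF setsY refl]]]
      show "(\<lambda>y. g (u, y)) \<in> borel_measurable M" .
    qed
  qed
  have Y_bmf: "bmf M (\<lambda>y. g (u, y))" if "bmf Y g" "u \<in> C" for g u
    using that Y_meas[of g] unfolding bmf_def by blast
  have Y_int: "(\<integral>z. g z \<partial>Y) = (\<Sum>u\<in>C. p u * (\<integral>y. g (u, y) \<partial>M))" if g: "bmf Y g" for g
  proof -
    have "(\<integral>z. g z \<partial>Y) = (\<integral>u. (\<integral>y. g (u, y) \<partial>M) \<partial>D)"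
      using Y.integral_fst'[of g] bmf_integrable[OF Yfm g] unfolding Y_def by simp
    also have "\<dots> = (\<Sum>u\<in>C. p u * (\<integral>y. g (u, y) \<partial>M))"
      unfolding D_def using C p0 by (subst lebesgue_integral_point_measure_finite) (auto simp: less_imp_le)
    finally show ?thesis .
  qed
  \<comment> \<open>Normalisation \<open>P 1 = 1\<close> is the eigenvector equation of
    \<open>h\<close>; preservation of the integral will be that of \<open>k\<close>. Outside
    \<open>C\<close>, where \<open>Y\<close> has no points, \<open>P\<close> is the identity, since
    \<open>pos_op\<close> makes demands at every element of the type.\<close>
  define P where "P g z = (if fst z \<in> C then \<Sum>u\<in>C. h u / (l * h (fst z)) * A u (fst z) (\<lambda>y. g (u, y)) (snd z) else g z)"
    for g :: "'a \<times> 'x \<Rightarrow> real" and z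
  have P_in: "P g (u', y) = (\<Sum>u\<in>C. h u / (l * h u') * A u u' (\<lambda>y. g (u, y)) y)" if "u' \<in> C" for g u' y
    using that by (simp add: P_def)
  have P_out: "P g z = g z" if "fst z \<notin> C" for g z using that by (simp add: P_def)
  have coef: "0 \<le> h u / (l * h u')" if "u \<in> C" "u' \<in> C" for u u'
    using h0[OF that(1)] h0[OF that(2)] l by simp
  have P_meas: "P g \<in> borel_measurable Y" if "g \<in> borel_measurable Y" for g
    unfolding Y_meas
  proof
    fix u' assume u': "u' \<in> C"
    show "(\<lambda>y. P g (u', y)) \<in> borel_measurable M" unfolding P_in[OF u']
      using that u' by (intro borel_measurable_sum borel_measurable_times borel_measurable_const pos_op_measurable[OF A]) (auto simp: Y_meas)
  qed
  have P_one: "P (\<lambda>_. 1) z = 1" for z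
  proof (cases "fst z \<in> C")
    case True
    have "P (\<lambda>_. 1) z = (\<Sum>u\<in>C. h u * B u (fst z)) / (l * h (fst z))"
      using True by (simp add: P_def pos_op_one[OF A] sum_divide_distrib)
    then show ?thesis using h_eig[OF True] h0[OF True] l by simp
  qed (simp add: P_def)
  have P_mono: "P g z \<le> P g' z" if "\<And>z. g z \<le> g' z" for g g' z
  proof (cases "fst z \<in> C")
    case True
    then show ?thesis unfolding P_def if_P[OF True]
      by (intro sum_mono mult_left_mono pos_op_mono[OF A] coef that)
  qed (simp add: P_out that)
  have P_abs: "\<bar>P g z\<bar> \<le> K" if K: "\<And>z. \<bar>g z\<bar> \<le> K" for g K z
  proof -
    have cm: "P (\<lambda>y. c * g y) z = c * P g z" for c g
      unfolding P_def by (auto simp: pos_op_cmult[OF A] sum_distrib_left mult_ac)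
    have "g y \<le> K * 1" "(-1) * g y \<le> K * 1" for y using K[of y] by linarith+
    then have "P g z \<le> P (\<lambda>_. K * 1) z" "P (\<lambda>y. (-1) * g y) z \<le> P (\<lambda>_. K * 1) z"
      by (auto simp del: mult_minus_left mult_1 mult_1_right intro!: P_mono)
    then show ?thesis unfolding cm P_one by simp
  qed
  have P: "pos_op Y 1 P"
    unfolding pos_op_def
  proof (intro conjI allI ballI impI)
    fix g g' z
    show "P (\<lambda>y. g y + g' y) z = P g z + P g' z"
      unfolding P_def by (simp add: pos_op_add[OF A] distrib_left sum.distrib)
  next
    fix c g z show "P (\<lambda>y. c * g y) z = c * P g z"
      unfolding P_def by (auto simp: pos_op_cmult[OF A] sum_distrib_left mult_ac)
  next
    fix g :: "'a \<times> 'x \<Rightarrow> real" assume g: "bmf Y g"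
    then obtain K where K: "\<And>z. \<bar>g z\<bar> \<le> K" by (meson bmfE)
    have Pg: "bmf Y (P g)" by (rule bmfI[OF P_meas P_abs[OF K]]) (use g in \<open>simp add: bmf_def\<close>)
    have iA: "integrable M (A u u' (\<lambda>y. g (u, y)))" if "u \<in> C" "u' \<in> C" for u u'
      by (rule bmf_integrable[OF fm pos_op_bmf[OF A[OF that] Y_bmf[OF g that(1)]]])
    have "(\<integral>z. P g z \<partial>Y) = (\<Sum>u'\<in>C. p u' * (\<Sum>u\<in>C. h u / (l * h u') * (B u u' * (\<integral>y. g (u, y) \<partial>M))))"
      unfolding Y_int[OF Pg]
    proof (intro sum.cong refl arg_cong2[of _ _ _ _ "(*)"])
      fix u' assume u': "u' \<in> C"
      have "(\<integral>y. P g (u', y) \<partial>M) = (\<Sum>u\<in>C. \<integral>y. h u / (l * h u') * A u u' (\<lambda>y. g (u, y)) y \<partial>M)"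
        unfolding P_in[OF u'] using iA u' by (intro Bochner_Integration.integral_sum integrable_mult_right) auto
      also have "\<dots> = (\<Sum>u\<in>C. h u / (l * h u') * (B u u' * (\<integral>y. g (u, y) \<partial>M)))"
        by (intro sum.cong refl) (simp add: pos_op_integral[OF A[OF _ u'] Y_bmf[OF g]])
      finally show "(\<integral>y. P g (u', y) \<partial>M) = (\<Sum>u\<in>C. h u / (l * h u') * (B u u' * (\<integral>y. g (u, y) \<partial>M)))" .
    qed
    also have "\<dots> = (\<Sum>u'\<in>C. \<Sum>u\<in>C. (h u / (S * l) * (\<integral>y. g (u, y) \<partial>M)) * (B u u' * k u'))"
      unfolding sum_distrib_left
    proof (intro sum.cong refl)
      fix u u' assume "u \<in> C" "u' \<in> C"
      then show "p u' * (h u / (l * h u') * (B u u' * (\<integral>y. g (u, y) \<partial>M))) = (h u / (S * l) * (\<integral>y. g (u, y) \<partial>M)) * (B u u' * k u')"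
        using h0[of u'] by (simp add: p_def)
    qed
    also have "\<dots> = (\<Sum>u\<in>C. \<Sum>u'\<in>C. (h u / (S * l) * (\<integral>y. g (u, y) \<partial>M)) * (B u u' * k u'))" by (rule sum.swap)
    also have "\<dots> = (\<Sum>u\<in>C. p u * (\<integral>y. g (u, y) \<partial>M))"
      unfolding sum_distrib_left[symmetric]
    proof (intro sum.cong refl)
      fix u assume u: "u \<in> C"
      show "h u / (S * l) * (\<integral>y. g (u, y) \<partial>M) * (\<Sum>u'\<in>C. B u u' * k u') = p u * (\<integral>y. g (u, y) \<partial>M)"
        unfolding k_eig[OF u] p_def using l by simp
    qed
    finally show "(\<integral>z. P g z \<partial>Y) = 1 * (\<integral>z. g z \<partial>Y)" unfolding Y_int[OF g] by simp
  next
    fix G :: "nat \<Rightarrow> 'a \<times> 'x \<Rightarrow> real" and g z assume G: "\<forall>y. (\<lambda>n. G n y) \<longlonglongrightarrow> g y"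
    show "(\<lambda>n. P (G n) z) \<longlonglongrightarrow> P g z"
    proof (cases "fst z \<in> C")
      case True
      show ?thesis unfolding P_def if_P[OF True]
        by (intro tendsto_sum tendsto_mult tendsto_const pos_op_lim[OF A] G[rule_format] True)
    qed (simp add: P_out G)
  qed (use P_meas P_one P_mono in auto)
  \<comment> \<open>Placing \<open>f\<close> on the fibre over \<open>w\<close> makes the powers of
    \<open>P\<close> reproduce row \<open>w\<close> of the operator powers: the factors
    \<open>h\<close> telescope to \<open>h w / h u\<close>, and \<open>l ^ j\<close> appears in the
    denominator.\<close>
  define g where "g z = (if fst z = w then f (snd z) else 0)" for z
  have Pj: "(P ^^ j) g (u, y) = h w / (l ^ j * h u) * op_pow C A j w u f y" if "u \<in> C" for j u y
    using that
  proof (induction j arbitrary: u y)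
    case 0
    then show ?case using h0[OF 0] by (auto simp: g_def)
  next
    case (Suc j)
    have "(P ^^ Suc j) g (u, y) = (\<Sum>z\<in>C. h z / (l * h u) * A z u (\<lambda>y. (P ^^ j) g (z, y)) y)"
      by (simp add: P_in[OF Suc.prems])
    also have "\<dots> = (\<Sum>z\<in>C. h w / (l ^ Suc j * h u) * A z u (op_pow C A j w z f) y)"
    proof (intro sum.cong refl)
      fix z assume z: "z \<in> C"
      have "(\<lambda>y. (P ^^ j) g (z, y)) = (\<lambda>y. h w / (l ^ j * h z) * op_pow C A j w z f y)" using Suc.IH[OF z] by auto
      then have "A z u (\<lambda>y. (P ^^ j) g (z, y)) y = h w / (l ^ j * h z) * A z u (op_pow C A j w z f) y"
        by (simp only: pos_op_cmult[OF A[OF z Suc.prems]])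
      then show "h z / (l * h u) * A z u (\<lambda>y. (P ^^ j) g (z, y)) y = h w / (l ^ Suc j * h u) * A z u (op_pow C A j w z f) y"
        using h0[OF z] by simp
    qed
    finally show ?case by (simp add: sum_distrib_left)
  qed
  obtain K where K: "\<And>y. \<bar>f y\<bar> \<le> K" "K \<ge> 0" using f by (meson bmfE)
  have "bmf Y g"
  proof (rule bmfI[where K=K])
    show "g \<in> borel_measurable Y" unfolding Y_meas
    proof
      fix u show "(\<lambda>y. g (u, y)) \<in> borel_measurable M"
        using bmf_measurable[OF f] by (cases "u = w") (simp_all add: g_def)
    qed
  qed (use K in \<open>auto simp: g_def\<close>)
  from ergodic_theorem[OF Yp P this]
  have "AE z in D \<Otimes>\<^sub>M M. convergent (\<lambda>n. (\<Sum>j<n. (P ^^ j) g z) / real n)" by (simp only: Y_def)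
  from Y.AE_pair[OF this]
  have "AE u in D. AE y in M. convergent (\<lambda>n. (\<Sum>j<n. (P ^^ j) g (u, y)) / real n)" .
  \<comment> \<open>The point \<open>v\<close> has positive mass \<open>p v\<close>, so a property
    of almost all points of \<open>C\<close> holds at \<open>v\<close>.\<close>
  then have "AE y in M. convergent (\<lambda>n. (\<Sum>j<n. (P ^^ j) g (v, y)) / real n)"
    unfolding D_def using v p0[OF v] by (simp add: AE_point_measure)
  then show ?thesis
  proof eventually_elim
    case (elim y)
    have "convergent (\<lambda>n. (h v / h w) * ((\<Sum>j<n. (P ^^ j) g (v, y)) / real n))"
      by (intro convergent_mult convergent_const elim)
    moreover have "(h v / h w) * ((\<Sum>j<n. (P ^^ j) g (v, y)) / real n) = (\<Sum>j<n. op_pow C A j w v f y / l ^ j) / real n" for n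
    proof -
      have "(h v / h w) * (\<Sum>j<n. (P ^^ j) g (v, y)) = (\<Sum>j<n. op_pow C A j w v f y / l ^ j)"
        unfolding sum_distrib_left Pj[OF v] using h0[OF v] h0[OF w] by (intro sum.cong refl) simp
      then show ?thesis by (simp only: times_divide_eq_right)
    qed
    ultimately show ?case by simp
  qed
qed

text \<open>Duhamel's formula: \<open>g (n - j) w\<close> enters the class at \<open>w\<close> at
  time \<open>n - j\<close> and then evolves inside it for \<open>j\<close> steps. The operator
  version has the same shape, so both sequences become sums of convolutions with the powers of one
  block.\<close>

lemma variation_of_constants_scalar:
  fixes a g :: "nat \<Rightarrow> 'a \<Rightarrow> real"
  assumes C: "finite C" and a0: "\<And>c. c \<in> C \<Longrightarrow> a 0 c = g 0 c"
    and aS: "\<And>n c. c \<in> C \<Longrightarrow> a (Suc n) c = (\<Sum>z\<in>C. B z c * a n z) + g (Suc n) c" and c: "c \<in> C"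
  shows "a n c = (\<Sum>w\<in>C. \<Sum>j\<le>n. mat_pow C B j w c * g (n - j) w)"
  using c
proof (induction n arbitrary: c)
  case 0
  have "(\<Sum>w\<in>C. \<Sum>j\<le>0. mat_pow C B j w c * g (0 - j) w) = (\<Sum>w\<in>C. if w = c then g 0 w else 0)"
    by (auto intro: sum.cong)
  then show ?case using 0 C a0 by (simp add: sum.delta)
next
  case (Suc n)
  have "(\<Sum>w\<in>C. \<Sum>j\<le>Suc n. mat_pow C B j w c * g (Suc n - j) w) =
      (\<Sum>w\<in>C. (if w = c then g (Suc n) w else 0) + (\<Sum>j\<le>n. mat_pow C B (Suc j) w c * g (n - j) w))"
    by (intro sum.cong refl) (simp add: sum.atMost_Suc_shift del: sum.atMost_Suc mat_pow.simps(2))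
  also have "\<dots> = g (Suc n) c + (\<Sum>w\<in>C. \<Sum>j\<le>n. mat_pow C B (Suc j) w c * g (n - j) w)"
    using C Suc.prems by (simp add: sum.distrib sum.delta)
  also have "(\<Sum>w\<in>C. \<Sum>j\<le>n. mat_pow C B (Suc j) w c * g (n - j) w) =
      (\<Sum>w\<in>C. \<Sum>j\<le>n. \<Sum>z\<in>C. B z c * (mat_pow C B j w z * g (n - j) w))"
    by (simp add: sum_distrib_right) (simp add: mult_ac)
  also have "\<dots> = (\<Sum>w\<in>C. \<Sum>z\<in>C. \<Sum>j\<le>n. B z c * (mat_pow C B j w z * g (n - j) w))"
    by (intro sum.cong refl sum.swap)
  also have "\<dots> = (\<Sum>z\<in>C. \<Sum>w\<in>C. \<Sum>j\<le>n. B z c * (mat_pow C B j w z * g (n - j) w))"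
    by (rule sum.swap)
  also have "\<dots> = (\<Sum>z\<in>C. B z c * a n z)"
    by (intro sum.cong refl) (simp add: Suc.IH sum_distrib_left)
  finally show ?case using aS[OF Suc.prems, of n] by simp
qed

lemma variation_of_constants_op:
  fixes x g :: "nat \<Rightarrow> 'a \<Rightarrow> 'x \<Rightarrow> real"
  assumes C: "finite C" and A: "\<And>w v. w \<in> C \<Longrightarrow> v \<in> C \<Longrightarrow> pos_op M (B w v) (A w v)"
    and x0: "\<And>c. c \<in> C \<Longrightarrow> x 0 c = g 0 c"
    and xS: "\<And>n c y. c \<in> C \<Longrightarrow> x (Suc n) c y = (\<Sum>z\<in>C. A z c (x n z) y) + g (Suc n) c y" and c: "c \<in> C"
  shows "x n c y = (\<Sum>w\<in>C. \<Sum>j\<le>n. op_pow C A j w c (g (n - j) w) y)"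
  using c
proof (induction n arbitrary: c y)
  case 0
  have "(\<Sum>w\<in>C. \<Sum>j\<le>0. op_pow C A j w c (g (0 - j) w) y) = (\<Sum>w\<in>C. if w = c then g 0 w y else 0)"
    by (auto intro: sum.cong)
  then show ?case using 0 C x0 by (simp add: sum.delta)
next
  case (Suc n)
  have "(\<Sum>w\<in>C. \<Sum>j\<le>Suc n. op_pow C A j w c (g (Suc n - j) w) y) =
      (\<Sum>w\<in>C. (if w = c then g (Suc n) w y else 0) + (\<Sum>j\<le>n. op_pow C A (Suc j) w c (g (n - j) w) y))"
    by (intro sum.cong refl) (simp add: sum.atMost_Suc_shift del: sum.atMost_Suc op_pow.simps(2))
  also have "\<dots> = g (Suc n) c y + (\<Sum>w\<in>C. \<Sum>j\<le>n. op_pow C A (Suc j) w c (g (n - j) w) y)"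
    using C Suc.prems by (simp add: sum.distrib sum.delta)
  also have "(\<Sum>w\<in>C. \<Sum>j\<le>n. op_pow C A (Suc j) w c (g (n - j) w) y) =
      (\<Sum>w\<in>C. \<Sum>j\<le>n. \<Sum>z\<in>C. A z c (op_pow C A j w z (g (n - j) w)) y)"
    by simp
  also have "\<dots> = (\<Sum>w\<in>C. \<Sum>z\<in>C. \<Sum>j\<le>n. A z c (op_pow C A j w z (g (n - j) w)) y)"
    by (intro sum.cong refl sum.swap)
  also have "\<dots> = (\<Sum>z\<in>C. \<Sum>w\<in>C. \<Sum>j\<le>n. A z c (op_pow C A j w z (g (n - j) w)) y)"
    by (rule sum.swap)
  also have "\<dots> = (\<Sum>z\<in>C. A z c (x n z) y)"
  proof (intro sum.cong refl)
    fix z assume z: "z \<in> C"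
    have "x n z = (\<lambda>y. \<Sum>w\<in>C. \<Sum>j\<le>n. op_pow C A j w z (g (n - j) w) y)" using Suc.IH[OF z] by auto
    then show "(\<Sum>w\<in>C. \<Sum>j\<le>n. A z c (op_pow C A j w z (g (n - j) w)) y) = A z c (x n z) y"
      by (simp only: pos_op_sum[OF A[OF z Suc.prems]])
  qed
  finally show ?case using xS[OF Suc.prems, of n] by simp
qed

text \<open>The idempotent pattern makes the relation \<open>R\<close> transitive. A vertex without
  \<open>R v v\<close> therefore has only predecessors of lower rank and is a finite sum over them.
  Otherwise its class \<open>C\<close> is a block with all entries positive, driven by lower
  classes, and Perron asymptotics, the ergodic theorem for the block and the convolution lemma
  apply.\<close>

lemma cesaro_regular_matrix_orbit:
  fixes x :: "nat \<Rightarrow> 'a \<Rightarrow> 'x \<Rightarrow> real" and a :: "nat \<Rightarrow> 'a \<Rightarrow> real"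
  assumes M: "prob_space M" and V: "finite V"
    and A: "\<And>w v. w \<in> V \<Longrightarrow> v \<in> V \<Longrightarrow> pos_op M (B w v) (A w v)"
    and idem: "\<And>w v. w \<in> V \<Longrightarrow> v \<in> V \<Longrightarrow> B w v > 0 \<longleftrightarrow> (\<exists>z\<in>V. B w z > 0 \<and> B z v > 0)"
    and xS: "\<And>n v y. v \<in> V \<Longrightarrow> x (Suc n) v y = (\<Sum>w\<in>V. A w v (x n w) y)"
    and aS: "\<And>n v. v \<in> V \<Longrightarrow> a (Suc n) v = (\<Sum>w\<in>V. B w v * a n w)"
    and x0: "\<And>v. v \<in> V \<Longrightarrow> x 0 v \<in> borel_measurable M"
    and x0_le: "\<And>v y. v \<in> V \<Longrightarrow> \<bar>x 0 v y\<bar> \<le> K * a 0 v" and a0: "\<And>v. v \<in> V \<Longrightarrow> a 0 v \<ge> 0"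
    and v: "v \<in> V"
  shows "cesaro_regular M (\<lambda>n. x n v) (\<lambda>n. a n v)"
proof -
  interpret prob_space M by fact
  have fm: "finite_measure M" by unfold_locales
  have B0: "B w v \<ge> 0" if "w \<in> V" "v \<in> V" for w v by (rule pos_op_factor_nonneg[OF A[OF that]])
  have x_le: "\<bar>x n v y\<bar> \<le> K * a n v" if "v \<in> V" for n v y
    using that
  proof (induction n arbitrary: v y)
    case (Suc n)
    have "\<bar>x (Suc n) v y\<bar> \<le> (\<Sum>w\<in>V. B w v * (K * a n w))"
      unfolding xS[OF Suc.prems]
      by (rule order_trans[OF sum_abs sum_mono]) (rule pos_op_abs_le[OF A[OF _ Suc.prems] Suc.IH])
    then show ?case unfolding aS[OF Suc.prems] by (simp add: sum_distrib_left mult_ac)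
  qed (rule x0_le)
  \<comment> \<open>A positive operator with factor 0 kills bounded functions, and
    \<open>x n w\<close> is bounded by \<open>K * a n w\<close>; the zero pattern of
    \<open>B\<close> is thus also that of the operators along the orbit.\<close>
  have A_zero: "A w v (x n w) y = 0" if "w \<in> V" "v \<in> V" "\<not> B w v > 0" for w v n y
  proof -
    have "B w v = 0" using B0[OF that(1,2)] that(3) by simp
    then show ?thesis using pos_op_abs_le[OF A[OF that(1,2)], of "x n w" "K * a n w" y] x_le[OF that(1)] by simp
  qed
  define R where "R w v \<longleftrightarrow> w \<in> V \<and> v \<in> V \<and> B w v > 0" for w v
  have R_trans: "R u w \<Longrightarrow> R w v \<Longrightarrow> R u v" for u w v unfolding R_def using idem by blast
  \<comment> \<open>Counting \<open>v\<close> along with its predecessors makes the inclusion strict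
    even if \<open>R v v\<close> fails: \<open>v\<close> lies in its own set but not in that of a
    strictly lower \<open>w\<close>.\<close>
  define rank where "rank v = card {w \<in> V. R w v \<or> w = v}" for v
  have rank_less: "rank w < rank v" if "R w v" "\<not> R v w" for w v
    unfolding rank_def
  proof (rule psubset_card_mono)
    show "{u \<in> V. R u w \<or> u = w} \<subset> {u \<in> V. R u v \<or> u = v}"
      using that R_trans by (auto simp: R_def)
  qed (use V in simp)
  have shifted: "cesaro_regular M (\<lambda>n y. \<Sum>w\<in>D. A w c (x n w) y) (\<lambda>n. \<Sum>w\<in>D. B w c * a n w)"
    if "c \<in> V" "\<And>w. w \<in> D \<Longrightarrow> R w c \<and> cesaro_regular M (\<lambda>n. x n w) (\<lambda>n. a n w)" for c D
    using that by (intro cesaro_regular_sum cesaro_regular_op[OF fm A]) (auto simp: R_def)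
  show ?thesis using v
  proof (induction "rank v" arbitrary: v rule: less_induct)
    case less
    have IH: "cesaro_regular M (\<lambda>n. x n w) (\<lambda>n. a n w)" if "R w v" "\<not> R v w" for w
      using less.hyps[OF rank_less[OF that]] that by (simp add: R_def)
    show ?case
    proof (cases "R v v")
      case False
      define D where "D = {w \<in> V. R w v}"
      have D: "R w v \<and> \<not> R v w" if "w \<in> D" for w using that False R_trans by (auto simp: D_def)
      have "x (Suc n) v y = (\<Sum>w\<in>D. A w v (x n w) y)" for n y
        unfolding xS[OF less.prems] D_def using V A_zero less.prems
        by (intro sum.mono_neutral_right) (auto simp: R_def)
      then have "x (Suc n) v = (\<lambda>y. \<Sum>w\<in>D. A w v (x n w) y)" for n by blast
      moreover have "a (Suc n) v = (\<Sum>w\<in>D. B w v * a n w)" for n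
        unfolding aS[OF less.prems] D_def using V B0 less.prems
        by (intro sum.mono_neutral_right) (force simp: R_def less_le)+
      ultimately have "cesaro_regular M (\<lambda>n. x (Suc n) v) (\<lambda>n. a (Suc n) v)"
        using shifted[OF less.prems, of D] D IH by simp
      then show ?thesis by (rule cesaro_regular_unshift) (use x0 x0_le a0 less.prems in auto)
    next
      case True
      define C where "C = {w \<in> V. R w v \<and> R v w}"
      define D where "D = {w \<in> V. R w v \<and> \<not> R v w}"
      have C: "finite C" "v \<in> C" "C \<subseteq> V" using V True less.prems by (auto simp: C_def)
      have BC: "B w c > 0" if "w \<in> C" "c \<in> C" for w c
        using that R_trans[of w v c] by (auto simp: C_def R_def)
      have AC: "pos_op M (B w c) (A w c)" if "w \<in> C" "c \<in> C" for w c using A that C by blast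
      have RD: "R w c" if "w \<in> D" "c \<in> C" for w c using that R_trans[of w v c] by (auto simp: C_def D_def)
      have CD: "w \<in> C \<union> D" if "R w c" "c \<in> C" for w c
        using that R_trans[of w c v] by (auto simp: C_def D_def R_def)
      have CDV: "C \<union> D \<subseteq> V" "C \<inter> D = {}" "finite D" using V by (auto simp: C_def D_def)
      \<comment> \<open>The inflow into the class: the initial value at time 0, and at time
        \<open>m + 1\<close> what the lower vertices in \<open>D\<close> send from time
        \<open>m\<close>.\<close>
      define g where "g n c = (case n of 0 \<Rightarrow> x 0 c | Suc m \<Rightarrow> (\<lambda>y. \<Sum>w\<in>D. A w c (x m w) y))" for n c
      define ga where "ga n c = (case n of 0 \<Rightarrow> a 0 c | Suc m \<Rightarrow> (\<Sum>w\<in>D. B w c * a m w))" for n c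
      have split: "x (Suc n) c y = (\<Sum>z\<in>C. A z c (x n z) y) + g (Suc n) c y" if c: "c \<in> C" for n c y
      proof -
        have cV: "c \<in> V" using c C by blast
        have z: "A w c (x n w) y = 0" if w: "w \<in> V - (C \<union> D)" for w
        proof -
          have "\<not> B w c > 0" using CD[OF _ c, of w] w cV by (auto simp: R_def)
          then show ?thesis using w cV by (intro A_zero) auto
        qed
        have "x (Suc n) c y = (\<Sum>w\<in>C \<union> D. A w c (x n w) y)"
          unfolding xS[OF cV] using V CDV z by (intro sum.mono_neutral_right) auto
        then show ?thesis using C CDV by (simp add: sum.union_disjoint g_def)
      qed
      have splita: "a (Suc n) c = (\<Sum>z\<in>C. B z c * a n z) + ga (Suc n) c" if c: "c \<in> C" for n c
      proof -
        have cV: "c \<in> V" using c C by blast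
        have z: "B w c = 0" if "w \<in> V - (C \<union> D)" for w
          using CD[OF _ c, of w] that cV B0[of w c] by (force simp: R_def less_le)
        have "a (Suc n) c = (\<Sum>w\<in>C \<union> D. B w c * a n w)"
          unfolding aS[OF cV] using V CDV z by (intro sum.mono_neutral_right) auto
        then show ?thesis using C CDV by (simp add: sum.union_disjoint ga_def)
      qed
      have cesaro_regular_g: "cesaro_regular M (\<lambda>n. g n c) (\<lambda>n. ga n c)" if c: "c \<in> C" for c
      proof (rule cesaro_regular_unshift)
        have cV: "c \<in> V" using c C by blast
        have "cesaro_regular M (\<lambda>n y. \<Sum>w\<in>D. A w c (x n w) y) (\<lambda>n. \<Sum>w\<in>D. B w c * a n w)"
        proof (rule shifted[OF cV])
          fix w assume w: "w \<in> D"
          then have "R w v" "\<not> R v w" by (auto simp: D_def)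
          then show "R w c \<and> cesaro_regular M (\<lambda>n. x n w) (\<lambda>n. a n w)" using RD[OF w c] IH by blast
        qed
        then show "cesaro_regular M (\<lambda>n. g (Suc n) c) (\<lambda>n. ga (Suc n) c)" by (simp add: g_def ga_def)
        show "g 0 c \<in> borel_measurable M" "\<And>y. \<bar>g 0 c y\<bar> \<le> K * ga 0 c" "ga 0 c \<ge> 0"
          using x0[OF cV] x0_le[OF cV] a0[OF cV] by (auto simp: g_def ga_def)
      qed
      have Cne: "C \<noteq> {}" using C by auto
      obtain l L where l: "l > 0" and L: "\<And>u v. u \<in> C \<Longrightarrow> v \<in> C \<Longrightarrow> L u v > 0"
        "\<And>u v. u \<in> C \<Longrightarrow> v \<in> C \<Longrightarrow> (\<lambda>n. mat_pow C B n u v / l ^ n) \<longlonglongrightarrow> L u v"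
        using perron[where B=B, OF C(1) Cne] BC by blast
      have "cesaro_regular M (\<lambda>n y. \<Sum>w\<in>C. \<Sum>j\<le>n. op_pow C A j w v (g (n - j) w) y)
          (\<lambda>n. \<Sum>w\<in>C. \<Sum>j\<le>n. mat_pow C B j w v * ga (n - j) w)"
      proof (rule cesaro_regular_sum)
        fix w assume w: "w \<in> C"
        show "cesaro_regular M (\<lambda>n y. \<Sum>j\<le>n. op_pow C A j w v (g (n - j) w) y) (\<lambda>n. \<Sum>j\<le>n. mat_pow C B j w v * ga (n - j) w)"
          by (rule cesaro_regular_conv[OF M pos_op_op_pow[where B=B and A=A, OF fm AC C(2)] l L(2)[OF w C(2)] L(1)[OF w C(2)]
                class_ergodic[where B=B and A=A, OF M C(1) AC l L _ w C(2)] cesaro_regular_g[OF w]])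
      qed
      moreover have "x n v = (\<lambda>y. \<Sum>w\<in>C. \<Sum>j\<le>n. op_pow C A j w v (g (n - j) w) y)" for n
        using variation_of_constants_op[of C M B A x g v n, OF C(1) AC _ split C(2)] by (auto simp: g_def)
      moreover have "a n v = (\<Sum>w\<in>C. \<Sum>j\<le>n. mat_pow C B j w v * ga (n - j) w)" for n
        using variation_of_constants_scalar[of C a ga B v n, OF C(1) _ splita C(2)] by (auto simp: ga_def)
      ultimately show ?thesis by simp
    qed
  qed
qed

section \<open>Idempotent zero patterns and residue classes\<close>

lemma op_pow_add:
  assumes M: "finite_measure M" and C: "finite C"
    and A: "\<And>w v. w \<in> C \<Longrightarrow> v \<in> C \<Longrightarrow> pos_op M (B w v) (A w v)" and v: "v \<in> C"
  shows "op_pow C A (m + n) u v f y = (\<Sum>w\<in>C. op_pow C A n w v (op_pow C A m u w f) y)"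
  using v
proof (induction n arbitrary: v y)
  case 0
  have "(\<Sum>w\<in>C. op_pow C A 0 w v (op_pow C A m u w f) y) = (\<Sum>w\<in>C. if w = v then op_pow C A m u w f y else 0)"
    by (intro sum.cong) auto
  then show ?case using 0 C by (simp add: sum.delta)
next
  case (Suc n)
  have "op_pow C A (m + Suc n) u v f y = (\<Sum>z\<in>C. A z v (op_pow C A (m + n) u z f) y)" by simp
  also have "\<dots> = (\<Sum>z\<in>C. \<Sum>w\<in>C. A z v (op_pow C A n w z (op_pow C A m u w f)) y)"
  proof (intro sum.cong refl)
    fix z assume z: "z \<in> C"
    have "op_pow C A (m + n) u z f = (\<lambda>y. \<Sum>w\<in>C. op_pow C A n w z (op_pow C A m u w f) y)" using Suc.IH[OF z] by blast
    then show "A z v (op_pow C A (m + n) u z f) y = (\<Sum>w\<in>C. A z v (op_pow C A n w z (op_pow C A m u w f)) y)"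
      by (simp only: pos_op_sum[OF A[OF z Suc.prems]])
  qed
  also have "\<dots> = (\<Sum>w\<in>C. \<Sum>z\<in>C. A z v (op_pow C A n w z (op_pow C A m u w f)) y)" by (rule sum.swap)
  finally show ?case by simp
qed

text \<open>Zero patterns of the powers multiply like relations and are finite in number, so they
  form a finite cyclic semigroup, which contains an idempotent. The equivalence states
  \<open>pat d = pat d O pat d\<close>.\<close>

lemma idempotent_pattern:
  fixes B :: "'a \<Rightarrow> 'a \<Rightarrow> real"
  assumes V: "finite V" and B: "\<And>w v. w \<in> V \<Longrightarrow> v \<in> V \<Longrightarrow> B w v \<ge> 0"
  obtains d where "d > 0"
    "\<And>w v. w \<in> V \<Longrightarrow> v \<in> V \<Longrightarrow> mat_pow V B d w v > 0 \<longleftrightarrow> (\<exists>z\<in>V. mat_pow V B d w z > 0 \<and> mat_pow V B d z v > 0)"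
proof -
  define pat where "pat n = {(u, v). u \<in> V \<and> v \<in> V \<and> mat_pow V B n u v > 0}" for n
  have nn: "mat_pow V B n u v \<ge> 0" if "v \<in> V" for n u v using that B by (intro mat_pow_nonneg)
  have pos_iff: "mat_pow V B (m + n) u v > 0 \<longleftrightarrow> (\<exists>z\<in>V. mat_pow V B m u z > 0 \<and> mat_pow V B n z v > 0)"
    if "u \<in> V" "v \<in> V" for m n u v
  proof -
    have terms: "0 \<le> mat_pow V B m u z * mat_pow V B n z v" if "z \<in> V" for z
      using nn that \<open>v \<in> V\<close> by (intro mult_nonneg_nonneg)
    have "mat_pow V B (m + n) u v > 0 \<longleftrightarrow> (\<exists>z\<in>V. mat_pow V B m u z * mat_pow V B n z v > 0)"
      unfolding mat_pow_add[OF V that]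
    proof
      assume pos: "0 < (\<Sum>z\<in>V. mat_pow V B m u z * mat_pow V B n z v)"
      show "\<exists>z\<in>V. mat_pow V B m u z * mat_pow V B n z v > 0"
      proof (rule ccontr)
        assume "\<not> ?thesis"
        then have "(\<Sum>z\<in>V. mat_pow V B m u z * mat_pow V B n z v) \<le> 0" by (intro sum_nonpos) force
        then show False using pos by simp
      qed
    next
      assume "\<exists>z\<in>V. mat_pow V B m u z * mat_pow V B n z v > 0"
      then obtain z where "z \<in> V" "mat_pow V B m u z * mat_pow V B n z v > 0" by blast
      then show "0 < (\<Sum>z\<in>V. mat_pow V B m u z * mat_pow V B n z v)" using V terms by (intro sum_pos2)
    qed
    moreover have "mat_pow V B m u z * mat_pow V B n z v > 0 \<longleftrightarrow> mat_pow V B m u z > 0 \<and> mat_pow V B n z v > 0" if "z \<in> V" for z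
      using nn[OF that, of m u] nn[OF \<open>v \<in> V\<close>, of n z] by (auto simp: zero_less_mult_iff)
    ultimately show ?thesis by blast
  qed
  have pat_add: "pat (m + n) = pat m O pat n" for m n
    using pos_iff by (auto simp: pat_def relcomp_unfold)
  have "finite (range pat)"
  proof (rule finite_subset)
    show "range pat \<subseteq> Pow (V \<times> V)" by (auto simp: pat_def)
  qed (use V in auto)
  then have "\<not> inj pat" using finite_imageD infinite_UNIV_nat by blast
  then obtain i j where "pat i = pat j" "i \<noteq> j" by (auto simp: inj_def)
  then obtain i q where q: "q > 0" and per: "pat i = pat (i + q)"
    by (metis less_imp_add_positive linorder_neqE_nat)
  have per': "pat (i + m) = pat (i + m + q)" for m
    using per pat_add[of i m] pat_add[of "i + q" m] by (metis add.commute add.left_commute)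
  have per'': "pat (i + m) = pat (i + m + k * q)" for m k
  proof (induction k)
    case (Suc k)
    then show ?case using per'[of "m + k * q"] by (simp add: ac_simps)
  qed simp
  \<comment> \<open>A multiple of the period \<open>q\<close> that is not below the preperiod
    \<open>i\<close>; hence adding \<open>d\<close> once more leaves the pattern unchanged.\<close>
  define d where "d = (i + 1) * q"
  have "d \<ge> i" unfolding d_def using q by (cases q) auto
  then have "pat d = pat (d + d)" using per''[of "d - i" "i + 1"] by (simp add: d_def)
  moreover have "d > 0" unfolding d_def using q by simp
  moreover have "mat_pow V B d w v > 0 \<longleftrightarrow> mat_pow V B (d + d) w v > 0" if "w \<in> V" "v \<in> V" for w v
    using \<open>pat d = pat (d + d)\<close> that by (auto simp: pat_def set_eq_iff)
  ultimately show ?thesis using that[of d] pos_iff[of _ _ d d] by presburger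
qed

text \<open>Cut the sum into complete blocks of length \<open>d\<close> and a remainder of fewer
  than \<open>d\<close> bounded terms. Each residue contributes its own mean with weight
  \<open>1 / d\<close>, the limit of \<open>(N div d) / N\<close>.\<close>

lemma cesaro_residues:
  fixes s :: "nat \<Rightarrow> real"
  assumes d: "d > 0" and K: "\<And>n. \<bar>s n\<bar> \<le> K"
    and conv: "\<And>r. r < d \<Longrightarrow> convergent (\<lambda>N. (\<Sum>n<N. s (r + d * n)) / real N)"
  shows "convergent (\<lambda>N. (\<Sum>n<N. s n) / real N)"
proof -
  obtain c where c: "\<And>r. r < d \<Longrightarrow> (\<lambda>N. (\<Sum>n<N. s (r + d * n)) / real N) \<longlonglongrightarrow> c r"
    using conv unfolding convergent_def by metis
  have K0: "K \<ge> 0" using K[of 0] by simp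
  have split: "(\<Sum>n<N. s n) = (\<Sum>r<d. \<Sum>n<N div d. s (r + d * n)) + (\<Sum>n=N div d * d..<N. s n)" for N
  proof -
    have "(\<Sum>n<N. s n) = (\<Sum>n<N div d * d. s n) + (\<Sum>n=N div d * d..<N. s n)"
      using sum.atLeastLessThan_concat[of 0 "N div d * d" N s] by (simp add: atLeast0LessThan)
    also have "(\<Sum>n<N div d * d. s n) = (\<Sum>m<N div d. sum s {m * d..<m * d + d})" by (rule sum.nat_group[symmetric])
    also have "\<dots> = (\<Sum>m<N div d. \<Sum>r<d. s (r + d * m))"
    proof (rule sum.cong[OF refl])
      fix m
      have "sum s {m * d..<m * d + d} = sum s {0 + m * d..<d + m * d}" by (simp add: add.commute)
      also have "\<dots> = (\<Sum>r=0..<d. s (r + m * d))" by (rule sum.shift_bounds_nat_ivl)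
      finally show "sum s {m * d..<m * d + d} = (\<Sum>r<d. s (r + d * m))" by (simp add: atLeast0LessThan mult.commute)
    qed
    also have "\<dots> = (\<Sum>r<d. \<Sum>n<N div d. s (r + d * n))" by (rule sum.swap)
    finally show ?thesis .
  qed
  have top: "filterlim (\<lambda>N. N div d) at_top sequentially"
    using d by (intro filterlim_at_top[THEN iffD2] allI)
      (metis (mono_tags, lifting) eventually_sequentially div_le_mono nonzero_mult_div_cancel_right not_gr_zero)
  have ratio: "(\<lambda>N. real (N div d) / real N) \<longlonglongrightarrow> 1 / real d"
  proof (rule LIM_zero_cancel, rule Lim_null_comparison[where g="\<lambda>N. 1 / real N"])
    show "\<forall>\<^sub>F N in sequentially. norm (real (N div d) / real N - 1 / real d) \<le> 1 / real N"
      using eventually_gt_at_top[of 0]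
    proof eventually_elim
      case (elim N)
      have "real N = real d * real (N div d) + real (N mod d)" by (metis of_nat_add of_nat_mult mult_div_mod_eq)
      then have "real (N div d) / real N - 1 / real d = - (real (N mod d) / real d) / real N"
        using d elim by (simp add: field_simps)
      moreover have "real (N mod d) / real d \<le> 1" using d by (simp add: less_imp_le)
      then have "(real (N mod d) / real d) / real N \<le> 1 / real N" by (intro divide_right_mono) auto
      ultimately show ?case by (simp only: real_norm_def abs_minus_cancel minus_divide_left[symmetric]) simp
    qed
  qed (rule lim_1_over_n)
  have rest: "(\<lambda>N. (\<Sum>n=N div d * d..<N. s n) / real N) \<longlonglongrightarrow> 0"
  proof (rule Lim_null_comparison[where g="\<lambda>N. (K * real d) / real N"])
    show "\<forall>\<^sub>F N in sequentially. norm ((\<Sum>n=N div d * d..<N. s n) / real N) \<le> (K * real d) / real N"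
    proof (rule always_eventually, rule allI)
      fix N
      have "\<bar>\<Sum>n=N div d * d..<N. s n\<bar> \<le> (\<Sum>n=N div d * d..<N. K)" by (rule order_trans[OF sum_abs sum_mono]) (rule K)
      also have "\<dots> = real (N mod d) * K" by (simp add: minus_div_mult_eq_mod[symmetric])
      also have "\<dots> \<le> real d * K" using d K0 by (intro mult_right_mono) (auto intro: less_imp_le)
      finally show "norm ((\<Sum>n=N div d * d..<N. s n) / real N) \<le> (K * real d) / real N"
        by (simp add: abs_divide divide_right_mono mult.commute)
    qed
    show "(\<lambda>N. (K * real d) / real N) \<longlonglongrightarrow> 0"
      by (intro tendsto_divide_0[OF tendsto_const] filterlim_at_top_imp_at_infinity filterlim_real_sequentially)
  qed
  have "(\<lambda>N. (\<Sum>r<d. (\<Sum>n<N div d. s (r + d * n)) / real (N div d) * (real (N div d) / real N))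
      + (\<Sum>n=N div d * d..<N. s n) / real N) \<longlonglongrightarrow> (\<Sum>r<d. c r * (1 / real d)) + 0"
    by (intro tendsto_add tendsto_sum tendsto_mult ratio rest filterlim_compose[OF c top]) auto
  then have "(\<lambda>N. (\<Sum>n<N. s n) / real N) \<longlonglongrightarrow> (\<Sum>r<d. c r * (1 / real d)) + 0"
  proof (rule Lim_transform_eventually, use eventually_ge_at_top[of d] in eventually_elim)
    case (elim N)
    then have "N div d > 0" using d by (simp add: div_greater_zero_iff)
    then have "(\<Sum>r<d. X r / real (N div d) * (real (N div d) / real N)) = (\<Sum>r<d. X r) / real N" for X :: "nat \<Rightarrow> real"
      by (simp add: sum_divide_distrib)
    then show ?case unfolding split by (simp only: add_divide_distrib)
  qed
  then show ?thesis by (rule convergentI)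
qed

section \<open>Path averages in a digraph\<close>

definition arcs_between :: "('a, 'b) pre_digraph \<Rightarrow> 'a \<Rightarrow> 'a \<Rightarrow> 'b set" where
  "arcs_between G w v = {e \<in> arcs G. tail G e = w \<and> head G e = v}"

definition arc_op :: "('a, 'b) pre_digraph \<Rightarrow> ('b \<Rightarrow> 'x \<Rightarrow> 'x) \<Rightarrow> 'a \<Rightarrow> 'a \<Rightarrow> ('x \<Rightarrow> real) \<Rightarrow> 'x \<Rightarrow> real" where
  "arc_op G T w v f x = (\<Sum>e\<in>arcs_between G w v. f (T e x))"

lemma path_map_snoc: "path_map T (l @ [e]) x = path_map T l (T e x)"
  by (induction l) (auto simp: path_map_def)

lemma mpt_path_map:
  assumes "\<And>e. e \<in> set l \<Longrightarrow> mpt M (T e)" shows "mpt M (path_map T l)"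
  using assms
proof (induction l)
  case Nil
  have "distr M M (\<lambda>x. x) = M" by (rule distr_id)
  then show ?case by (simp add: path_map_def mpt_def id_def)
next
  case (Cons e l)
  have eq: "path_map T (e # l) = T e \<circ> path_map T l" by (simp add: path_map_def)
  have 1: "T e \<in> M \<rightarrow>\<^sub>M M" "distr M M (T e) = M" using Cons.prems[of e] by (auto simp: mpt_def)
  have 2: "path_map T l \<in> M \<rightarrow>\<^sub>M M" "distr M M (path_map T l) = M" using Cons by (auto simp: mpt_def)
  show ?case unfolding mpt_def eq using 1 2 distr_distr[OF 1(1) 2(1)] by (auto intro: measurable_comp)
qed

lemma paths_uv_arcs: "l \<in> paths_uv G u v n \<Longrightarrow> set l \<subseteq> arcs G"
  by (auto simp: paths_uv_def pre_digraph.awalk_def)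

lemma finite_paths_uv:
  assumes "fin_digraph G" shows "finite (paths_uv G u v n)"
proof (rule finite_subset)
  show "paths_uv G u v n \<subseteq> {l. set l \<subseteq> arcs G \<and> length l = n}"
    using paths_uv_arcs[of _ G u v n] by (auto simp: paths_uv_def)
  show "finite {l. set l \<subseteq> arcs G \<and> length l = n}"
    using assms by (intro finite_lists_length_eq) (simp add: fin_digraph_def fin_digraph_axioms_def)
qed

lemma sum_paths_uv_Suc:
  fixes F :: "'b list \<Rightarrow> real"
  assumes G: "fin_digraph G"
  shows "(\<Sum>l\<in>paths_uv G u v (Suc n). F l) =
    (\<Sum>z\<in>verts G. \<Sum>e\<in>arcs_between G z v. \<Sum>l\<in>paths_uv G u z n. F (l @ [e]))"
proof -
  interpret fin_digraph G by fact
  have fin: "finite (arcs_between G z w)" for z w by (simp add: arcs_between_def)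
  have "(\<Sum>z\<in>verts G. \<Sum>e\<in>arcs_between G z v. \<Sum>l\<in>paths_uv G u z n. F (l @ [e])) =
     (\<Sum>(z, e, l)\<in>(SIGMA z:verts G. arcs_between G z v \<times> paths_uv G u z n). F (l @ [e]))"
    using finite_paths_uv[OF G] fin by (simp add: sum.Sigma sum.cartesian_product split_beta)
  also have "\<dots> = (\<Sum>l\<in>paths_uv G u v (Suc n). F l)"
  proof (rule sum.reindex_bij_witness[of _ "\<lambda>l. (tail G (last l), last l, butlast l)" "\<lambda>(z, e, l). l @ [e]"])
    fix l assume "l \<in> paths_uv G u v (Suc n)"
    then have l: "awalk u l v" "length l = Suc n" by (auto simp: paths_uv_def)
    then have eq: "l = butlast l @ [last l]" by (metis append_butlast_last_id length_0_conv nat.distinct(1))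
    then have "awalk u (butlast l @ [last l]) v" using l by simp
    then obtain z where z: "awalk u (butlast l) z" "awalk z [last l] v" by (auto simp only: awalk_append_iff)
    then show "(tail G (last l), last l, butlast l) \<in> (SIGMA z:verts G. arcs_between G z v \<times> paths_uv G u z n)"
      using l by (auto simp: awalk_Cons_iff awalk_Nil_iff paths_uv_def arcs_between_def)
    show "(case (tail G (last l), last l, butlast l) of (z, e, l) \<Rightarrow> l @ [e]) = l" using eq by simp
  next
    fix a assume "a \<in> (SIGMA z:verts G. arcs_between G z v \<times> paths_uv G u z n)"
    then obtain z e l where a: "a = (z, e, l)" "z \<in> verts G" "e \<in> arcs_between G z v" "l \<in> paths_uv G u z n" by auto
    then show "(case a of (z, e, l) \<Rightarrow> l @ [e]) \<in> paths_uv G u v (Suc n)"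
      by (auto simp: paths_uv_def arcs_between_def awalk_Cons_iff awalk_Nil_iff)
    show "(tail G (last (case a of (z, e, l) \<Rightarrow> l @ [e])), last (case a of (z, e, l) \<Rightarrow> l @ [e]),
        butlast (case a of (z, e, l) \<Rightarrow> l @ [e])) = a"
      using a by (auto simp: arcs_between_def)
    show "F (case a of (z, e, l) \<Rightarrow> l @ [e]) = (case a of (z, e, l) \<Rightarrow> F (l @ [e]))" using a by simp
  qed
  finally show ?thesis by simp
qed

lemma paths_uv_0:
  assumes "fin_digraph G" "u \<in> verts G" shows "paths_uv G u v 0 = (if u = v then {[]} else {})"
proof -
  interpret fin_digraph G by fact
  show ?thesis using assms by (auto simp: paths_uv_def awalk_Nil_iff)
qed

lemma op_pow_paths:
  assumes G: "fin_digraph G" and u: "u \<in> verts G"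
  shows "op_pow (verts G) (arc_op G T) n u v f x = (\<Sum>l\<in>paths_uv G u v n. f (path_map T l x))"
proof (induction n arbitrary: v x)
  case 0
  then show ?case by (auto simp: paths_uv_0[OF G u] path_map_def)
next
  case (Suc n)
  show ?case unfolding sum_paths_uv_Suc[OF G] path_map_snoc Suc[symmetric]
    by (simp only: op_pow.simps arc_op_def[of G T _ v _ x])
qed

lemma mat_pow_paths:
  assumes G: "fin_digraph G" and u: "u \<in> verts G"
  shows "mat_pow (verts G) (\<lambda>w v. real (card (arcs_between G w v))) n u v = real (card (paths_uv G u v n))"
proof (induction n arbitrary: v)
  case 0
  then show ?case by (auto simp: paths_uv_0[OF G u])
next
  case (Suc n)
  have "real (card (paths_uv G u v (Suc n))) = (\<Sum>l\<in>paths_uv G u v (Suc n). 1)" by simp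
  then show ?case unfolding sum_paths_uv_Suc[OF G] by (simp add: Suc mult.commute)
qed

lemma pos_op_arc_op:
  assumes M: "finite_measure M" and T: "\<And>e. e \<in> arcs G \<Longrightarrow> mpt M (T e)"
  shows "pos_op M (real (card (arcs_between G w v))) (arc_op G T w v)"
proof -
  have "pos_op M (\<Sum>e\<in>arcs_between G w v. 1) (\<lambda>f x. \<Sum>e\<in>arcs_between G w v. f (T e x))"
    by (intro pos_op_sum_op[OF M] pos_op_mpt[OF M] T) (simp add: arcs_between_def)
  then show ?thesis by (simp add: arc_op_def[abs_def])
qed

text \<open>The set \<open>W\<close> of admissible endpoints unifies the two kinds of averages:
  \<open>{v}\<close> for one, all vertices for the other. The union is disjoint since a path from
  \<open>u\<close> determines its endpoint, and division by zero matches the value 0 for an empty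
  set of paths.\<close>

lemma avg_op_Union_paths:
  assumes G: "fin_digraph G" and W: "W \<subseteq> verts G"
  shows "avg_op T (\<Union>v\<in>W. paths_uv G u v n) f x =
    (\<Sum>v\<in>W. \<Sum>l\<in>paths_uv G u v n. f (path_map T l x)) / (\<Sum>v\<in>W. real (card (paths_uv G u v n)))"
proof -
  interpret fin_digraph G by fact
  have fW: "finite W" using W finite_subset finite_verts by blast
  have dis: "\<forall>v\<in>W. \<forall>v'\<in>W. v \<noteq> v' \<longrightarrow> paths_uv G u v n \<inter> paths_uv G u v' n = {}"
  proof (intro ballI impI)
    fix v v' assume "v \<in> W" "v' \<in> W" "v \<noteq> v'"
    show "paths_uv G u v n \<inter> paths_uv G u v' n = {}"
    proof (rule ccontr)
      assume "\<not> ?thesis"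
      then obtain l where "awalk u l v" "awalk u l v'" by (auto simp: paths_uv_def)
      then show False using awalk_ends[of u l v u v'] \<open>v \<noteq> v'\<close> by (auto simp: awalk_Nil_iff)
    qed
  qed
  have "real (card (\<Union>v\<in>W. paths_uv G u v n)) = (\<Sum>v\<in>W. real (card (paths_uv G u v n)))"
    using card_UN_disjoint[OF fW _ dis] finite_paths_uv[OF G] by simp
  moreover have "(\<Sum>l\<in>(\<Union>v\<in>W. paths_uv G u v n). f (path_map T l x)) = (\<Sum>v\<in>W. \<Sum>l\<in>paths_uv G u v n. f (path_map T l x))"
    using sum.UNION_disjoint[OF fW _ dis] finite_paths_uv[OF G] by blast
  ultimately show ?thesis by (auto simp: avg_op_def)
qed

lemma avg_op_bounded:
  assumes K: "\<And>x. \<bar>f x\<bar> \<le> K" shows "\<bar>avg_op T L f x\<bar> \<le> K"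
proof (cases "L = {} \<or> infinite L")
  case True
  then have "avg_op T L f x = 0" by (auto simp: avg_op_def)
  moreover have "0 \<le> K" using K[of undefined] by simp
  ultimately show ?thesis by simp
next
  case False
  then have c: "card L > 0" by (simp add: card_gt_0_iff)
  have "\<bar>\<Sum>l\<in>L. f (path_map T l x)\<bar> \<le> (\<Sum>l\<in>L. K)" by (rule order_trans[OF sum_abs sum_mono]) (rule K)
  then show ?thesis using False c by (simp add: avg_op_def abs_mult field_simps)
qed

text \<open>Along \<open>n = r + d * i\<close> the path sums form an orbit of the
  \<open>d\<close>-th power of the arc operators, starting from the paths of length
  \<open>r\<close>. Numerator and denominator are summed over \<open>W\<close> separately, and only
  then is the ratio taken; hence the pairing of functions and counts in
  \<open>cesaro_regular\<close>.\<close>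

lemma AE_convergent_avg_bounded:
  assumes G: "fin_digraph G" and M: "prob_space M" and T: "\<And>e. e \<in> arcs G \<Longrightarrow> mpt M (T e)"
    and u: "u \<in> verts G" and W: "W \<subseteq> verts G" and f: "bmf M f"
  shows "AE x in M. convergent (\<lambda>N. (1 / real N) * (\<Sum>n<N. avg_op T (\<Union>v\<in>W. paths_uv G u v n) f x))"
proof -
  interpret fin_digraph G by fact
  interpret M: prob_space M by fact
  have fm: "finite_measure M" by unfold_locales
  define V where "V = verts G"
  define B where "B w v = real (card (arcs_between G w v))" for w v
  have V: "finite V" by (simp add: V_def)
  have uV: "u \<in> V" using u by (simp add: V_def)
  have A: "pos_op M (B w v) (arc_op G T w v)" for w v unfolding B_def by (rule pos_op_arc_op[OF fm T])
  obtain d where d: "d > 0" and idem: "\<And>w v. w \<in> V \<Longrightarrow> v \<in> V \<Longrightarrow>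
      mat_pow V B d w v > 0 \<longleftrightarrow> (\<exists>z\<in>V. mat_pow V B d w z > 0 \<and> mat_pow V B d z v > 0)"
    using idempotent_pattern[OF V, of B] by (metis B_def of_nat_0_le_iff)
  obtain K where K: "\<And>x. \<bar>f x\<bar> \<le> K" using f by (meson bmfE)
  have O: "pos_op M (mat_pow V B n w v) (op_pow V (arc_op G T) n w v)" if "v \<in> V" for n w v
    by (rule pos_op_op_pow[OF fm A that])
  have cesaro_regular_r: "cesaro_regular M (\<lambda>n. op_pow V (arc_op G T) (r + d * n) u v f) (\<lambda>n. mat_pow V B (r + d * n) u v)" if v: "v \<in> V" for r v
  proof (rule cesaro_regular_matrix_orbit[where V=V and A="op_pow V (arc_op G T) d" and B="mat_pow V B d" and K=K
        and x="\<lambda>n v. op_pow V (arc_op G T) (r + d * n) u v f" and a="\<lambda>n v. mat_pow V B (r + d * n) u v", OF M V O idem])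
    fix n v y assume v: "v \<in> V"
    have eq: "r + d * Suc n = (r + d * n) + d" by simp
    show "op_pow V (arc_op G T) (r + d * Suc n) u v f y = (\<Sum>w\<in>V. op_pow V (arc_op G T) d w v (op_pow V (arc_op G T) (r + d * n) u w f) y)"
      unfolding eq by (rule op_pow_add[OF fm V A v])
    show "mat_pow V B (r + d * Suc n) u v = (\<Sum>w\<in>V. mat_pow V B d w v * mat_pow V B (r + d * n) u w)"
      unfolding eq mat_pow_add[OF V uV v] by (simp add: mult.commute)
  next
    fix v y assume v: "v \<in> V"
    show "op_pow V (arc_op G T) (r + d * 0) u v f \<in> borel_measurable M"
      by (rule pos_op_measurable[OF O[OF v] bmf_measurable[OF f]])
    show "\<bar>op_pow V (arc_op G T) (r + d * 0) u v f y\<bar> \<le> K * mat_pow V B (r + d * 0) u v"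
      using pos_op_abs_le[OF O[OF v] K] by (simp add: mult.commute)
    show "0 \<le> mat_pow V B (r + d * 0) u v" by (rule pos_op_factor_nonneg[OF O[OF v]])
  qed (use v in auto)
  define s where "s n x = avg_op T (\<Union>v\<in>W. paths_uv G u v n) f x" for n x
  have s_eq: "s n x = (\<Sum>v\<in>W. op_pow V (arc_op G T) n u v f x) / (\<Sum>v\<in>W. mat_pow V B n u v)" for n x
    unfolding s_def avg_op_Union_paths[OF G W] V_def B_def op_pow_paths[OF G u] mat_pow_paths[OF G u] ..
  have "AE x in M. convergent (\<lambda>N. (\<Sum>n<N. s (r + d * n) x) / real N)" for r
    unfolding s_eq by (rule cesaro_regular_ratio_mean, rule cesaro_regular_sum, rule cesaro_regular_r) (use W in \<open>auto simp: V_def\<close>)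
  then have "AE x in M. \<forall>r. convergent (\<lambda>N. (\<Sum>n<N. s (r + d * n) x) / real N)"
    unfolding AE_all_countable by blast
  then show ?thesis
  proof eventually_elim
    case (elim x)
    have "convergent (\<lambda>N. (\<Sum>n<N. s n x) / real N)"
      by (rule cesaro_residues[OF d]) (use elim avg_op_bounded[OF K] in \<open>auto simp: s_def\<close>)
    then show ?case by (simp add: s_def)
  qed
qed

text \<open>Truncation changes an essentially bounded function only on a null set. The path maps are
  measure preserving and countable in number, so for almost every point no path leads into that
  set.\<close>

lemma AE_convergent_avg:
  assumes G: "fin_digraph G" and M: "prob_space M" and T: "\<And>e. e \<in> arcs G \<Longrightarrow> mpt M (T e)"
    and u: "u \<in> verts G" and W: "W \<subseteq> verts G" and f: "in_Linf M f"
  shows "AE x in M. convergent (\<lambda>N. (1 / real N) * (\<Sum>n<N. avg_op T (\<Union>v\<in>W. paths_uv G u v n) f x))"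
proof -
  interpret fin_digraph G by fact
  obtain K where K: "AE x in M. \<bar>f x\<bar> \<le> K" and [measurable]: "f \<in> borel_measurable M"
    using f by (auto simp: in_Linf_def)
  define g where "g x = max (- \<bar>K\<bar>) (min \<bar>K\<bar> (f x))" for x
  have g: "bmf M g" by (rule bmfI[where K="\<bar>K\<bar>"]) (auto simp: g_def[abs_def])
  have [measurable]: "g \<in> borel_measurable M" using g by (rule bmf_measurable)
  have fg: "AE x in M. f x = g x" using K by eventually_elim (auto simp: g_def)
  have "AE x in M. \<forall>n. \<forall>l\<in>(\<Union>v\<in>W. paths_uv G u v n). f (path_map T l x) = g (path_map T l x)"
    unfolding AE_all_countable
  proof (intro allI AE_finite_allI)
    fix n l assume l: "l \<in> (\<Union>v\<in>W. paths_uv G u v n)"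
    have "mpt M (path_map T l)" using l paths_uv_arcs[of l G u _ n] T by (intro mpt_path_map) blast
    then have m: "path_map T l \<in> M \<rightarrow>\<^sub>M M" "distr M M (path_map T l) = M" by (auto simp: mpt_def)
    from fg have "AE x in distr M M (path_map T l). f x = g x" by (simp only: m(2))
    then show "AE x in M. f (path_map T l x) = g (path_map T l x)" by (rule AE_distrD[OF m(1)])
  next
    fix n
    have "finite W" using W finite_subset finite_verts by blast
    then show "finite (\<Union>v\<in>W. paths_uv G u v n)" using finite_paths_uv[OF G] by blast
  qed
  moreover have "AE x in M. convergent (\<lambda>N. (1 / real N) * (\<Sum>n<N. avg_op T (\<Union>v\<in>W. paths_uv G u v n) g x))"
    by (rule AE_convergent_avg_bounded[OF G M T u W g])
  ultimately show ?thesis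
  proof eventually_elim
    case (elim x)
    have "avg_op T (\<Union>v\<in>W. paths_uv G u v n) f x = avg_op T (\<Union>v\<in>W. paths_uv G u v n) g x" for n
    proof -
      have "(\<Sum>l\<in>(\<Union>v\<in>W. paths_uv G u v n). f (path_map T l x)) = (\<Sum>l\<in>(\<Union>v\<in>W. paths_uv G u v n). g (path_map T l x))"
        by (rule sum.cong[OF refl]) (use elim(1) in blast)
      then show ?thesis by (simp add: avg_op_def)
    qed
    then show ?case using elim(2) by simp
  qed
qed

section \<open>Convergence in the mean of order p\<close>

text \<open>The supporting line of the convex power function at \<open>s\<close>. Convexity is used
  on the open half-line, so \<open>t = 0\<close> is computed directly.\<close>

lemma powr_tangent:
  fixes p s t :: real
  assumes p: "p \<ge> 1" and s: "s > 0" and t: "t \<ge> 0"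
  shows "s powr p + p * s powr (p - 1) * (t - s) \<le> t powr p"
proof (cases "t = 0")
  case True
  have "s powr (p - 1) * s = s powr p" using s by (simp add: powr_mult_base mult.commute)
  then have "s powr p + p * s powr (p - 1) * (t - s) = s powr p * (1 - p)" using True by (simp add: algebra_simps)
  also have "\<dots> \<le> 0" using p by (intro mult_nonneg_nonpos) auto
  finally show ?thesis using True by simp
next
  case False
  have "((\<lambda>x. x powr p) has_real_derivative p * s powr (p - 1)) (at s within {0<..})"
    using s by (auto intro!: derivative_eq_intros)
  from convex_on_imp_above_tangent[OF powr_convex[OF p] _ _ _ this, of t] show ?thesis
    using s t False by (simp add: interior_open)
qed

text \<open>Jensen's inequality for weights of total mass \<open>W \<le> 1\<close>, from the tangent
  at the weighted sum \<open>s\<close>. A deficit in mass is allowed because empty path sets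
  contribute 0; it is absorbed by \<open>1 \<le> W + p * (1 - W)\<close>.\<close>

lemma powr_sum_le:
  fixes p :: real and w t :: "'i \<Rightarrow> real"
  assumes p: "p \<ge> 1" and I: "finite I" and w: "\<And>i. i \<in> I \<Longrightarrow> 0 \<le> w i" "(\<Sum>i\<in>I. w i) \<le> 1"
    and t: "\<And>i. i \<in> I \<Longrightarrow> 0 \<le> t i"
  shows "(\<Sum>i\<in>I. w i * t i) powr p \<le> (\<Sum>i\<in>I. w i * t i powr p)"
proof -
  define s where "s = (\<Sum>i\<in>I. w i * t i)"
  define W where "W = (\<Sum>i\<in>I. w i)"
  have s0: "s \<ge> 0" unfolding s_def using w t by (intro sum_nonneg) auto
  show ?thesis
  proof (cases "s = 0")
    case True
    then show ?thesis using w by (simp add: s_def[symmetric] sum_nonneg)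
  next
    case False
    then have s: "s > 0" using s0 by simp
    have "s powr p \<le> s powr p * (W + p * (1 - W))"
    proof -
      have "1 * (1 - W) \<le> p * (1 - W)" using p w(2) by (intro mult_right_mono) (auto simp: W_def)
      then have "1 \<le> W + p * (1 - W)" by simp
      then show ?thesis using mult_left_mono[of 1 _ "s powr p"] by simp
    qed
    also have "\<dots> = W * s powr p + p * s powr (p - 1) * (s - W * s)"
    proof -
      have "s powr (p - 1) * s = s powr p" using s by (simp add: powr_mult_base mult.commute)
      then have "p * s powr (p - 1) * (s - W * s) = p * (1 - W) * s powr p" by (simp add: algebra_simps)
      then show ?thesis by (simp add: algebra_simps)
    qed
    also have "\<dots> = (\<Sum>i\<in>I. w i * (s powr p + p * s powr (p - 1) * (t i - s)))"
    proof -
      have "(\<Sum>i\<in>I. w i * (s powr p + p * s powr (p - 1) * (t i - s))) =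
          (\<Sum>i\<in>I. w i * s powr p + (p * s powr (p - 1)) * (w i * t i - w i * s))"
        by (intro sum.cong refl) (simp add: algebra_simps)
      also have "\<dots> = W * s powr p + p * s powr (p - 1) * (s - W * s)"
        by (simp only: sum.distrib sum_distrib_right[symmetric] sum_distrib_left[symmetric] sum_subtractf s_def[symmetric] W_def[symmetric])
      finally show ?thesis by simp
    qed
    also have "\<dots> \<le> (\<Sum>i\<in>I. w i * t i powr p)"
      by (intro sum_mono mult_left_mono powr_tangent[OF p s] t w)
    finally show ?thesis by (simp add: s_def)
  qed
qed

text \<open>This stands in for Minkowski's inequality: only convergence of \<open>p\<close>-th
  moments to 0 is tracked, so a factor \<open>2 powr p\<close> does no harm.\<close>

lemma powr_abs_add_le:
  fixes a b p :: real assumes "p \<ge> 0"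
  shows "\<bar>a + b\<bar> powr p \<le> 2 powr p * (\<bar>a\<bar> powr p + \<bar>b\<bar> powr p)"
proof -
  have "\<bar>a + b\<bar> powr p \<le> (2 * max \<bar>a\<bar> \<bar>b\<bar>) powr p" using assms by (intro powr_mono2) auto
  also have "\<dots> = 2 powr p * (max \<bar>a\<bar> \<bar>b\<bar>) powr p" by (simp add: powr_mult)
  also have "\<dots> \<le> 2 powr p * (\<bar>a\<bar> powr p + \<bar>b\<bar> powr p)"
    by (intro mult_left_mono) (auto simp: max_def)
  finally show ?thesis .
qed

lemma in_Lp_add:
  fixes f g :: "'x \<Rightarrow> real"
  assumes p: "p \<ge> 0" and f: "in_Lp M p f" and g: "in_Lp M p g"
  shows "in_Lp M p (\<lambda>x. f x + g x)"
    "(\<integral>x. \<bar>f x + g x\<bar> powr p \<partial>M) \<le> 2 powr p * ((\<integral>x. \<bar>f x\<bar> powr p \<partial>M) + (\<integral>x. \<bar>g x\<bar> powr p \<partial>M))"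
proof -
  have [measurable]: "f \<in> borel_measurable M" "g \<in> borel_measurable M" using f g by (auto simp: in_Lp_def)
  have i: "integrable M (\<lambda>x. 2 powr p * (\<bar>f x\<bar> powr p + \<bar>g x\<bar> powr p))" using f g by (auto simp: in_Lp_def)
  have j: "integrable M (\<lambda>x. \<bar>f x + g x\<bar> powr p)"
    by (rule Bochner_Integration.integrable_bound[OF i]) (auto intro: powr_abs_add_le[OF p])
  show "in_Lp M p (\<lambda>x. f x + g x)" using j by (simp add: in_Lp_def)
  have "(\<integral>x. \<bar>f x + g x\<bar> powr p \<partial>M) \<le> (\<integral>x. 2 powr p * (\<bar>f x\<bar> powr p + \<bar>g x\<bar> powr p) \<partial>M)"
    by (intro integral_mono j i powr_abs_add_le[OF p])
  then show "(\<integral>x. \<bar>f x + g x\<bar> powr p \<partial>M) \<le> 2 powr p * ((\<integral>x. \<bar>f x\<bar> powr p \<partial>M) + (\<integral>x. \<bar>g x\<bar> powr p \<partial>M))"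
    using f g by (simp add: in_Lp_def)
qed

lemma in_Lp_uminus: "in_Lp M p f \<Longrightarrow> in_Lp M p (\<lambda>x. - f x)"
  by (simp add: in_Lp_def)

lemma in_Lp_diff:
  assumes "p \<ge> 0" "in_Lp M p f" "in_Lp M p g" shows "in_Lp M p (\<lambda>x. f x - g x)"
  using in_Lp_add(1)[OF assms(1,2) in_Lp_uminus[OF assms(3)]] by simp

lemma in_Lp_bmf:
  assumes "finite_measure M" "p \<ge> 0" "bmf M f" shows "in_Lp M p f"
proof -
  obtain K where K: "\<And>x. \<bar>f x\<bar> \<le> K" using assms by (meson bmfE)
  have [measurable]: "f \<in> borel_measurable M" using assms(3) by (rule bmf_measurable)
  have "bmf M (\<lambda>x. \<bar>f x\<bar> powr p)" by (rule bmfI[where K="K powr p"]) (auto intro!: powr_mono2 assms K)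
  then show ?thesis unfolding in_Lp_def using bmf_integrable[OF assms(1)] by auto
qed

lemma in_Lp_dominated:
  assumes p: "p \<ge> 0" and f: "in_Lp M p f" and g: "g \<in> borel_measurable M" and le: "\<And>x. \<bar>g x\<bar> \<le> \<bar>f x\<bar>"
  shows "in_Lp M p g" "(\<integral>x. \<bar>g x\<bar> powr p \<partial>M) \<le> (\<integral>x. \<bar>f x\<bar> powr p \<partial>M)"
proof -
  have le': "\<bar>g x\<bar> powr p \<le> \<bar>f x\<bar> powr p" for x using le[of x] p by (simp add: powr_mono2)
  have i: "integrable M (\<lambda>x. \<bar>g x\<bar> powr p)"
  proof (rule Bochner_Integration.integrable_bound)
    show "integrable M (\<lambda>x. \<bar>f x\<bar> powr p)" using f by (simp add: in_Lp_def)
    show "(\<lambda>x. \<bar>g x\<bar> powr p) \<in> borel_measurable M" using g by measurable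
    show "AE x in M. norm (\<bar>g x\<bar> powr p) \<le> norm (\<bar>f x\<bar> powr p)" using le' by simp
  qed
  then show "in_Lp M p g" using g by (simp add: in_Lp_def)
  show "(\<integral>x. \<bar>g x\<bar> powr p \<partial>M) \<le> (\<integral>x. \<bar>f x\<bar> powr p \<partial>M)"
    using f i by (intro integral_mono le') (auto simp: in_Lp_def)
qed

lemma Lp_convergent_diff:
  assumes p: "p \<ge> 0" and F: "\<And>N. in_Lp M p (F N)" and G: "\<And>N. in_Lp M p (G N)"
    and "Lp_convergent M p F" "Lp_convergent M p G"
  shows "Lp_convergent M p (\<lambda>N x. F N x - G N x)"
proof -
  obtain f g where f: "in_Lp M p f" "(\<lambda>N. \<integral>x. \<bar>F N x - f x\<bar> powr p \<partial>M) \<longlonglongrightarrow> 0"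
    and g: "in_Lp M p g" "(\<lambda>N. \<integral>x. \<bar>G N x - g x\<bar> powr p \<partial>M) \<longlonglongrightarrow> 0"
    using assms by (auto simp: Lp_convergent_def)
  have "(\<lambda>N. 2 powr p * ((\<integral>x. \<bar>F N x - f x\<bar> powr p \<partial>M) + (\<integral>x. \<bar>G N x - g x\<bar> powr p \<partial>M))) \<longlonglongrightarrow> 2 powr p * (0 + 0)"
    by (intro tendsto_mult tendsto_add tendsto_const f g)
  then have lim: "(\<lambda>N. 2 powr p * ((\<integral>x. \<bar>F N x - f x\<bar> powr p \<partial>M) + (\<integral>x. \<bar>G N x - g x\<bar> powr p \<partial>M))) \<longlonglongrightarrow> 0" by simp
  have "(\<lambda>N. \<integral>x. \<bar>(F N x - G N x) - (f x - g x)\<bar> powr p \<partial>M) \<longlonglongrightarrow> 0"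
  proof (rule tendsto_sandwich[OF _ _ tendsto_const lim])
    show "\<forall>\<^sub>F N in sequentially. (\<integral>x. \<bar>(F N x - G N x) - (f x - g x)\<bar> powr p \<partial>M)
       \<le> 2 powr p * ((\<integral>x. \<bar>F N x - f x\<bar> powr p \<partial>M) + (\<integral>x. \<bar>G N x - g x\<bar> powr p \<partial>M))"
    proof (rule always_eventually, rule allI)
      fix N
      have "(\<integral>x. \<bar>(F N x - f x) + (g x - G N x)\<bar> powr p \<partial>M)
         \<le> 2 powr p * ((\<integral>x. \<bar>F N x - f x\<bar> powr p \<partial>M) + (\<integral>x. \<bar>g x - G N x\<bar> powr p \<partial>M))"
        by (intro in_Lp_add[OF p] in_Lp_diff[OF p] F G f g)
      moreover have "(F N x - f x) + (g x - G N x) = (F N x - G N x) - (f x - g x)" for x by simp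
      ultimately show "(\<integral>x. \<bar>(F N x - G N x) - (f x - g x)\<bar> powr p \<partial>M)
         \<le> 2 powr p * ((\<integral>x. \<bar>F N x - f x\<bar> powr p \<partial>M) + (\<integral>x. \<bar>G N x - g x\<bar> powr p \<partial>M))"
        by (simp add: abs_minus_commute)
    qed
  qed simp
  then show ?thesis using in_Lp_diff[OF p f(1) g(1)] by (auto simp: Lp_convergent_def)
qed

text \<open>The mean over lengths and the mean over paths of one length are merged into a single
  combination of Koopman operators, so that Jensen's inequality has to be applied only once.\<close>

locale mp_averages = prob_space M for M :: "'x measure" +
  fixes I :: "nat \<Rightarrow> 'i set" and w :: "nat \<Rightarrow> 'i \<Rightarrow> real" and \<tau> :: "'i \<Rightarrow> 'x \<Rightarrow> 'x"
  assumes fin: "finite (I N)" and w_nonneg: "i \<in> I N \<Longrightarrow> 0 \<le> w N i" and w_le: "(\<Sum>i\<in>I N. w N i) \<le> 1"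
    and mp: "i \<in> I N \<Longrightarrow> mpt M (\<tau> i)"
begin

definition av :: "nat \<Rightarrow> ('x \<Rightarrow> real) \<Rightarrow> 'x \<Rightarrow> real" where
  "av N f x = (\<Sum>i\<in>I N. w N i * f (\<tau> i x))"

lemma av_measurable: "f \<in> borel_measurable M \<Longrightarrow> av N f \<in> borel_measurable M"
  unfolding av_def[abs_def] using mp[of _ N]
  by (intro borel_measurable_sum borel_measurable_times borel_measurable_const) (auto simp: mpt_def intro: measurable_compose)

lemma av_diff: "av N (\<lambda>x. f x - g x) x = av N f x - av N g x"
  by (simp add: av_def right_diff_distrib sum_subtractf)

lemma av_mono: "(\<And>x. f x \<le> g x) \<Longrightarrow> av N f x \<le> av N g x"
  unfolding av_def by (intro sum_mono mult_left_mono w_nonneg)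

lemma av_abs: "\<bar>av N f x\<bar> \<le> av N (\<lambda>x. \<bar>f x\<bar>) x"
  unfolding av_def by (rule order_trans[OF sum_abs]) (simp add: abs_mult w_nonneg)

lemma av_abs_le:
  assumes K: "\<And>x. \<bar>f x\<bar> \<le> K" shows "\<bar>av N f x\<bar> \<le> K"
proof -
  have K0: "K \<ge> 0" using K[of undefined] by simp
  have "\<bar>av N f x\<bar> \<le> (\<Sum>i\<in>I N. w N i * K)"
    by (rule order_trans[OF av_abs]) (unfold av_def, intro sum_mono mult_left_mono w_nonneg K)
  also have "\<dots> \<le> 1 * K" unfolding sum_distrib_right[symmetric] by (intro mult_right_mono w_le K0)
  finally show ?thesis by simp
qed

lemma av_Lp:
  assumes p: "p \<ge> 1" and f: "in_Lp M p f"
  shows "in_Lp M p (av N f)" "(\<integral>x. \<bar>av N f x\<bar> powr p \<partial>M) \<le> (\<integral>x. \<bar>f x\<bar> powr p \<partial>M)"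
proof -
  have m: "\<tau> i \<in> M \<rightarrow>\<^sub>M M" "distr M M (\<tau> i) = M" if "i \<in> I N" for i using mp[OF that] by (auto simp: mpt_def)
  have fm: "f \<in> borel_measurable M" and fi: "integrable M (\<lambda>x. \<bar>f x\<bar> powr p)" using f by (auto simp: in_Lp_def)
  have i: "integrable M (\<lambda>x. \<bar>f (\<tau> i x)\<bar> powr p)" if "i \<in> I N" for i
    using integrable_distr[OF m(1)[OF that], of "\<lambda>x. \<bar>f x\<bar> powr p"] fi m(2)[OF that] by simp
  have e: "(\<integral>x. \<bar>f (\<tau> i x)\<bar> powr p \<partial>M) = (\<integral>x. \<bar>f x\<bar> powr p \<partial>M)" if "i \<in> I N" for i
    using integral_distr[OF m(1)[OF that], of "\<lambda>x. \<bar>f x\<bar> powr p"] fm m(2)[OF that] by simp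
  have iS: "integrable M (\<lambda>x. \<Sum>i\<in>I N. w N i * \<bar>f (\<tau> i x)\<bar> powr p)"
    by (intro Bochner_Integration.integrable_sum integrable_mult_right i)
  have le: "\<bar>av N f x\<bar> powr p \<le> (\<Sum>i\<in>I N. w N i * \<bar>f (\<tau> i x)\<bar> powr p)" for x
  proof -
    have "\<bar>av N f x\<bar> powr p \<le> (\<Sum>i\<in>I N. w N i * \<bar>f (\<tau> i x)\<bar>) powr p"
      using av_abs[of N f x] p by (intro powr_mono2) (auto simp: av_def)
    also have "\<dots> \<le> (\<Sum>i\<in>I N. w N i * \<bar>f (\<tau> i x)\<bar> powr p)"
      by (intro powr_sum_le p fin w_nonneg w_le) auto
    finally show ?thesis .
  qed
  have avm: "av N f \<in> borel_measurable M" by (rule av_measurable[OF fm])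
  have ia: "integrable M (\<lambda>x. \<bar>av N f x\<bar> powr p)"
    using avm by (intro Bochner_Integration.integrable_bound[OF iS] AE_I2)
      (auto intro!: order_trans[OF le] sum_nonneg mult_nonneg_nonneg w_nonneg)
  then show "in_Lp M p (av N f)" using avm by (simp add: in_Lp_def)
  have "(\<integral>x. \<bar>av N f x\<bar> powr p \<partial>M) \<le> (\<integral>x. (\<Sum>i\<in>I N. w N i * \<bar>f (\<tau> i x)\<bar> powr p) \<partial>M)"
    by (intro integral_mono ia iS le)
  also have "\<dots> = (\<Sum>i\<in>I N. w N i * (\<integral>x. \<bar>f x\<bar> powr p \<partial>M))"
    by (subst Bochner_Integration.integral_sum) (auto intro!: integrable_mult_right i simp: e)
  also have "\<dots> \<le> 1 * (\<integral>x. \<bar>f x\<bar> powr p \<partial>M)"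
    unfolding sum_distrib_right[symmetric] by (intro mult_right_mono w_le integral_nonneg_AE) auto
  finally show "(\<integral>x. \<bar>av N f x\<bar> powr p \<partial>M) \<le> (\<integral>x. \<bar>f x\<bar> powr p \<partial>M)" by simp
qed

text \<open>Nonnegativity makes the truncations \<open>t k\<close> increase, and with them the
  limits \<open>g k\<close> of their averages; this provides the candidate \<open>h\<close> as a
  monotone limit. The error of truncation is \<open>\<delta> j\<close> uniformly in
  \<open>N\<close>, since the averages contract the \<open>L\<^sup>p\<close> norm, so
  \<open>j\<close> can be fixed before \<open>N\<close> tends to infinity.\<close>

lemma Lp_convergent_av_nonneg:
  assumes bdd: "\<And>f. bmf M f \<Longrightarrow> AE x in M. convergent (\<lambda>N. av N f x)"
    and p: "p \<ge> 1" and f: "in_Lp M p f" and f0: "\<And>x. 0 \<le> f x"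
  shows "Lp_convergent M p (\<lambda>N. av N f)"
proof -
  have fm: "finite_measure M" by unfold_locales
  have p0: "p \<ge> 0" "p > 0" using p by auto
  have [measurable]: "f \<in> borel_measurable M" using f by (simp add: in_Lp_def)
  define t where "t k x = min (f x) (real k)" for k x
  have tm[measurable]: "t k \<in> borel_measurable M" for k unfolding t_def by measurable
  have tK: "\<bar>t k x\<bar> \<le> real k" for k x using f0[of x] by (auto simp: t_def)
  have avK: "\<bar>av N (t k) x\<bar> \<le> real k" for N k x using av_abs_le[of "t k" "real k" N x] tK by blast
  have t: "bmf M (t k)" for k by (rule bmfI[OF tm tK])
  have "\<forall>k. \<exists>g. bmf M g \<and> (\<forall>x. \<bar>g x\<bar> \<le> real k) \<and> (AE x in M. (\<lambda>N. av N (t k) x) \<longlonglongrightarrow> g x)"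
  proof
    fix k
    show "\<exists>g. bmf M g \<and> (\<forall>x. \<bar>g x\<bar> \<le> real k) \<and> (AE x in M. (\<lambda>N. av N (t k) x) \<longlonglongrightarrow> g x)"
      using AE_convergent_bmf[OF av_measurable[OF tm] avK bdd[OF t]] by metis
  qed
  then obtain g where g: "\<And>k. bmf M (g k)" "\<And>k x. \<bar>g k x\<bar> \<le> real k"
    and lim: "\<And>k. AE x in M. (\<lambda>N. av N (t k) x) \<longlonglongrightarrow> g k x" by metis
  have [measurable]: "g k \<in> borel_measurable M" for k using g(1) by (rule bmf_measurable)
  have avt[measurable]: "av N (t k) \<in> borel_measurable M" for N k by (rule av_measurable[OF tm])
  have gL: "in_Lp M p (g k)" and tL: "in_Lp M p (t k)" for k by (intro in_Lp_bmf[OF fm p0(1)] g t)+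
  have lim0: "(\<lambda>N. \<integral>x. \<bar>av N (t k) x - g k x\<bar> powr p \<partial>M) \<longlonglongrightarrow> 0" for k
  proof -
    have "(\<lambda>N. \<integral>x. \<bar>av N (t k) x - g k x\<bar> powr p \<partial>M) \<longlonglongrightarrow> (\<integral>x. 0 \<partial>M)"
    proof (rule integral_dominated_convergence[where w="\<lambda>_. (2 * real k) powr p"])
      show "AE x in M. (\<lambda>N. \<bar>av N (t k) x - g k x\<bar> powr p) \<longlonglongrightarrow> 0"
        using lim[of k]
      proof eventually_elim
        case (elim x)
        then have "(\<lambda>N. \<bar>av N (t k) x - g k x\<bar>) \<longlonglongrightarrow> 0" by (simp add: LIM_zero_iff tendsto_rabs_zero_iff)
        then show ?case by (intro tendsto_zero_powrI[OF _ tendsto_const]) (use p0 in auto)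
      qed
      show "AE x in M. norm (\<bar>av N (t k) x - g k x\<bar> powr p) \<le> (2 * real k) powr p" for N
      proof (rule AE_I2)
        fix x
        have "\<bar>av N (t k) x - g k x\<bar> \<le> 2 * real k"
          using avK[of N k x] g(2)[of k x] by linarith
        then show "norm (\<bar>av N (t k) x - g k x\<bar> powr p) \<le> (2 * real k) powr p" using p0 by (simp add: powr_mono2)
      qed
    qed auto
    then show ?thesis by simp
  qed
  define \<delta> where "\<delta> j = (\<integral>x. \<bar>f x - t j x\<bar> powr p \<partial>M)" for j
  have \<delta>_lim: "\<delta> \<longlonglongrightarrow> 0"
  proof -
    have "\<delta> \<longlonglongrightarrow> (\<integral>x. 0 \<partial>M)" unfolding \<delta>_def
    proof (rule integral_dominated_convergence[where w="\<lambda>x. \<bar>f x\<bar> powr p"])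
      show "AE x in M. (\<lambda>j. \<bar>f x - t j x\<bar> powr p) \<longlonglongrightarrow> 0"
      proof (rule AE_I2, rule tendsto_eventually)
        fix x
        obtain n where n: "f x \<le> real n" using real_arch_simple by blast
        show "\<forall>\<^sub>F j in sequentially. \<bar>f x - t j x\<bar> powr p = 0"
          using eventually_ge_at_top[of n]
        proof eventually_elim
          case (elim j)
          then have "t j x = f x" using n by (auto simp: t_def)
          then show ?case by simp
        qed
      qed
      show "AE x in M. norm (\<bar>f x - t j x\<bar> powr p) \<le> \<bar>f x\<bar> powr p" for j
        using f0 p0 by (intro AE_I2) (auto simp: t_def intro!: powr_mono2)
      show "integrable M (\<lambda>x. \<bar>f x\<bar> powr p)" using f by (simp add: in_Lp_def)
    qed auto
    then show ?thesis by simp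
  qed
  \<comment> \<open>The contraction estimate for \<open>t k - t j\<close> holds for every
    \<open>N\<close> and passes to the limit by dominated convergence.\<close>
  have g_dist: "(\<integral>x. \<bar>g k x - g j x\<bar> powr p \<partial>M) \<le> \<delta> j" if "j \<le> k" for j k
  proof (rule LIMSEQ_le_const2)
    show "(\<lambda>N. \<integral>x. \<bar>av N (t k) x - av N (t j) x\<bar> powr p \<partial>M) \<longlonglongrightarrow> (\<integral>x. \<bar>g k x - g j x\<bar> powr p \<partial>M)"
    proof (rule integral_dominated_convergence[where w="\<lambda>_. (real k + real j) powr p"])
      show "AE x in M. (\<lambda>N. \<bar>av N (t k) x - av N (t j) x\<bar> powr p) \<longlonglongrightarrow> \<bar>g k x - g j x\<bar> powr p"
        using lim[of k] lim[of j]
      proof eventually_elim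
        case (elim x)
        show ?case by (intro tendsto_powr' tendsto_rabs tendsto_diff elim tendsto_const) (use p0 in auto)
      qed
      show "AE x in M. norm (\<bar>av N (t k) x - av N (t j) x\<bar> powr p) \<le> (real k + real j) powr p" for N
      proof (rule AE_I2)
        fix x
        have "\<bar>av N (t k) x - av N (t j) x\<bar> \<le> real k + real j"
          using avK[of N k x] avK[of N j x] by linarith
        then show "norm (\<bar>av N (t k) x - av N (t j) x\<bar> powr p) \<le> (real k + real j) powr p" using p0 by (simp add: powr_mono2)
      qed
    qed auto
    show "\<exists>N0. \<forall>N\<ge>N0. (\<integral>x. \<bar>av N (t k) x - av N (t j) x\<bar> powr p \<partial>M) \<le> \<delta> j"
    proof (intro exI allI impI)
      fix N
      have "(\<integral>x. \<bar>av N (\<lambda>x. t k x - t j x) x\<bar> powr p \<partial>M) \<le> (\<integral>x. \<bar>t k x - t j x\<bar> powr p \<partial>M)"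
        by (intro av_Lp p in_Lp_diff p0 tL)
      also have "\<dots> \<le> (\<integral>x. \<bar>f x - t j x\<bar> powr p \<partial>M)"
        using that f0 by (intro in_Lp_dominated(2)[OF p0(1) in_Lp_diff[OF p0(1) f tL]]) (auto simp: t_def)
      finally show "(\<integral>x. \<bar>av N (t k) x - av N (t j) x\<bar> powr p \<partial>M) \<le> \<delta> j" by (simp add: av_diff \<delta>_def)
    qed
  qed
  have mono: "AE x in M. \<forall>k. g k x \<le> g (Suc k) x"
    unfolding AE_all_countable
  proof
    fix k show "AE x in M. g k x \<le> g (Suc k) x"
      using lim[of k] lim[of "Suc k"]
    proof eventually_elim
      case (elim x)
      have "av N (t k) x \<le> av N (t (Suc k)) x" for N by (intro av_mono) (auto simp: t_def)
      then show ?case using elim by (intro LIMSEQ_le[OF elim]) auto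
    qed
  qed
  \<comment> \<open>Truncation at level 0 leaves nothing, so \<open>g_dist\<close> with
    \<open>j = 0\<close> bounds the \<open>p\<close>-th moments of all \<open>g k\<close> by
    \<open>\<delta> 0\<close>, and monotonicity makes \<open>g k\<close> nonnegative almost
    everywhere.\<close>
  have g00: "g 0 x = 0" for x using g(2)[of 0 x] by simp
  define u where "u k x = ennreal (\<bar>g k x\<bar> powr p)" for k x
  have um[measurable]: "u k \<in> borel_measurable M" for k unfolding u_def by measurable
  have u_mono: "AE x in M. u k x \<le> u (Suc k) x" for k
    using mono
  proof eventually_elim
    case (elim x)
    have "incseq (\<lambda>k. g k x)" using elim by (intro incseq_SucI) auto
    then have "0 \<le> g k x" using g00[of x] by (metis incseqD le0)
    then show ?case unfolding u_def using elim p0 by (intro ennreal_leI powr_mono2) (auto intro: order_trans)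
  qed
  have "(\<integral>\<^sup>+x. (SUP k. u k x) \<partial>M) = (SUP k. \<integral>\<^sup>+x. u k x \<partial>M)"
    by (rule nn_integral_monotone_convergence_SUP_AE) (rule u_mono um)+
  also have "\<dots> \<le> ennreal (\<delta> 0)"
  proof (rule SUP_least)
    fix k
    have "(\<integral>\<^sup>+x. u k x \<partial>M) = ennreal (\<integral>x. \<bar>g k x\<bar> powr p \<partial>M)"
      unfolding u_def using gL[of k] by (intro nn_integral_eq_integral) (auto simp: in_Lp_def)
    also have "\<dots> \<le> ennreal (\<delta> 0)" using g_dist[of 0 k] by (intro ennreal_leI) (simp add: g00)
    finally show "(\<integral>\<^sup>+x. u k x \<partial>M) \<le> ennreal (\<delta> 0)" .
  qed
  finally have "(\<integral>\<^sup>+x. (SUP k. u k x) \<partial>M) \<noteq> \<infinity>" by (auto simp: top_unique)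
  then have "AE x in M. (SUP k. u k x) \<noteq> \<infinity>" by (intro nn_integral_PInf_AE) auto
  then have conv: "AE x in M. (\<lambda>k. g k x) \<longlonglongrightarrow> lim (\<lambda>k. g k x)"
    using mono
  proof eventually_elim
    case (elim x)
    obtain c where c: "(SUP k. u k x) = ennreal c" "c \<ge> 0" using elim(1) by (cases "SUP k. u k x") auto
    \<comment> \<open>Either the value is at most 1, or it is at most its \<open>p\<close>-th power,
      hence at most \<open>c\<close>.\<close>
    have "g k x \<le> 1 + c" for k
    proof -
      have "u k x \<le> ennreal c" unfolding c(1)[symmetric] by (rule SUP_upper) simp
      then have le: "\<bar>g k x\<bar> powr p \<le> c" unfolding u_def using c(2) by simp
      show ?thesis
      proof (cases "g k x \<le> 1")
        case False
        then have "\<bar>g k x\<bar> powr 1 \<le> \<bar>g k x\<bar> powr p" using p by (intro powr_mono) auto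
        then show ?thesis using False le by simp
      qed (use c in simp)
    qed
    moreover have "incseq (\<lambda>k. g k x)" using elim by (intro incseq_SucI) auto
    ultimately have "convergent (\<lambda>k. g k x)" using incseq_convergent[of "\<lambda>k. g k x" "1 + c"] convergentI by metis
    then show ?case by (simp add: convergent_LIMSEQ_iff)
  qed
  define h where "h x = lim (\<lambda>k. g k x)" for x
  have hm[measurable]: "h \<in> borel_measurable M" unfolding h_def by measurable
  \<comment> \<open>Fatou's lemma in \<open>k\<close> transfers the distance bound of
    \<open>g_dist\<close> from \<open>g k\<close> to \<open>h\<close>. Working with extended
    nonnegative integrals avoids presupposing integrability, which is deduced from this
    bound.\<close>
  have fatou: "(\<integral>\<^sup>+x. ennreal (\<bar>h x - g j x\<bar> powr p) \<partial>M) \<le> ennreal (\<delta> j)" for j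
  proof -
    have "(\<integral>\<^sup>+x. ennreal (\<bar>h x - g j x\<bar> powr p) \<partial>M) = (\<integral>\<^sup>+x. liminf (\<lambda>k. ennreal (\<bar>g k x - g j x\<bar> powr p)) \<partial>M)"
    proof (rule nn_integral_cong_AE, use conv in eventually_elim)
      case (elim x)
      have "(\<lambda>k. \<bar>g k x - g j x\<bar> powr p) \<longlonglongrightarrow> \<bar>h x - g j x\<bar> powr p"
        unfolding h_def by (intro tendsto_powr' tendsto_rabs tendsto_diff elim tendsto_const) (use p0 in auto)
      then have "(\<lambda>k. ennreal (\<bar>g k x - g j x\<bar> powr p)) \<longlonglongrightarrow> ennreal (\<bar>h x - g j x\<bar> powr p)"
        by (rule tendsto_ennrealI)
      from lim_imp_Liminf[OF sequentially_bot this] show ?case by simp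
    qed
    also have "\<dots> \<le> liminf (\<lambda>k. \<integral>\<^sup>+x. ennreal (\<bar>g k x - g j x\<bar> powr p) \<partial>M)"
      by (rule nn_integral_liminf) measurable
    also have "\<dots> \<le> liminf (\<lambda>k. ennreal (\<delta> j))"
    proof (rule Liminf_mono, use eventually_ge_at_top[of j] in eventually_elim)
      case (elim k)
      have "(\<integral>\<^sup>+x. ennreal (\<bar>g k x - g j x\<bar> powr p) \<partial>M) = ennreal (\<integral>x. \<bar>g k x - g j x\<bar> powr p \<partial>M)"
        using in_Lp_diff[OF p0(1) gL gL, of k j] by (intro nn_integral_eq_integral) (auto simp: in_Lp_def)
      then show ?case using g_dist[OF elim] by (simp add: ennreal_leI)
    qed
    also have "\<dots> = ennreal (\<delta> j)" by (simp add: Liminf_const)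
    finally show ?thesis .
  qed
  have \<delta>0: "\<delta> j \<ge> 0" for j unfolding \<delta>_def by (intro integral_nonneg_AE) auto
  have hg: "integrable M (\<lambda>x. \<bar>h x - g j x\<bar> powr p)" for j
    using fatou[of j] by (intro integrableI_nonneg) (auto intro: le_less_trans)
  have hg_le: "(\<integral>x. \<bar>h x - g j x\<bar> powr p \<partial>M) \<le> \<delta> j" for j
    using fatou[of j] \<delta>0[of j] nn_integral_eq_integral[OF hg, of j] by simp
  have hL: "in_Lp M p h" using hg[of 0] by (simp add: in_Lp_def g00)
  define C where "C = 2 powr p"
  have bound: "(\<integral>x. \<bar>av N f x - h x\<bar> powr p \<partial>M) \<le> C * (\<delta> j + C * ((\<integral>x. \<bar>av N (t j) x - g j x\<bar> powr p \<partial>M) + \<delta> j))" for N j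
  proof -
    have L1: "in_Lp M p (\<lambda>x. av N (t j) x - g j x)" "in_Lp M p (\<lambda>x. g j x - h x)" "in_Lp M p (\<lambda>x. av N f x - av N (t j) x)"
      by (intro in_Lp_diff p0 av_Lp p tL gL hL f)+
    have "(\<integral>x. \<bar>(av N f x - av N (t j) x) + ((av N (t j) x - g j x) + (g j x - h x))\<bar> powr p \<partial>M)
        \<le> C * ((\<integral>x. \<bar>av N f x - av N (t j) x\<bar> powr p \<partial>M) + (\<integral>x. \<bar>(av N (t j) x - g j x) + (g j x - h x)\<bar> powr p \<partial>M))"
      unfolding C_def by (rule in_Lp_add(2)[OF p0(1) L1(3) in_Lp_add(1)[OF p0(1) L1(1,2)]])
    also have "\<dots> \<le> C * (\<delta> j + C * ((\<integral>x. \<bar>av N (t j) x - g j x\<bar> powr p \<partial>M) + \<delta> j))"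
    proof (intro mult_left_mono add_mono)
      show "(\<integral>x. \<bar>av N f x - av N (t j) x\<bar> powr p \<partial>M) \<le> \<delta> j"
        using av_Lp(2)[OF p in_Lp_diff[OF p0(1) f tL], of N j] by (simp add: av_diff \<delta>_def)
      have "(\<integral>x. \<bar>(av N (t j) x - g j x) + (g j x - h x)\<bar> powr p \<partial>M)
          \<le> C * ((\<integral>x. \<bar>av N (t j) x - g j x\<bar> powr p \<partial>M) + (\<integral>x. \<bar>g j x - h x\<bar> powr p \<partial>M))"
        unfolding C_def by (rule in_Lp_add(2)[OF p0(1) L1(1,2)])
      also have "\<dots> \<le> C * ((\<integral>x. \<bar>av N (t j) x - g j x\<bar> powr p \<partial>M) + \<delta> j)"
        using hg_le[of j] by (intro mult_left_mono add_mono) (auto simp: C_def abs_minus_commute)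
      finally show "(\<integral>x. \<bar>(av N (t j) x - g j x) + (g j x - h x)\<bar> powr p \<partial>M)
          \<le> C * ((\<integral>x. \<bar>av N (t j) x - g j x\<bar> powr p \<partial>M) + \<delta> j)" .
    qed (simp add: C_def)
    finally show ?thesis by simp
  qed
  have "(\<lambda>N. \<integral>x. \<bar>av N f x - h x\<bar> powr p \<partial>M) \<longlonglongrightarrow> 0"
  proof (rule LIMSEQ_I)
    fix r :: real assume r: "r > 0"
    have "(\<lambda>j. C * (\<delta> j + C * (0 + \<delta> j))) \<longlonglongrightarrow> C * (0 + C * (0 + 0))" by (intro tendsto_intros \<delta>_lim)
    then have "\<forall>\<^sub>F j in sequentially. C * (\<delta> j + C * (0 + \<delta> j)) < r" by (rule order_tendstoD) (use r in simp)
    then obtain j where j: "C * (\<delta> j + C * (0 + \<delta> j)) < r" by (auto simp: eventually_sequentially)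
    have "(\<lambda>N. C * (\<delta> j + C * ((\<integral>x. \<bar>av N (t j) x - g j x\<bar> powr p \<partial>M) + \<delta> j))) \<longlonglongrightarrow> C * (\<delta> j + C * (0 + \<delta> j))"
      by (intro tendsto_intros lim0)
    then have "\<forall>\<^sub>F N in sequentially. C * (\<delta> j + C * ((\<integral>x. \<bar>av N (t j) x - g j x\<bar> powr p \<partial>M) + \<delta> j)) < r"
      by (rule order_tendstoD) (rule j)
    then have "\<forall>\<^sub>F N in sequentially. norm ((\<integral>x. \<bar>av N f x - h x\<bar> powr p \<partial>M) - 0) < r"
    proof eventually_elim
      case (elim N)
      have "0 \<le> (\<integral>x. \<bar>av N f x - h x\<bar> powr p \<partial>M)" by (intro integral_nonneg_AE) auto
      then show ?case using bound[of N j] elim by simp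
    qed
    then show "\<exists>no. \<forall>N\<ge>no. norm ((\<integral>x. \<bar>av N f x - h x\<bar> powr p \<partial>M) - 0) < r" by (simp add: eventually_sequentially)
  qed
  then show ?thesis using hL by (auto simp: Lp_convergent_def)
qed

lemma Lp_convergent_av:
  assumes bdd: "\<And>f. bmf M f \<Longrightarrow> AE x in M. convergent (\<lambda>N. av N f x)"
    and p: "p \<ge> 1" and f: "in_Lp M p f"
  shows "Lp_convergent M p (\<lambda>N. av N f)"
proof -
  have p0: "p \<ge> 0" using p by simp
  have [measurable]: "f \<in> borel_measurable M" using f by (simp add: in_Lp_def)
  have L: "in_Lp M p (\<lambda>x. max (f x) 0)" "in_Lp M p (\<lambda>x. max (- f x) 0)"
    by (rule in_Lp_dominated(1)[OF p0 f]; auto)+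
  have "Lp_convergent M p (\<lambda>N x. av N (\<lambda>x. max (f x) 0) x - av N (\<lambda>x. max (- f x) 0) x)"
    by (intro Lp_convergent_diff p0 av_Lp p L Lp_convergent_av_nonneg bdd) auto
  moreover have "(\<lambda>x. max (f x) 0 - max (- f x) 0) = f" by (auto simp: max_def)
  ultimately show ?thesis by (simp add: av_diff[symmetric])
qed

end

lemma Lp_convergent_avg:
  assumes G: "fin_digraph G" and M: "prob_space M" and T: "\<And>e. e \<in> arcs G \<Longrightarrow> mpt M (T e)"
    and u: "u \<in> verts G" and W: "W \<subseteq> verts G" and p: "p \<ge> 1" and f: "in_Lp M p f"
  shows "Lp_convergent M p (\<lambda>N x. (1 / real N) * (\<Sum>n<N. avg_op T (\<Union>v\<in>W. paths_uv G u v n) f x))"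
proof -
  define L where "L n = (\<Union>v\<in>W. paths_uv G u v n)" for n
  have "finite W" using W G finite_subset fin_digraph.finite_verts by metis
  then have finL: "finite (L n)" for n unfolding L_def using finite_paths_uv[OF G] by blast
  define I where "I N = (SIGMA n:{..<N}. L n)" for N
  define wt where "wt N i = 1 / (real N * real (card (L (fst i))))" for N and i :: "nat \<times> 'b list"
  interpret mp_averages M I wt "\<lambda>i. path_map T (snd i)"
  proof (intro mp_averages.intro mp_averages_axioms.intro M)
    fix N
    show "finite (I N)" unfolding I_def using finL by auto
    show "0 \<le> wt N i" for i by (simp add: wt_def)
    have "(\<Sum>i\<in>I N. wt N i) = (\<Sum>n<N. \<Sum>l\<in>L n. wt N (n, l))"
      unfolding I_def using finL by (subst sum.Sigma) auto
    \<comment> \<open>Only an inequality: a length \<open>n\<close> without paths contributes 0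
      instead of \<open>1 / N\<close>.\<close>
    also have "\<dots> \<le> (\<Sum>n<N. 1 / real N)" by (rule sum_mono) (simp add: wt_def divide_simps)
    also have "\<dots> \<le> 1" by simp
    finally show "(\<Sum>i\<in>I N. wt N i) \<le> 1" .
    fix i assume "i \<in> I N"
    then obtain v where "snd i \<in> paths_uv G u v (fst i)" by (auto simp: I_def L_def)
    then show "mpt M (path_map T (snd i))" using paths_uv_arcs[of "snd i" G u v "fst i"] T by (intro mpt_path_map) blast
  qed
  have eq: "av N g x = (1 / real N) * (\<Sum>n<N. avg_op T (L n) g x)" for N g x
  proof -
    have "av N g x = (\<Sum>n<N. \<Sum>l\<in>L n. wt N (n, l) * g (path_map T l x))"
      unfolding av_def I_def using finL by (subst sum.Sigma) (auto simp: split_beta)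
    also have "\<dots> = (1 / real N) * (\<Sum>n<N. avg_op T (L n) g x)"
      unfolding sum_distrib_left by (rule sum.cong[OF refl]) (auto simp: avg_op_def wt_def sum_distrib_left sum_divide_distrib mult.commute)
    finally show ?thesis .
  qed
  have "Lp_convergent M p (\<lambda>N. av N f)"
  proof (rule Lp_convergent_av[OF _ p f])
    fix g :: "'c \<Rightarrow> real" assume "bmf M g"
    from AE_convergent_avg_bounded[OF G M T u W this]
    show "AE x in M. convergent (\<lambda>N. av N g x)" unfolding eq L_def .
  qed
  then show ?thesis by (simp add: eq[abs_def] L_def)
qed

theorem theorem2:
  fixes G :: "('a,'b) pre_digraph" and M :: "'x measure"
    and T :: "'b \<Rightarrow> 'x \<Rightarrow> 'x"
  assumes "fin_digraph G"
    and "prob_space M"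
    and "\<And>e. e \<in> arcs G \<Longrightarrow> mpt M (T e)"
    and "u \<in> verts G" and "v \<in> verts G" and "v0 \<in> verts G"
  shows "(\<forall>p::real. p \<ge> 1 \<longrightarrow> (\<forall>\<phi>. in_Lp M p \<phi> \<longrightarrow>
            Lp_convergent M p (\<lambda>N. c_uv G T u v N \<phi>)))
    \<and> (\<forall>\<phi>. in_Linf M \<phi> \<longrightarrow>
            (AE x in M. convergent (\<lambda>N. c_uv G T u v N \<phi> x)))
    \<and> (\<forall>p::real. p \<ge> 1 \<longrightarrow> (\<forall>\<phi>. in_Lp M p \<phi> \<longrightarrow>
            Lp_convergent M p (\<lambda>N. c_u G T v0 N \<phi>)))
    \<and> (\<forall>\<phi>. in_Linf M \<phi> \<longrightarrow>
            (AE x in M. convergent (\<lambda>N. c_u G T v0 N \<phi> x)))"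
proof -
  have uv: "c_uv G T u v N \<phi> x = (1 / real N) * (\<Sum>n<N. avg_op T (\<Union>v\<in>{v}. paths_uv G u v n) \<phi> x)" for N \<phi> x
    by (simp add: c_uv_def)
  have vs: "c_u G T v0 N \<phi> x = (1 / real N) * (\<Sum>n<N. avg_op T (\<Union>v\<in>verts G. paths_uv G v0 v n) \<phi> x)" for N \<phi> x
    by (simp add: c_u_def paths_u_def)
  have v: "{v} \<subseteq> verts G" using assms by simp
  have Lp: "Lp_convergent M p (\<lambda>N x. (1 / real N) * (\<Sum>n<N. avg_op T (\<Union>v\<in>W. paths_uv G u v n) \<phi> x))"
    if "u \<in> verts G" "W \<subseteq> verts G" "p \<ge> 1" "in_Lp M p \<phi>" for u W p \<phi>
    by (rule Lp_convergent_avg[OF assms(1,2) _ that]) (rule assms(3))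
  have AE: "AE x in M. convergent (\<lambda>N. (1 / real N) * (\<Sum>n<N. avg_op T (\<Union>v\<in>W. paths_uv G u v n) \<phi> x))"
    if "u \<in> verts G" "W \<subseteq> verts G" "in_Linf M \<phi>" for u W \<phi>
    by (rule AE_convergent_avg[OF assms(1,2) _ that]) (rule assms(3))
  show ?thesis unfolding uv[abs_def] vs[abs_def]
    by (intro conjI allI impI Lp AE assms v order_refl)
qed

end
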